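(* Let $0\le k<1$ and $0\le p<1$. Suppose that $f\in\Sigma_k(p)$ is expressed in the form $$f(z)=\frac{1}{z-p}+\sum_{n=0}^{\infty}a_n z^n,\qquad |z|<1.$$ Then $$\sum_{n=1}^{\infty}n|a_n|^2\le \frac{k^2}{(1-p^2)^2}.$$ Here, equality holds if and only if $f$ is of the form $$f(z)=\frac1{z-p}+a_0+\frac{a_1z}{1-pz}\qquad\text{for } |z|<1,$$ where $a_0$ and $a_1$ are (complex) constants with $|a_1|=k$. Moreover, a $k$-quasiconformal extension of this $f$ to $\widehat{\mathbb C}$ is given by setting $$f(z)=\frac1{z-p}+a_0+\frac{a_1}{\bar z-p}\qquad\text{for } |z|\ge 1.$$
   Context: $\widehat{\mathbb C}=\mathbb C\cup\{\infty\}$ is the extended complex plane and $\mathbb D=\{z\in\mathbb C:|z|<1\}$. For $p\in[0,1)$, $\Sigma(p)$ is the class of meromorphic univalent (injective) functions $f$ in $\mathbb D$ with a simple pole at $z=p$ of residue $1$; since $f(z)-1/(z-p)$ is analytic in $\mathbb D$, each such $f$ has an expansion $f(z)=\frac1{z-p}+\sum_{n=0}^\infty a_nz^n$, $|z|<1$ (the power series converging in $\mathbb D$). For $0\le k<1$, a mapping $F:\widehat{\mathbb C}\to\widehat{\mathbb C}$ is called $k$-quasiconformal if $F$ is a homeomorphism and has locally $L^2$ distributional derivatives on $\mathbb C\setminus\{F^{-1}(\infty)\}$ satisfying $|\bar\partial F|\le k|\partial F|$ a.e., where $\partial F=\partial F/\partial z$ and $\bar\partial F=\partial F/\partial\bar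 z$. $\Sigma_k(p)$ is the class of those $f\in\Sigma(p)$ which admit a $k$-quasiconformal extension to $\widehat{\mathbb C}$, i.e. for which there is a $k$-quasiconformal $F:\widehat{\mathbb C}\to\widehat{\mathbb C}$ with $F|_{\mathbb D}=f$. In the formula for $|z|\ge1$, the value at $z=\infty$ is understood by continuity. *)

theory Defs
  imports "HOL-Complex_Analysis.Complex_Analysis"
begin

text \<open>The extended plane is the one-point compactification of \<open>\<complex>\<close>:
  \<open>Some z\<close> is the finite point \<open>z\<close> and \<open>None\<close> is \<open>\<infinity>\<close>.\<close>

abbreviation ext_plane :: "complex option topology" where
  "ext_plane \<equiv> Alexandroff_compactification euclidean"

abbreviation unit_disc :: "complex set" where
  "unit_disc \<equiv> ball 0 1"

text \<open>Meromorphic functions are represented by maps into the extended plane, so that poles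
  carry the value \<open>None\<close> and injectivity takes the value \<open>\<infinity>\<close> into account.
  Since \<open>meromorphic_on\<close> alone constrains no individual function values,
  the value at each point is pinned down separately. Values outside \<open>A\<close> are irrelevant.\<close>

definition meromorphic_map_on :: "(complex \<Rightarrow> complex option) \<Rightarrow> complex set \<Rightarrow> bool" where
  "meromorphic_map_on f A \<longleftrightarrow>
     (\<lambda>z. the (f z)) meromorphic_on A \<and>
     (\<forall>z\<in>A. if f z = None then is_pole (\<lambda>z. the (f z)) z
             else (\<lambda>z. the (f z)) analytic_on {z})"

definition Sigma_class :: "real \<Rightarrow> (complex \<Rightarrow> complex option) set" where
  "Sigma_class p = {f. meromorphic_map_on f unit_disc \<and> inj_on f unit_disc \<and>
     f (of_real p) = None \<and>
     zorder (\<lambda>z. the (f z)) (of_real p) = -1 \<and>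
     residue (\<lambda>z. the (f z)) (of_real p) = 1}"

text \<open>\<open>C\<^sup>n\<close> in the real sense on \<open>\<complex> = \<real>\<^sup>2\<close>; the Frechet derivatives in the directions
  \<open>1\<close> and \<open>\<i>\<close> are the partial derivatives in \<open>x\<close> and \<open>y\<close>.\<close>

primrec C_k :: "nat \<Rightarrow> (complex \<Rightarrow> complex) \<Rightarrow> bool" where
  "C_k 0 \<phi> \<longleftrightarrow> continuous_on UNIV \<phi>"
| "C_k (Suc n) \<phi> \<longleftrightarrow> (\<forall>z. \<phi> differentiable (at z)) \<and>
     C_k n (\<lambda>z. frechet_derivative \<phi> (at z) 1) \<and>
     C_k n (\<lambda>z. frechet_derivative \<phi> (at z) \<i>)"

definition test_functions :: "complex set \<Rightarrow> (complex \<Rightarrow> complex) set" where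
  "test_functions U = {\<phi>. (\<forall>n. C_k n \<phi>) \<and>
     compact (closure {z. \<phi> z \<noteq> 0}) \<and> closure {z. \<phi> z \<noteq> 0} \<subseteq> U}"

definition d_z :: "(complex \<Rightarrow> complex) \<Rightarrow> complex \<Rightarrow> complex" where
  "d_z \<phi> z = (frechet_derivative \<phi> (at z) 1 - \<i> * frechet_derivative \<phi> (at z) \<i>) / 2"

definition d_zbar :: "(complex \<Rightarrow> complex) \<Rightarrow> complex \<Rightarrow> complex" where
  "d_zbar \<phi> z = (frechet_derivative \<phi> (at z) 1 + \<i> * frechet_derivative \<phi> (at z) \<i>) / 2"

definition locally_L2_on :: "complex set \<Rightarrow> (complex \<Rightarrow> complex) \<Rightarrow> bool" where
  "locally_L2_on U h \<longleftrightarrow> set_borel_measurable lebesgue U h \<and>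
     (\<forall>K. compact K \<and> K \<subseteq> U \<longrightarrow> set_integrable lebesgue K (\<lambda>z. (cmod (h z))\<^sup>2))"

text \<open>\<open>h\<close> represents the distributional derivative of \<open>g\<close> on the open set \<open>U\<close>. These are
  used only for \<open>g\<close> continuous on \<open>U\<close> and \<open>h\<close> locally \<open>L\<^sup>2\<close>, where all the integrals converge
  (the test functions vanish outside a compact subset of \<open>U\<close>).\<close>

definition distr_d_z_on :: "complex set \<Rightarrow> (complex \<Rightarrow> complex) \<Rightarrow> (complex \<Rightarrow> complex) \<Rightarrow> bool" where
  "distr_d_z_on U g h \<longleftrightarrow> (\<forall>\<phi>\<in>test_functions U.
     (LINT z:U|lebesgue. h z * \<phi> z) = - (LINT z:U|lebesgue. g z * d_z \<phi> z))"

definition distr_d_zbar_on :: "complex set \<Rightarrow> (complex \<Rightarrow> complex) \<Rightarrow> (complex \<Rightarrow> complex) \<Rightarrow> bool" where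
  "distr_d_zbar_on U g h \<longleftrightarrow> (\<forall>\<phi>\<in>test_functions U.
     (LINT z:U|lebesgue. h z * \<phi> z) = - (LINT z:U|lebesgue. g z * d_zbar \<phi> z))"

text \<open>Below \<open>U\<close> is \<open>\<complex>\<close> without the preimage of \<open>\<infinity>\<close>, \<open>g\<close> is the finite part of \<open>F\<close> on \<open>U\<close>,
  and \<open>h\<^sub>1\<close>, \<open>h\<^sub>2\<close> represent \<open>\<partial>F/\<partial>z\<close> and its conjugate counterpart \<open>\<partial>F/\<partial>(cnj z)\<close>.\<close>

definition quasiconformal :: "real \<Rightarrow> (complex option \<Rightarrow> complex option) \<Rightarrow> bool" where
  "quasiconformal k F \<longleftrightarrow> homeomorphic_map ext_plane ext_plane F \<and>
     (let U = {z. F (Some z) \<noteq> None}; g = (\<lambda>z. the (F (Some z))) in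
      \<exists>h\<^sub>1 h\<^sub>2. locally_L2_on U h\<^sub>1 \<and> locally_L2_on U h\<^sub>2 \<and>
        distr_d_z_on U g h\<^sub>1 \<and> distr_d_zbar_on U g h\<^sub>2 \<and>
        (AE z in lebesgue. z \<in> U \<longrightarrow> cmod (h\<^sub>2 z) \<le> k * cmod (h\<^sub>1 z)))"

definition quasiconformal_extension ::
    "real \<Rightarrow> (complex \<Rightarrow> complex option) \<Rightarrow> (complex option \<Rightarrow> complex option) \<Rightarrow> bool" where
  "quasiconformal_extension k f F \<longleftrightarrow> quasiconformal k F \<and> (\<forall>z\<in>unit_disc. F (Some z) = f z)"

definition Sigma_qc_class :: "real \<Rightarrow> real \<Rightarrow> (complex \<Rightarrow> complex option) set" where
  "Sigma_qc_class k p = {f \<in> Sigma_class p. \<exists>F. quasiconformal_extension k f F}"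

text \<open>The case distinction at \<open>p\<close> is needed because \<open>1 / 0 = 0\<close> in HOL.\<close>

definition has_Sigma_expansion :: "(complex \<Rightarrow> complex option) \<Rightarrow> real \<Rightarrow> (nat \<Rightarrow> complex) \<Rightarrow> bool" where
  "has_Sigma_expansion f p a \<longleftrightarrow> (\<forall>z\<in>unit_disc.
     summable (\<lambda>n. a n * z ^ n) \<and>
     f z = (if z = of_real p then None else Some (1 / (z - of_real p) + (\<Sum>n. a n * z ^ n))))"

definition extremal_map :: "real \<Rightarrow> complex \<Rightarrow> complex \<Rightarrow> complex \<Rightarrow> complex option" where
  "extremal_map p c\<^sub>0 c\<^sub>1 z =
     (if z = of_real p then None
      else Some (1 / (z - of_real p) + c\<^sub>0 + c\<^sub>1 * z / (1 - of_real p * z)))"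

text \<open>At \<open>\<infinity>\<close> the value is \<open>c\<^sub>0\<close>, the limit of the formula for \<open>1 \<le> cmod z\<close>.\<close>

definition extremal_extension :: "real \<Rightarrow> complex \<Rightarrow> complex \<Rightarrow> complex option \<Rightarrow> complex option" where
  "extremal_extension p c\<^sub>0 c\<^sub>1 w = (case w of
       None \<Rightarrow> Some c\<^sub>0
     | Some z \<Rightarrow> if cmod z < 1 then extremal_map p c\<^sub>0 c\<^sub>1 z
                else Some (1 / (z - of_real p) + c\<^sub>0 + c\<^sub>1 / (cnj z - of_real p)))"

end

theory Submission
  imports Defs
begin

text \<open>Let \<open>F\<close> be the extension of \<open>f\<close> and \<open>q = 1 / (z - p)\<^sup>2\<close>.  Subtracting the pole leaves \<open>g = F - 1 / (z - p)\<close>, which is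
continuous and bounded on the whole plane and equals \<open>\<Sum>n. a\<^sub>n z\<^sup>n\<close> in the disc.  Write \<open>h\<close> and \<open>w\<close> for its weak derivatives
with respect to \<open>z\<close> and \<open>cnj z\<close>.  Inside the disc \<open>w = 0\<close> and \<open>h\<close> is the ordinary derivative; outside, the dilatation
bound for \<open>F\<close> says \<open>cmod w \<le> k * cmod (h - q)\<close>.  This is the reduction \<open>qc_reduction\<close>; from there on only \<open>g\<close>, \<open>h\<close> and \<open>w\<close>
matter, so that univalence enters through the homeomorphism \<open>F\<close> alone.

For a bounded function with square integrable weak derivatives the Jacobian integrates to zero, that is
\<open>\<integral> (cmod h)\<^sup>2 = \<integral> (cmod w)\<^sup>2\<close> (\<open>energy_identity\<close>), and the polarised form of this identity (\<open>global_pairing\<close>) relates \<open>g\<close> to any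
second such function.  The second function of interest is \<open>e = z / (1 - p z)\<close> inside and \<open>e = 1 / (cnj z - p)\<close> outside the
disc (\<open>reflected_pole\<close>).  Its \<open>z\<close>-derivative lives inside, where \<open>w\<close> vanishes, and its \<open>cnj z\<close>-derivative is \<open>- cnj q\<close>
outside; hence \<open>h\<close> is orthogonal to \<open>q\<close> on the exterior.  Let \<open>A\<close> and \<open>B\<close> be the integrals of \<open>(cmod h)\<^sup>2\<close> inside and outside, and
\<open>P = \<pi> / (1 - p\<^sup>2)\<^sup>2\<close> the integral of \<open>(cmod q)\<^sup>2\<close> outside.  Then
\<open>A + B = \<integral> (cmod w)\<^sup>2 \<le> k\<^sup>2 * \<integral> (cmod (h - q))\<^sup>2 = k\<^sup>2 * (B + P)\<close>, so \<open>A \<le> k\<^sup>2 * P - (1 - k\<^sup>2) * B \<le> k\<^sup>2 * P\<close>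
(\<open>exterior_energy\<close>).  Since \<open>A = \<pi> * (\<Sum>n. n * (cmod a\<^sub>n)\<^sup>2)\<close> by the area formula (\<open>disc_area_formula\<close>), this is the inequality.

In the case of equality \<open>B = 0\<close>, so \<open>cnj g\<close> is holomorphic outside the disc by Weyl's lemma, and its derivative divided by \<open>q\<close>
has the constant modulus \<open>k\<close>.  Therefore \<open>g = c\<^sub>0 + c\<^sub>1 * e\<close> outside, and by the maximum principle also inside
(\<open>equality_case\<close>).  Conversely, the extension \<open>1 / (z - p) + c\<^sub>0 + c\<^sub>1 * e\<close> has \<open>z\<close>-derivative \<open>- q\<close> and \<open>cnj z\<close>-derivative
\<open>- c\<^sub>1 * cnj q\<close> outside the disc, so its dilatation is at most \<open>k = cmod c\<^sub>1\<close>.  It is a homeomorphism of the sphere because in the coordinate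
\<open>\<zeta> = 1 / (z - p)\<close> it is \<open>\<zeta> + c\<^sub>0 + c\<^sub>1 * \<sigma> \<zeta>\<close> with a nonexpansive map \<open>\<sigma>\<close>, and \<open>cmod c\<^sub>1 < 1\<close>
(\<open>extremal_extension_homeomorphism\<close>).

The analysis behind the pairings is by mollification.  Convolution with a smooth bump converges locally in the mean
(\<open>conv_moll_tendsto_L2\<close>) and commutes with weak differentiation (\<open>d_z_conv\<close>); testing with a cutoff times a mollified
function, and using that second derivatives commute, gives a pairing with boundary terms (\<open>local_pairing\<close>).  A Caccioppoli
estimate shows that the energy of \<open>g\<close> is finite up to infinity (\<open>energy_finite\<close>), and then the boundary terms tend to zero.\<close>

section \<open>Smooth functions\<close>

definition smooth :: "(complex \<Rightarrow> complex) \<Rightarrow> bool" where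
  "smooth \<phi> \<longleftrightarrow> (\<forall>n. C_k n \<phi>)"

abbreviation d_x :: "(complex \<Rightarrow> complex) \<Rightarrow> complex \<Rightarrow> complex" where
  "d_x \<phi> z \<equiv> frechet_derivative \<phi> (at z) 1"
abbreviation d_y :: "(complex \<Rightarrow> complex) \<Rightarrow> complex \<Rightarrow> complex" where
  "d_y \<phi> z \<equiv> frechet_derivative \<phi> (at z) \<i>"

lemma C_k_Suc_imp: "C_k (Suc n) \<phi> \<Longrightarrow> C_k n \<phi>"
proof (induction n arbitrary: \<phi>)
  case 0
  then show ?case
    by (simp add: continuous_on_eq_continuous_at differentiable_imp_continuous_within)
next
  case (Suc n)
  then show ?case by (metis C_k.simps(2))
qed

lemma C_k_SucI:
  assumes "\<And>z. (\<phi> has_derivative D z) (at z)" "C_k n (\<lambda>z. D z 1)" "C_k n (\<lambda>z. D z \<i>)"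
  shows "C_k (Suc n) \<phi>"
proof -
  have "frechet_derivative \<phi> (at z) = D z" for z
    using assms(1) frechet_derivative_at by metis
  then show ?thesis using assms by (auto simp: differentiable_def)
qed

lemma C_k_derivative:
  assumes "C_k (Suc n) \<phi>"
  shows "(\<phi> has_derivative frechet_derivative \<phi> (at z)) (at z)"
  using assms frechet_derivative_works by auto

lemma C_k_const [simp]: "C_k n (\<lambda>_. c)"
proof (induction n arbitrary: c)
  case (Suc n)
  show ?case by (rule C_k_SucI[where D = "\<lambda>_ _. 0"]) (use Suc in auto)
qed auto

lemma C_k_add: "C_k n \<phi> \<Longrightarrow> C_k n \<psi> \<Longrightarrow> C_k n (\<lambda>z. \<phi> z + \<psi> z)"
proof (induction n arbitrary: \<phi> \<psi>)
  case (Suc n)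
  show ?case
    by (rule C_k_SucI[where D = "\<lambda>z d. frechet_derivative \<phi> (at z) d + frechet_derivative \<psi> (at z) d"])
      (use Suc C_k_derivative[OF Suc.prems(1)] C_k_derivative[OF Suc.prems(2)] in
        \<open>auto intro!: has_derivative_add\<close>)
qed (auto intro: continuous_intros)

lemma C_k_mult: "C_k n \<phi> \<Longrightarrow> C_k n \<psi> \<Longrightarrow> C_k n (\<lambda>z. \<phi> z * \<psi> z)"
proof (induction n arbitrary: \<phi> \<psi>)
  case (Suc n)
  have l: "C_k n \<phi>" "C_k n \<psi>" using Suc.prems C_k_Suc_imp by blast+
  show ?case
    by (rule C_k_SucI[where D = "\<lambda>z d. \<phi> z * frechet_derivative \<psi> (at z) d + frechet_derivative \<phi> (at z) d * \<psi> z"])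
      (use Suc l C_k_derivative[OF Suc.prems(1)] C_k_derivative[OF Suc.prems(2)] in
        \<open>auto intro!: has_derivative_mult C_k_add Suc.IH\<close>)
qed (auto intro: continuous_intros)

lemma C_k_linear:
  assumes "bounded_linear L" shows "C_k n L"
proof (cases n)
  case 0
  then show ?thesis using assms by (simp add: linear_continuous_on)
next
  case (Suc m)
  show ?thesis unfolding Suc
    by (rule C_k_SucI[where D = "\<lambda>_. L"]) (use assms in \<open>auto intro: bounded_linear_imp_has_derivative\<close>)
qed

lemma C_k_linear_comp:
  assumes L: "bounded_linear L"
  shows "C_k n \<phi> \<Longrightarrow> C_k n (\<lambda>z. L (\<phi> z))"
proof (induction n arbitrary: \<phi>)
  case 0 then show ?case
    using bounded_linear.continuous_on[OF L] by auto
next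
  case (Suc n)
  show ?case
    by (rule C_k_SucI[where D = "\<lambda>z d. L (frechet_derivative \<phi> (at z) d)"])
      (use Suc C_k_derivative[OF Suc.prems(1)] in \<open>auto intro!: bounded_linear.has_derivative[OF L]\<close>)
qed

text \<open>Real dilations, translations and reflections are all the changes of variables that occur below: they turn one bump into a
sequence of mollifiers and of cutoffs.\<close>

lemma C_k_affine:
  fixes c :: real
  shows "C_k n \<phi> \<Longrightarrow> C_k n (\<lambda>z. \<phi> (a + c *\<^sub>R z))"
proof (induction n arbitrary: \<phi>)
  case 0
  have "continuous_on UNIV (\<lambda>z. \<phi> (a + c *\<^sub>R z))"
    by (rule continuous_on_compose2[of UNIV \<phi>]) (use 0 in \<open>auto intro!: continuous_intros\<close>)
  then show ?case by simp
next
  case (Suc n)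
  have d: "((\<lambda>z. \<phi> (a + c *\<^sub>R z)) has_derivative (\<lambda>d. c *\<^sub>R frechet_derivative \<phi> (at (a + c *\<^sub>R z)) d)) (at z)" for z
  proof -
    have "((\<lambda>z. \<phi> (a + c *\<^sub>R z)) has_derivative (\<lambda>d. frechet_derivative \<phi> (at (a + c *\<^sub>R z)) (c *\<^sub>R d))) (at z)"
      by (rule has_derivative_compose[OF _ C_k_derivative[OF Suc.prems]])
        (auto intro!: derivative_eq_intros)
    moreover have "linear (frechet_derivative \<phi> (at (a + c *\<^sub>R z)))"
      using C_k_derivative[OF Suc.prems] has_derivative_linear by blast
    ultimately show ?thesis by (simp add: linear_scale)
  qed
  have s: "C_k n (\<lambda>z. c *\<^sub>R \<psi> z)" if "C_k n \<psi>" for \<psi>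
    using C_k_linear_comp[OF bounded_linear_scaleR_right that] .
  show ?case
    by (rule C_k_SucI[OF d]) (use Suc in \<open>auto intro!: s\<close>)
qed

lemma frechet_affine:
  fixes c :: real
  assumes "\<phi> differentiable (at (a + c *\<^sub>R z))"
  shows "frechet_derivative (\<lambda>z. \<phi> (a + c *\<^sub>R z)) (at z) d = c *\<^sub>R frechet_derivative \<phi> (at (a + c *\<^sub>R z)) d"
proof -
  have f: "(\<phi> has_derivative frechet_derivative \<phi> (at (a + c *\<^sub>R z))) (at (a + c *\<^sub>R z))"
    using assms frechet_derivative_works by blast
  have "((\<lambda>z. \<phi> (a + c *\<^sub>R z)) has_derivative (\<lambda>d. frechet_derivative \<phi> (at (a + c *\<^sub>R z)) (c *\<^sub>R d))) (at z)"
    by (rule has_derivative_compose[where g = \<phi>]) (use f in \<open>auto intro!: derivative_eq_intros\<close>)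
  then show ?thesis using f has_derivative_linear linear_scale frechet_derivative_at by metis
qed

text \<open>Multiplying \<open>exp (- 1 / t)\<close> by powers of \<open>1 / t\<close> gives a family of functions, flat at \<open>0\<close>, whose linear span is closed under
differentiation; smoothness of the basic bump \<open>flat 0\<close> then follows by induction over the whole family at once.\<close>

definition flat :: "nat \<Rightarrow> real \<Rightarrow> real" where
  "flat n t = (if t > 0 then (1/t) ^ n * exp (- (1/t)) else 0)"

lemma flat_tendsto: "(flat n \<longlongrightarrow> 0) (at_right 0)"
proof -
  have "((\<lambda>x::real. x ^ n / exp x) \<longlongrightarrow> 0) at_top" by (rule tendsto_power_div_exp_0)
  then have "((\<lambda>t. (inverse t) ^ n / exp (inverse t)) \<longlongrightarrow> 0) (at_right (0::real))"
    by (rule filterlim_compose) (rule filterlim_inverse_at_top_right)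
  then show ?thesis
    by (rule Lim_transform_eventually)
      (auto simp: flat_def eventually_at_right_less exp_minus field_simps
        intro!: eventually_mono[OF eventually_at_right_less[of 0]])
qed

text \<open>At \<open>t = 0\<close> the difference quotient of \<open>flat n\<close> is \<open>flat (n + 1)\<close> from the right, which tends to \<open>0\<close>.\<close>

lemma flat_deriv: "(flat n has_real_derivative flat (n+2) t - n * flat (n+1) t) (at t)"
proof -
  consider "t > 0" | "t < 0" | "t = 0" by linarith
  then show ?thesis
  proof cases
    case 1
    have "((\<lambda>t. (1/t) ^ n * exp (- (1/t))) has_real_derivative flat (n+2) t - n * flat (n+1) t) (at t)"
      using 1 by (auto intro!: derivative_eq_intros simp: flat_def field_simps power2_eq_square)
        (cases n; simp add: field_simps)
    then show ?thesis
      by (rule has_field_derivative_transform_within_open[where S = "{0<..}"])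
        (use 1 in \<open>auto simp: flat_def\<close>)
  next
    case 2
    have "((\<lambda>_. 0) has_real_derivative flat (n+2) t - n * flat (n+1) t) (at t)"
      using 2 by (auto simp: flat_def)
    then show ?thesis
      by (rule has_field_derivative_transform_within_open[where S = "{..<0}"])
        (use 2 in \<open>auto simp: flat_def\<close>)
  next
    case 3
    have "((\<lambda>h. flat n h / h) \<longlongrightarrow> 0) (at 0)"
    proof (rule filterlim_split_at)
        show "((\<lambda>h. flat n h / h) \<longlongrightarrow> 0) (at_left 0)"
          by (rule Lim_transform_eventually[OF tendsto_const])
            (auto simp: flat_def eventually_at_left_field intro!: exI[of _ "-1"])
        show "((\<lambda>h. flat n h / h) \<longlongrightarrow> 0) (at_right 0)"
          by (rule Lim_transform_eventually[OF flat_tendsto[of "Suc n"]])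
            (auto simp: flat_def field_simps intro!: eventually_mono[OF eventually_at_right_less[of 0]])
    qed
    then show ?thesis using 3 by (simp add: DERIV_def flat_def)
  qed
qed

lemma C_k_flat: "C_k m (\<lambda>z. of_real (flat n (1 - (cmod z)\<^sup>2)))"
proof (induction m arbitrary: n)
  have D: "((\<lambda>z. of_real (flat n (1 - (cmod z)\<^sup>2))) has_derivative
     (\<lambda>d. of_real ((flat (n+2) (1 - (cmod z)\<^sup>2) - n * flat (n+1) (1 - (cmod z)\<^sup>2)) * (- 2 * (z \<bullet> d))) :: complex)) (at z)" for z n
  proof -
    have 1: "((\<lambda>z. 1 - (cmod z)\<^sup>2) has_derivative (\<lambda>d. - 2 * (z \<bullet> d))) (at z)"
      unfolding power2_norm_eq_inner
      by (auto intro!: derivative_eq_intros simp: inner_commute)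
    have 2: "(flat n has_derivative (*) (flat (n+2) (1 - (cmod z)\<^sup>2) - n * flat (n+1) (1 - (cmod z)\<^sup>2)))
       (at (1 - (cmod z)\<^sup>2))"
      using flat_deriv has_field_derivative_def by blast
    show ?thesis
      by (rule has_derivative_of_real) (rule has_derivative_compose[OF 1 2])
  qed
  {
    case 0
    have "continuous (at z) (\<lambda>z. complex_of_real (flat n (1 - (cmod z)\<^sup>2)))" for z
      using has_derivative_continuous[OF D] .
    then show ?case
      unfolding C_k.simps continuous_on_eq_continuous_at[OF open_UNIV] by blast
  next
    case (Suc m)
    have R: "C_k m (\<lambda>z. of_real (Re z))" "C_k m (\<lambda>z. of_real (Im z))"
      by (auto intro!: C_k_linear bounded_linear_compose[OF bounded_linear_of_real] bounded_linear_Re bounded_linear_Im)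
    show ?case
    proof (rule C_k_SucI[OF D])
      have *: "C_k m (\<lambda>z. (of_real (flat (n+2) (1 - (cmod z)\<^sup>2)) + (- of_nat n) * of_real (flat (n+1) (1 - (cmod z)\<^sup>2))) * ((-2) * \<psi> z))"
        if "C_k m \<psi>" for \<psi>
        by (intro C_k_mult C_k_add C_k_const Suc that)
      show "C_k m (\<lambda>z. of_real ((flat (n+2) (1 - (cmod z)\<^sup>2) - n * flat (n+1) (1 - (cmod z)\<^sup>2)) * (- 2 * (z \<bullet> 1))))"
        using *[OF R(1)] by (simp add: inner_complex_def algebra_simps)
      show "C_k m (\<lambda>z. of_real ((flat (n+2) (1 - (cmod z)\<^sup>2) - n * flat (n+1) (1 - (cmod z)\<^sup>2)) * (- 2 * (z \<bullet> \<i>))))"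
        using *[OF R(2)] by (simp add: inner_complex_def algebra_simps)
    qed
  }
qed

section \<open>Integrals of partial derivatives\<close>

text \<open>Identifying the area measure of the complex plane with a product measure makes Fubini's theorem available, and with it
integration along horizontal and vertical lines.\<close>

lemma lborel_complex_eq:
  "lborel = distr (lborel \<Otimes>\<^sub>M lborel) borel (\<lambda>(x, y). Complex x y)"
proof (rule lborel_eqI)
  have m[measurable]: "(\<lambda>(x, y). Complex x y) \<in> borel_measurable (borel \<Otimes>\<^sub>M borel)"
    unfolding borel_prod
    by (intro borel_measurable_continuous_onI) (auto simp: case_prod_unfold intro!: continuous_intros)
  fix l u :: complex assume le: "\<And>b. b \<in> Basis \<Longrightarrow> l \<bullet> b \<le> u \<bullet> b"
  have le': "Re l \<le> Re u" "Im l \<le> Im u"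
    using le[of 1] le[of \<i>] by (auto simp: Basis_complex_def inner_complex_def)
  have "(\<lambda>(x, y). Complex x y) -` box l u \<inter> space (lborel \<Otimes>\<^sub>M lborel) = {Re l<..<Re u} \<times> {Im l<..<Im u}"
    by (auto simp: in_box_complex_iff space_pair_measure)
  then have "emeasure (distr (lborel \<Otimes>\<^sub>M lborel) borel (\<lambda>(x, y). Complex x y)) (box l u)
     = emeasure (lborel \<Otimes>\<^sub>M lborel) ({Re l<..<Re u} \<times> {Im l<..<Im u})"
    by (subst emeasure_distr) auto
  also have "\<dots> = ennreal (Re u - Re l) * ennreal (Im u - Im l)"
    using le' by (subst lborel.emeasure_pair_measure_Times) auto
  also have "\<dots> = ennreal (\<Prod>b\<in>Basis. (u - l) \<bullet> b)"
    using le' by (simp add: Basis_complex_def inner_complex_def ennreal_mult)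
  finally show "emeasure (distr (lborel \<Otimes>\<^sub>M lborel) borel (\<lambda>(x, y). Complex x y)) (box l u)
     = ennreal (\<Prod>b\<in>Basis. (u - l) \<bullet> b)" .
qed simp

lemma Complex_measurable [measurable]:
  "(\<lambda>(x, y). Complex x y) \<in> borel_measurable (borel \<Otimes>\<^sub>M borel)"
  unfolding borel_prod
  by (intro borel_measurable_continuous_onI) (auto simp: case_prod_unfold intro!: continuous_intros)

lemma integrable_complex_pair:
  fixes f :: "complex \<Rightarrow> complex"
  assumes f: "integrable lborel f"
  shows "integrable (lborel \<Otimes>\<^sub>M lborel) (\<lambda>(x, y). f (Complex x y))"
    "integral\<^sup>L lborel f = (\<integral>p. (case p of (x, y) \<Rightarrow> f (Complex x y)) \<partial>(lborel \<Otimes>\<^sub>M lborel))"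
proof -
  have [measurable]: "f \<in> borel_measurable borel" using f by auto
  have "integrable (distr (lborel \<Otimes>\<^sub>M lborel) borel (\<lambda>(x, y). Complex x y)) f"
    using f by (simp flip: lborel_complex_eq)
  then show "integrable (lborel \<Otimes>\<^sub>M lborel) (\<lambda>(x, y). f (Complex x y))"
    by (subst (asm) integrable_distr_eq) (auto simp: case_prod_unfold)
  show "integral\<^sup>L lborel f = (\<integral>p. (case p of (x, y) \<Rightarrow> f (Complex x y)) \<partial>(lborel \<Otimes>\<^sub>M lborel))"
    by (subst lborel_complex_eq, subst integral_distr) (auto simp: case_prod_unfold)
qed

lemma line_integral_derivative_zero:
  fixes u v :: "real \<Rightarrow> complex"
  assumes v: "integrable lborel v" and u: "continuous_on UNIV u"
    and out: "\<And>t. R < \<bar>t\<bar> \<Longrightarrow> u t = 0 \<and> v t = 0"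
    and fin: "finite {t. \<not> (u has_vector_derivative v t) (at t)}"
  shows "integral\<^sup>L lborel v = 0"
proof -
  define S where "S = \<bar>R\<bar> + 1"
  have "(v has_integral (u S - u (- S))) {- S..S}"
    by (rule fundamental_theorem_of_calculus_interior_strong[OF fin])
       (auto simp: S_def intro: continuous_on_subset[OF u])
  moreover have "u S = 0" "u (- S) = 0" using out by (auto simp: S_def)
  ultimately have "(v has_integral 0) {- S..S}" by simp
  then have "(v has_integral 0) UNIV"
    by (rule has_integral_on_superset) (use out in \<open>auto simp: S_def\<close>)
  then show ?thesis
    using has_integral_integral_lborel[OF v] has_integral_unique by blast
qed

text \<open>The fundamental theorem of calculus on each line, followed by Fubini.  Finitely many exceptional points on every line are
allowed so that functions with a jump of the derivative across a circle can be treated without a smooth approximation.\<close>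

lemma integral_partial_derivative_zero:
  fixes u v :: "complex \<Rightarrow> complex"
  assumes v: "integrable lborel v" and u: "continuous_on UNIV u"
    and out: "\<And>z. R < cmod z \<Longrightarrow> u z = 0 \<and> v z = 0"
    and fin: "(\<forall>y. finite {x. \<not> ((\<lambda>x. u (Complex x y)) has_vector_derivative v (Complex x y)) (at x)}) \<or>
       (\<forall>x. finite {y. \<not> ((\<lambda>y. u (Complex x y)) has_vector_derivative v (Complex x y)) (at y)})"
  shows "integral\<^sup>L lborel v = 0"
  using fin
proof
  note I = integrable_complex_pair[OF v]
  have le: "\<bar>x\<bar> \<le> cmod (Complex x y)" "\<bar>y\<bar> \<le> cmod (Complex x y)" for x y
    using abs_Re_le_cmod[of "Complex x y"] abs_Im_le_cmod[of "Complex x y"] by auto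
  have o: "u (Complex x y) = 0 \<and> v (Complex x y) = 0" if "R < \<bar>x\<bar> \<or> R < \<bar>y\<bar>" for x y
    using that le[of x y] le(2)[of y x] out[of "Complex x y"] by linarith
  {
    assume f: "\<forall>y. finite {x. \<not> ((\<lambda>x. u (Complex x y)) has_vector_derivative v (Complex x y)) (at x)}"
    have "AE y in lborel. (LINT x|lborel. v (Complex x y)) = 0"
      using lborel_pair.AE_integrable_snd[OF I(1)]
    proof eventually_elim
      case (elim y)
      show ?case
        by (rule line_integral_derivative_zero[OF elim, where u = "\<lambda>x. u (Complex x y)" and R = R])
          (use o f in \<open>auto intro!: continuous_on_compose2[OF u] continuous_intros\<close>)
    qed
    then have "(LINT y|lborel. LINT x|lborel. v (Complex x y)) = 0"
      by (rule integral_eq_zero_AE)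
    then show ?thesis using lborel_pair.integral_snd[OF I(1)] I(2) by simp
  next
    assume f: "\<forall>x. finite {y. \<not> ((\<lambda>y. u (Complex x y)) has_vector_derivative v (Complex x y)) (at y)}"
    have "AE x in lborel. (LINT y|lborel. v (Complex x y)) = 0"
      using lborel_pair.AE_integrable_fst[OF I(1)]
    proof eventually_elim
      case (elim x)
      show ?case
        by (rule line_integral_derivative_zero[OF elim, where u = "\<lambda>y. u (Complex x y)" and R = R])
          (use o f in \<open>auto intro!: continuous_on_compose2[OF u] continuous_intros\<close>)
    qed
    then have "(LINT x|lborel. LINT y|lborel. v (Complex x y)) = 0"
      by (rule integral_eq_zero_AE)
    then show ?thesis using lborel_pair.integral_fst[OF I(1)] I(2) by simp
  }
qed

section \<open>Test functions\<close>

lemma smooth_differentiable: "smooth \<phi> \<Longrightarrow> (\<phi> has_derivative frechet_derivative \<phi> (at z)) (at z)"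
  unfolding smooth_def using C_k_derivative by blast

lemma smooth_d:
  assumes "smooth \<phi>" shows "smooth (d_x \<phi>)" "smooth (d_y \<phi>)"
proof -
  have "C_k (Suc n) \<phi>" for n using assms unfolding smooth_def by blast
  then show "smooth (d_x \<phi>)" "smooth (d_y \<phi>)" by (auto simp: smooth_def)
qed

lemma smooth_continuous: "smooth \<phi> \<Longrightarrow> continuous_on S \<phi>"
proof -
  assume "smooth \<phi>"
  then have "C_k 0 \<phi>" unfolding smooth_def by blast
  then show "continuous_on S \<phi>" by (auto intro: continuous_on_subset)
qed

lemma frechet_split:
  assumes "(\<phi> has_derivative D) (at (z::complex))"
  shows "D d = Re d *\<^sub>R D 1 + Im d *\<^sub>R D \<i>"
proof -
  interpret linear D using assms has_derivative_linear by blast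
  have "d = Re d *\<^sub>R 1 + Im d *\<^sub>R \<i>"
    by (simp add: complex_eq_iff)
  then have "D d = D (Re d *\<^sub>R 1 + Im d *\<^sub>R \<i>)" by simp
  then show ?thesis by (simp only: add scaleR)
qed

lemma frechet_zero_outside:
  assumes "closed K" "\<And>w. w \<notin> K \<Longrightarrow> \<phi> w = 0" "z \<notin> K"
  shows "frechet_derivative \<phi> (at z) = (\<lambda>_. 0)"
proof -
  have "((\<lambda>_. 0) has_derivative (\<lambda>_. 0)) (at z)" by simp
  then have "(\<phi> has_derivative (\<lambda>_. 0)) (at z)"
    by (rule has_derivative_transform_within_open[where s = "- K"]) (use assms in auto)
  then show ?thesis using frechet_derivative_at by metis
qed

lemma test_functionsI:
  assumes "smooth \<phi>" "compact K" "K \<subseteq> U" "\<And>z. z \<notin> K \<Longrightarrow> \<phi> z = 0"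
  shows "\<phi> \<in> test_functions U"
proof -
  have c: "closure {z. \<phi> z \<noteq> 0} \<subseteq> K"
    using assms by (intro closure_minimal) (auto intro: compact_imp_closed)
  moreover have "compact (closure {z. \<phi> z \<noteq> 0})"
    using c assms(2) by (metis bounded_subset closed_closure compact_eq_bounded_closed)
  ultimately show ?thesis using assms by (auto simp: test_functions_def smooth_def)
qed

lemma test_functionsD:
  assumes "\<phi> \<in> test_functions U"
  shows "smooth \<phi>" "\<exists>K. compact K \<and> K \<subseteq> U \<and> (\<forall>z. z \<notin> K \<longrightarrow> \<phi> z = 0)"
proof -
  show "smooth \<phi>" using assms by (simp add: test_functions_def smooth_def)
  let ?K = "closure {z. \<phi> z \<noteq> 0}"
  have "\<forall>z. z \<notin> ?K \<longrightarrow> \<phi> z = 0"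
    using closure_subset[of "{z. \<phi> z \<noteq> 0}"] by blast
  moreover have "compact ?K \<and> ?K \<subseteq> U"
    using assms unfolding test_functions_def by blast
  ultimately show "\<exists>K. compact K \<and> K \<subseteq> U \<and> (\<forall>z. z \<notin> K \<longrightarrow> \<phi> z = 0)" by blast
qed

lemma test_functions_UNIV_iff:
  "\<phi> \<in> test_functions UNIV \<longleftrightarrow> smooth \<phi> \<and> (\<exists>R. \<forall>z. R < cmod z \<longrightarrow> \<phi> z = 0)"
proof
  assume "\<phi> \<in> test_functions UNIV"
  note T = test_functionsD[OF this]
  from T(2) obtain K where K: "compact K" "\<And>z. z \<notin> K \<Longrightarrow> \<phi> z = 0" by metis
  obtain R where "\<forall>x\<in>K. cmod x \<le> R"
    using compact_imp_bounded[OF K(1)] by (auto simp: bounded_iff)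
  then have "\<forall>z. R < cmod z \<longrightarrow> \<phi> z = 0" using K(2) by (meson linorder_not_le)
  then show "smooth \<phi> \<and> (\<exists>R. \<forall>z. R < cmod z \<longrightarrow> \<phi> z = 0)" using T(1) by blast
next
  assume "smooth \<phi> \<and> (\<exists>R. \<forall>z. R < cmod z \<longrightarrow> \<phi> z = 0)"
  then obtain R where "smooth \<phi>" "\<And>z. R < cmod z \<Longrightarrow> \<phi> z = 0" by blast
  then show "\<phi> \<in> test_functions UNIV"
    by (intro test_functionsI[where K = "cball 0 R"]) auto
qed

section \<open>Symmetry of second derivatives\<close>

lemma mean_value_bound:
  fixes f :: "real \<Rightarrow> complex"
  assumes "0 \<le> s" "\<And>t. 0 \<le> t \<Longrightarrow> t \<le> s \<Longrightarrow> (f has_vector_derivative f' t) (at t)"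
    and "\<And>t. 0 \<le> t \<Longrightarrow> t \<le> s \<Longrightarrow> cmod (f' t) \<le> B"
  shows "cmod (f s - f 0) \<le> B * s"
proof -
  have "norm (f s - f 0) \<le> B * norm (s - 0)"
  proof (rule differentiable_bound[where f' = "\<lambda>t x. x *\<^sub>R f' t"])
    show "convex {0..s}" by simp
    show "s \<in> {0..s}" "0 \<in> {0..s}" using assms(1) by auto
    fix x assume x: "x \<in> {0..s}"
    then have "(f has_vector_derivative f' x) (at x)" using assms(2) by auto
    then show "(f has_derivative (\<lambda>xa. xa *\<^sub>R f' x)) (at x within {0..s})"
      unfolding has_vector_derivative_def by (rule has_derivative_at_withinI)
    have "cmod (f' x) \<le> B" using assms(3) x by auto
    then have "norm (t *\<^sub>R f' x) \<le> B * norm t" for t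
      using mult_right_mono[of "cmod (f' x)" B "\<bar>t\<bar>"] by (simp add: mult.commute)
    then show "onorm (\<lambda>xa. xa *\<^sub>R f' x) \<le> B" by (rule onorm_le)
  qed
  then show ?thesis using assms(1) by simp
qed

lemma has_vector_derivative_along:
  assumes "(\<phi> has_derivative D) (at (z + t *\<^sub>R a))"
  shows "((\<lambda>t. \<phi> (z + t *\<^sub>R a)) has_vector_derivative D a) (at t)"
proof -
  have "((\<lambda>t. \<phi> (z + t *\<^sub>R a)) has_derivative (\<lambda>h. D (h *\<^sub>R a))) (at t)"
    by (rule has_derivative_compose[where g = \<phi>]) (use assms in \<open>auto intro!: derivative_eq_intros\<close>)
  moreover have "D (h *\<^sub>R a) = h *\<^sub>R D a" for h
    using has_derivative_linear[OF assms] linear_scale by blast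
  ultimately show ?thesis unfolding has_vector_derivative_def by simp
qed

text \<open>The mean value inequality applied twice to the second difference in the directions \<open>a\<close> and \<open>b\<close>, where \<open>c\<close> stands for the
value at \<open>z\<close> of the second derivative.  The second difference is symmetric in the two directions, which is why second
derivatives commute.\<close>

lemma second_difference_bound:
  fixes \<phi> \<psi> :: "complex \<Rightarrow> complex"
  assumes ab: "cmod a = 1" "cmod b = 1" and s: "0 < s" "2 * s < \<delta>"
    and \<phi>: "\<And>\<zeta>. (\<phi> has_derivative D \<zeta>) (at \<zeta>)" and \<psi>: "\<And>\<zeta>. ((\<lambda>\<zeta>. D \<zeta> a) has_derivative E \<zeta>) (at \<zeta>)"
    and e: "\<And>\<zeta>. dist \<zeta> z < \<delta> \<Longrightarrow> cmod (E \<zeta> b - c) \<le> e"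
  shows "cmod (\<phi> (z + s *\<^sub>R a + s *\<^sub>R b) - \<phi> (z + s *\<^sub>R a) - \<phi> (z + s *\<^sub>R b) + \<phi> z - (s * s) *\<^sub>R c) \<le> e * s * s"
proof -
  have inner: "cmod (D (z + x *\<^sub>R a + s *\<^sub>R b) a - D (z + x *\<^sub>R a) a - s *\<^sub>R c) \<le> e * s" if x: "0 \<le> x" "x \<le> s" for x
  proof -
    have "cmod ((D (z + x *\<^sub>R a + s *\<^sub>R b) a - s *\<^sub>R c) - (D (z + x *\<^sub>R a + 0 *\<^sub>R b) a - 0 *\<^sub>R c)) \<le> e * s"
    proof (rule mean_value_bound[where f' = "\<lambda>y. E (z + x *\<^sub>R a + y *\<^sub>R b) b - c"])
      fix t assume t: "0 \<le> t" "t \<le> s"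
      show "((\<lambda>t. D (z + x *\<^sub>R a + t *\<^sub>R b) a - t *\<^sub>R c) has_vector_derivative E (z + x *\<^sub>R a + t *\<^sub>R b) b - c) (at t)"
        by (intro has_vector_derivative_diff has_vector_derivative_along \<psi>)
          (auto intro!: derivative_eq_intros)
      have "dist (z + x *\<^sub>R a + t *\<^sub>R b) z \<le> norm (x *\<^sub>R a) + norm (t *\<^sub>R b)"
        by (simp add: dist_norm add.assoc del: norm_scaleR) (rule norm_triangle_ineq)
      then show "cmod (E (z + x *\<^sub>R a + t *\<^sub>R b) b - c) \<le> e"
        using ab t x s by (intro e) simp
    qed (use s in auto)
    then show ?thesis by (simp add: algebra_simps)
  qed
  have "cmod ((\<phi> (z + s *\<^sub>R b + s *\<^sub>R a) - \<phi> (z + s *\<^sub>R a) - s *\<^sub>R (s *\<^sub>R c)) -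
      (\<phi> (z + s *\<^sub>R b + 0 *\<^sub>R a) - \<phi> (z + 0 *\<^sub>R a) - 0 *\<^sub>R (s *\<^sub>R c))) \<le> (e * s) * s"
  proof (rule mean_value_bound[where f' = "\<lambda>x. D (z + s *\<^sub>R b + x *\<^sub>R a) a - D (z + x *\<^sub>R a) a - s *\<^sub>R c"])
    fix t assume t: "0 \<le> t" "t \<le> s"
    show "((\<lambda>x. \<phi> (z + s *\<^sub>R b + x *\<^sub>R a) - \<phi> (z + x *\<^sub>R a) - x *\<^sub>R (s *\<^sub>R c)) has_vector_derivative
        D (z + s *\<^sub>R b + t *\<^sub>R a) a - D (z + t *\<^sub>R a) a - s *\<^sub>R c) (at t)"
      by (intro has_vector_derivative_diff has_vector_derivative_along \<phi>)
        (auto intro!: derivative_eq_intros)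
    show "cmod (D (z + s *\<^sub>R b + t *\<^sub>R a) a - D (z + t *\<^sub>R a) a - s *\<^sub>R c) \<le> e * s"
      using inner[OF t] by (simp add: algebra_simps)
  qed (use s in auto)
  then show ?thesis by (simp add: algebra_simps)
qed

text \<open>Both iterated derivatives are limits of the same second difference divided by \<open>s\<^sup>2\<close>.\<close>

lemma mixed_partials_commute:
  assumes sm: "smooth \<phi>" shows "d_y (d_x \<phi>) z = d_x (d_y \<phi>) z"
proof -
  define c1 c2 where "c1 = d_y (d_x \<phi>) z" and "c2 = d_x (d_y \<phi>) z"
  have "cmod (c1 - c2) \<le> 2 * e" if e: "e > 0" for e
  proof -
    have cont: "continuous (at z) (d_y (d_x \<phi>))" "continuous (at z) (d_x (d_y \<phi>))"
      using smooth_continuous[OF smooth_d(2)[OF smooth_d(1)[OF sm]], of UNIV]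
        smooth_continuous[OF smooth_d(1)[OF smooth_d(2)[OF sm]], of UNIV]
      by (auto simp: continuous_on_eq_continuous_at)
    obtain \<delta>1 where \<delta>1: "\<delta>1 > 0" "\<And>\<zeta>. dist \<zeta> z < \<delta>1 \<Longrightarrow> dist (d_y (d_x \<phi>) \<zeta>) c1 < e"
      using cont(1) e unfolding continuous_at_eps_delta c1_def by blast
    obtain \<delta>2 where \<delta>2: "\<delta>2 > 0" "\<And>\<zeta>. dist \<zeta> z < \<delta>2 \<Longrightarrow> dist (d_x (d_y \<phi>) \<zeta>) c2 < e"
      using cont(2) e unfolding continuous_at_eps_delta c2_def by blast
    define \<delta> where "\<delta> = min \<delta>1 \<delta>2"
    define s where "s = \<delta> / 3"
    have s: "0 < s" "2 * s < \<delta>" using \<delta>1 \<delta>2 by (auto simp: \<delta>_def s_def)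
    let ?\<Delta> = "\<phi> (z + s *\<^sub>R 1 + s *\<^sub>R \<i>) - \<phi> (z + s *\<^sub>R 1) - \<phi> (z + s *\<^sub>R \<i>) + \<phi> z"
    have A: "cmod (?\<Delta> - (s * s) *\<^sub>R c1) \<le> e * s * s"
      by (rule second_difference_bound[OF _ _ s smooth_differentiable[OF sm]
          smooth_differentiable[OF smooth_d(1)[OF sm]]])
        (use \<delta>1 in \<open>auto simp: \<delta>_def dist_norm intro: less_imp_le\<close>)
    have "cmod (\<phi> (z + s *\<^sub>R \<i> + s *\<^sub>R 1) - \<phi> (z + s *\<^sub>R \<i>) - \<phi> (z + s *\<^sub>R 1) + \<phi> z - (s * s) *\<^sub>R c2) \<le> e * s * s"
      by (rule second_difference_bound[OF _ _ s smooth_differentiable[OF sm]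
          smooth_differentiable[OF smooth_d(2)[OF sm]]])
        (use \<delta>2 in \<open>auto simp: \<delta>_def dist_norm intro: less_imp_le\<close>)
    then have B: "cmod (?\<Delta> - (s * s) *\<^sub>R c2) \<le> e * s * s"
      by (simp add: algebra_simps)
    have "(s * s) *\<^sub>R (c1 - c2) = (?\<Delta> - (s * s) *\<^sub>R c2) - (?\<Delta> - (s * s) *\<^sub>R c1)"
      by (simp add: algebra_simps)
    then have "cmod ((s * s) *\<^sub>R (c1 - c2)) \<le> e * s * s + e * s * s"
      using order_trans[OF norm_triangle_ineq4 add_mono[OF B A]] by (simp only:)
    then have "(s * s) * cmod (c1 - c2) \<le> (s * s) * (2 * e)"
      unfolding norm_scaleR using s by (simp add: mult.commute mult.left_commute)
    then show ?thesis using s by simp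
  qed
  from this[of "cmod (c1 - c2) / 4"] have "c1 = c2" by (cases "c1 = c2") auto
  then show ?thesis by (simp add: c1_def c2_def)
qed

section \<open>Convolution with a smooth kernel\<close>

definition loc_int :: "(complex \<Rightarrow> complex) \<Rightarrow> bool" where
  "loc_int u \<longleftrightarrow> u \<in> borel_measurable borel \<and> (\<forall>R. set_integrable lborel (cball 0 R) u)"

definition conv :: "(complex \<Rightarrow> complex) \<Rightarrow> (complex \<Rightarrow> complex) \<Rightarrow> complex \<Rightarrow> complex" where
  "conv u \<phi> z = (LINT w|lborel. u w * \<phi> (z - w))"

lemma bounded_compact_support:
  assumes "continuous_on UNIV \<phi>" "\<And>z. r < cmod z \<Longrightarrow> \<phi> z = (0::complex)"
  obtains B where "B \<ge> 0" "\<And>z. cmod (\<phi> z) \<le> B"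
proof -
  have "compact (\<phi> ` cball 0 r)"
    using assms(1) by (intro compact_continuous_image) (auto intro: continuous_on_subset)
  then obtain B where B: "\<And>z. z \<in> cball 0 r \<Longrightarrow> cmod (\<phi> z) \<le> B"
    using compact_imp_bounded bounded_iff by (metis imageI)
  have "cmod (\<phi> z) \<le> max 0 B" for z
    using B[of z] assms(2)[of z] by (cases "cmod z \<le> r") auto
  then show ?thesis by (intro that[of "max 0 B"]) auto
qed

lemma integrable_mult_compact_support:
  assumes u: "loc_int u" and \<phi>: "continuous_on UNIV \<phi>" "\<And>z. r < cmod z \<Longrightarrow> \<phi> z = 0"
  shows "integrable lborel (\<lambda>w. u w * \<phi> w)"
proof -
  obtain B where B: "B \<ge> 0" "\<And>z. cmod (\<phi> z) \<le> B" using bounded_compact_support[OF \<phi>] by blast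
  have [measurable]: "u \<in> borel_measurable borel" using u by (simp add: loc_int_def)
  have [measurable]: "\<phi> \<in> borel_measurable borel" using \<phi>(1) by (rule borel_measurable_continuous_onI)
  have "integrable lborel (\<lambda>w. indicator (cball 0 r) w *\<^sub>R u w)"
    using u by (auto simp: loc_int_def set_integrable_def)
  then have "integrable lborel (\<lambda>w. B *\<^sub>R (indicator (cball 0 r) w *\<^sub>R u w))"
    by (rule integrable_scaleR_right)
  then show ?thesis
  proof (rule Bochner_Integration.integrable_bound)
    show "AE w in lborel. norm (u w * \<phi> w) \<le> norm (B *\<^sub>R (indicator (cball 0 r) w *\<^sub>R u w))"
    proof (rule AE_I2)
      fix w
      show "norm (u w * \<phi> w) \<le> norm (B *\<^sub>R (indicator (cball 0 r) w *\<^sub>R u w))"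
        using B \<phi>(2)[of w] mult_left_mono[OF B(2)[of w], of "cmod (u w)"]
        by (cases "cmod w \<le> r") (auto simp: norm_mult indicator_def mult.commute)
    qed
  qed measurable
qed

lemma integrable_conv:
  assumes u: "loc_int u" and \<phi>: "continuous_on UNIV \<phi>" "\<And>z. r < cmod z \<Longrightarrow> \<phi> z = 0"
  shows "integrable lborel (\<lambda>w. u w * \<phi> (z - w))"
proof (rule integrable_mult_compact_support[OF u, where r = "cmod z + r"])
  show "continuous_on UNIV (\<lambda>w. \<phi> (z - w))"
    by (rule continuous_on_compose2[OF \<phi>(1)]) (auto intro!: continuous_intros)
  fix w assume "cmod z + r < cmod w"
  moreover have "cmod w \<le> cmod z + cmod (z - w)"
    using norm_triangle_ineq4[of z "z - w"] by simp
  ultimately show "\<phi> (z - w) = 0" by (intro \<phi>(2)) simp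
qed

lemma uniformly_continuous_compact_support:
  assumes c: "continuous_on UNIV \<phi>" and z: "\<And>z. r < cmod z \<Longrightarrow> \<phi> z = (0::complex)" and e: "e > 0"
  obtains \<delta> where "\<delta> > 0" "\<And>z w. dist z w < \<delta> \<Longrightarrow> dist (\<phi> z) (\<phi> w) < e"
proof -
  have "uniformly_continuous_on (cball 0 (r + 2)) \<phi>"
    by (intro compact_uniformly_continuous) (auto intro: continuous_on_subset[OF c])
  then obtain d where d: "d > 0" "\<And>x x'. x \<in> cball 0 (r+2) \<Longrightarrow> x' \<in> cball 0 (r+2) \<Longrightarrow> dist x' x < d \<Longrightarrow> dist (\<phi> x') (\<phi> x) < e"
    using e unfolding uniformly_continuous_on_def by meson
  show ?thesis
  proof (rule that[of "min d 1"])
    fix x y :: complex assume xy: "dist x y < min d 1"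
    have n: "cmod x \<le> cmod y + dist x y" "cmod y \<le> cmod x + dist x y"
      using norm_triangle_ineq2[of x y] norm_triangle_ineq2[of y x] by (auto simp: dist_norm norm_minus_commute)
    show "dist (\<phi> x) (\<phi> y) < e"
    proof (cases "cmod x \<le> r + 1 \<or> cmod y \<le> r + 1")
      case True
      then show ?thesis using n xy by (intro d(2)) auto
    next
      case False
      then show ?thesis using z e by simp
    qed
  qed (use d(1) in auto)
qed

text \<open>The derivative of a compactly supported smooth function is uniformly continuous, so the error in the linear approximation is
small uniformly in the base point.  This is what allows differentiation under the integral sign of a convolution
with a merely locally integrable function.\<close>

lemma linearization_uniform:
  assumes sm: "smooth \<phi>" and z: "\<And>z. r < cmod z \<Longrightarrow> \<phi> z = 0" and e: "e > 0"
  obtains \<delta> where "\<delta> > 0"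
    "\<And>\<zeta> d. cmod d < \<delta> \<Longrightarrow> cmod (\<phi> (\<zeta> + d) - \<phi> \<zeta> - (Re d *\<^sub>R d_x \<phi> \<zeta> + Im d *\<^sub>R d_y \<phi> \<zeta>)) \<le> e * cmod d"
proof -
  have out: "frechet_derivative \<phi> (at z) = (\<lambda>_. 0)" if "r < cmod z" for z
    by (rule frechet_zero_outside[of "cball 0 r"]) (use z that in auto)
  have "e / 2 > 0" using e by simp
  obtain \<delta>1 where \<delta>1: "\<delta>1 > 0" "\<And>z w. dist z w < \<delta>1 \<Longrightarrow> dist (d_x \<phi> z) (d_x \<phi> w) < e / 2"
    by (rule uniformly_continuous_compact_support[OF smooth_continuous[OF smooth_d(1)[OF sm]] _ \<open>e / 2 > 0\<close>, where r = r])
      (use out in auto)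
  obtain \<delta>2 where \<delta>2: "\<delta>2 > 0" "\<And>z w. dist z w < \<delta>2 \<Longrightarrow> dist (d_y \<phi> z) (d_y \<phi> w) < e / 2"
    by (rule uniformly_continuous_compact_support[OF smooth_continuous[OF smooth_d(2)[OF sm]] _ \<open>e / 2 > 0\<close>, where r = r])
      (use out in auto)
  let ?D = "\<lambda>\<zeta> d. frechet_derivative \<phi> (at \<zeta>) d"
  have split: "?D \<zeta> d = Re d *\<^sub>R d_x \<phi> \<zeta> + Im d *\<^sub>R d_y \<phi> \<zeta>" for \<zeta> d
    by (rule frechet_split[OF smooth_differentiable[OF sm]])
  show ?thesis
  proof (rule that[of "min \<delta>1 \<delta>2"])
    fix \<zeta> d assume d: "cmod d < min \<delta>1 \<delta>2"
    have "norm (\<phi> (\<zeta> + d) - \<phi> \<zeta> - ?D \<zeta> ((\<zeta> + d) - \<zeta>)) \<le> norm ((\<zeta> + d) - \<zeta>) * e"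
    proof (rule differentiable_bound_linearization[where S = "ball \<zeta> (min \<delta>1 \<delta>2)" and f' = "\<lambda>x. ?D x" and ?x0.0 = \<zeta>])
      fix t :: real assume t: "t \<in> {0..1}"
      have "norm (t *\<^sub>R d) \<le> 1 * norm d"
        using t unfolding norm_scaleR by (intro mult_right_mono) auto
      then show "\<zeta> + t *\<^sub>R ((\<zeta> + d) - \<zeta>) \<in> ball \<zeta> (min \<delta>1 \<delta>2)"
        using d by (simp add: dist_norm)
    next
      fix x show "(\<phi> has_derivative ?D x) (at x within ball \<zeta> (min \<delta>1 \<delta>2))"
        by (rule has_derivative_at_withinI[OF smooth_differentiable[OF sm]])
    next
      fix x assume "x \<in> ball \<zeta> (min \<delta>1 \<delta>2)"
      then have x: "cmod (d_x \<phi> x - d_x \<phi> \<zeta>) \<le> e / 2" "cmod (d_y \<phi> x - d_y \<phi> \<zeta>) \<le> e / 2"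
        using \<delta>1(2)[of x \<zeta>] \<delta>2(2)[of x \<zeta>] by (auto simp: dist_norm norm_minus_commute)
      show "onorm (?D x - ?D \<zeta>) \<le> e"
        unfolding fun_diff_def
      proof (rule onorm_le)
        fix d
        have "?D x d - ?D \<zeta> d = Re d *\<^sub>R (d_x \<phi> x - d_x \<phi> \<zeta>) + Im d *\<^sub>R (d_y \<phi> x - d_y \<phi> \<zeta>)"
          unfolding split[of x d] split[of \<zeta> d] by (simp add: algebra_simps)
        also have "norm \<dots> \<le> cmod d * (e / 2) + cmod d * (e / 2)"
        proof (rule norm_triangle_le)
          have "norm (Re d *\<^sub>R (d_x \<phi> x - d_x \<phi> \<zeta>)) \<le> cmod d * (e / 2)"
            unfolding norm_scaleR by (rule mult_mono[OF abs_Re_le_cmod x(1)]) auto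
          moreover have "norm (Im d *\<^sub>R (d_y \<phi> x - d_y \<phi> \<zeta>)) \<le> cmod d * (e / 2)"
            unfolding norm_scaleR by (rule mult_mono[OF abs_Im_le_cmod x(2)]) auto
          ultimately show "norm (Re d *\<^sub>R (d_x \<phi> x - d_x \<phi> \<zeta>)) + norm (Im d *\<^sub>R (d_y \<phi> x - d_y \<phi> \<zeta>))
              \<le> cmod d * (e / 2) + cmod d * (e / 2)" by (rule add_mono)
        qed
        finally show "norm (?D x d - ?D \<zeta> d) \<le> e * norm d" by (simp add: mult.commute)
      qed
    qed (use \<delta>1(1) \<delta>2(1) in auto)
    then show "cmod (\<phi> (\<zeta> + d) - \<phi> \<zeta> - (Re d *\<^sub>R d_x \<phi> \<zeta> + Im d *\<^sub>R d_y \<phi> \<zeta>)) \<le> e * cmod d"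
      by (simp add: split[of \<zeta> d] mult.commute)
  qed (use \<delta>1(1) \<delta>2(1) in auto)
qed

lemma has_derivative_conv:
  assumes u: "loc_int u" and sm: "smooth \<phi>" and z: "\<And>z. r < cmod z \<Longrightarrow> \<phi> z = 0"
  shows "(conv u \<phi> has_derivative (\<lambda>d. Re d *\<^sub>R conv u (d_x \<phi>) z + Im d *\<^sub>R conv u (d_y \<phi>) z)) (at z)"
proof -
  have out: "frechet_derivative \<phi> (at z) = (\<lambda>_. 0)" if "r < cmod z" for z
    by (rule frechet_zero_outside[of "cball 0 r"]) (use z that in auto)
  have I: "integrable lborel (\<lambda>w. u w * \<phi> (x - w))" "integrable lborel (\<lambda>w. u w * d_x \<phi> (x - w))"
     "integrable lborel (\<lambda>w. u w * d_y \<phi> (x - w))" for x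
    by (rule integrable_conv[OF u, where r = r]; use smooth_continuous sm smooth_d[OF sm] z out in auto)+
  define K where "K = cball (0::complex) (cmod z + r + 1)"
  have iK: "integrable lborel (\<lambda>w. norm (indicator K w *\<^sub>R u w))"
    using u unfolding loc_int_def set_integrable_def K_def by (intro integrable_norm) blast
  define A where "A = (LINT w|lborel. norm (indicator K w *\<^sub>R u w))"
  have A: "A \<ge> 0" unfolding A_def by (rule integral_nonneg_AE) auto
  show ?thesis
    unfolding has_derivative_at_alt
  proof (intro conjI allI impI)
    show "bounded_linear (\<lambda>d. Re d *\<^sub>R conv u (d_x \<phi>) z + Im d *\<^sub>R conv u (d_y \<phi>) z)"
      by (intro bounded_linear_add bounded_linear_compose[OF bounded_linear_scaleR_left] bounded_linear_Re bounded_linear_Im)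
    fix e :: real assume "0 < e"
    then have "e / (A + 1) > 0" using A by simp
    then obtain \<delta> where \<delta>: "\<delta> > 0"
      "\<And>\<zeta> d. cmod d < \<delta> \<Longrightarrow> cmod (\<phi> (\<zeta> + d) - \<phi> \<zeta> - (Re d *\<^sub>R d_x \<phi> \<zeta> + Im d *\<^sub>R d_y \<phi> \<zeta>)) \<le> e / (A + 1) * cmod d"
      using linearization_uniform[OF sm z] by blast
    show "\<exists>d>0. \<forall>y. norm (y - z) < d \<longrightarrow>
       norm (conv u \<phi> y - conv u \<phi> z - (Re (y - z) *\<^sub>R conv u (d_x \<phi>) z + Im (y - z) *\<^sub>R conv u (d_y \<phi>) z)) \<le> e * norm (y - z)"
    proof (intro exI[of _ "min \<delta> 1"] conjI allI impI)
      fix y assume y: "norm (y - z) < min \<delta> 1"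
      define d where "d = y - z"
      let ?E = "\<lambda>w. \<phi> (z - w + d) - \<phi> (z - w) - (Re d *\<^sub>R d_x \<phi> (z - w) + Im d *\<^sub>R d_y \<phi> (z - w))"
      have eq1: "conv u \<phi> y - conv u \<phi> z - (Re d *\<^sub>R conv u (d_x \<phi>) z + Im d *\<^sub>R conv u (d_y \<phi>) z)
         = (LINT w|lborel. u w * \<phi> (y - w) - u w * \<phi> (z - w) - (Re d *\<^sub>R (u w * d_x \<phi> (z - w)) + Im d *\<^sub>R (u w * d_y \<phi> (z - w))))"
        unfolding conv_def using I by simp
      have eq2: "(LINT w|lborel. u w * \<phi> (y - w) - u w * \<phi> (z - w) - (Re d *\<^sub>R (u w * d_x \<phi> (z - w)) + Im d *\<^sub>R (u w * d_y \<phi> (z - w))))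
         = (LINT w|lborel. u w * ?E w)"
        by (rule Bochner_Integration.integral_cong) (auto simp: d_def algebra_simps)
      have "norm (LINT w|lborel. u w * ?E w) \<le> (LINT w|lborel. (e / (A + 1) * cmod d) * norm (indicator K w *\<^sub>R u w))"
      proof (rule Bochner_Integration.integral_norm_bound_integral)
        have "integrable lborel (\<lambda>w. u w * \<phi> (y - w) - u w * \<phi> (z - w) - (Re d *\<^sub>R (u w * d_x \<phi> (z - w)) + Im d *\<^sub>R (u w * d_y \<phi> (z - w))))"
          using I by simp
        then show "integrable lborel (\<lambda>w. u w * ?E w)"
          by (rule Bochner_Integration.integrable_cong[THEN iffD1, rotated -1]) (auto simp: d_def algebra_simps)
        show "integrable lborel (\<lambda>w. (e / (A + 1) * cmod d) * norm (indicator K w *\<^sub>R u w))"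
          using iK by simp
        fix w
        show "norm (u w * ?E w) \<le> (e / (A + 1) * cmod d) * norm (indicator K w *\<^sub>R u w)"
        proof (cases "w \<in> K")
          case True
          then show ?thesis
            using mult_left_mono[OF \<delta>(2)[of d "z - w"], of "cmod (u w)"] y by (simp add: d_def norm_mult mult.commute)
        next
          case False
          have "cmod w \<le> cmod z + cmod (z - w)" using norm_triangle_ineq4[of z "z - w"] by simp
          moreover have "cmod (z - w) \<le> cmod (z - w + d) + cmod d"
            using norm_triangle_ineq4[of "z - w + d" d] by simp
          ultimately have "r < cmod (z - w)" "r < cmod (z - w + d)"
            using False y by (auto simp: K_def d_def)
          then show ?thesis using z out False by simp
        qed
      qed
      also have "\<dots> = (e / (A + 1) * cmod d) * A" unfolding A_def by (rule integral_mult_right_zero)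
      also have "\<dots> = e * cmod d * (A / (A + 1))" by simp
      also have "\<dots> \<le> e * cmod d * 1" using A \<open>e > 0\<close> by (intro mult_left_mono) auto
      finally have "norm (LINT w|lborel. u w * ?E w) \<le> e * cmod d" by simp
      then show "norm (conv u \<phi> y - conv u \<phi> z - (Re (y - z) *\<^sub>R conv u (d_x \<phi>) z + Im (y - z) *\<^sub>R conv u (d_y \<phi>) z)) \<le> e * norm (y - z)"
        unfolding d_def[symmetric] by (simp only: eq1 eq2)
    qed (use \<delta>(1) in auto)
  qed
qed

lemma smooth_conv:
  assumes u: "loc_int u" and sm: "smooth \<phi>" and z: "\<And>z. r < cmod z \<Longrightarrow> \<phi> z = 0"
  shows "smooth (conv u \<phi>)"
proof -
  have "C_k n (conv u \<phi>)" if "smooth \<phi>" "\<And>z. r < cmod z \<Longrightarrow> \<phi> z = 0" for n \<phi>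
    using that
  proof (induction n arbitrary: \<phi>)
    case 0
    have "continuous (at z) (conv u \<phi>)" for z
      using has_derivative_continuous[OF has_derivative_conv[OF u 0]] .
    then show ?case unfolding C_k.simps continuous_on_eq_continuous_at[OF open_UNIV] by blast
  next
    case (Suc n)
    have out: "frechet_derivative \<phi> (at z) = (\<lambda>_. 0)" if "r < cmod z" for z
      by (rule frechet_zero_outside[of "cball 0 r"]) (use Suc.prems that in auto)
    show ?case
      by (rule C_k_SucI[OF has_derivative_conv[OF u Suc.prems]])
        (use Suc.IH[OF smooth_d(1)[OF Suc.prems(1)]] Suc.IH[OF smooth_d(2)[OF Suc.prems(1)]] out in auto)
  qed
  then show ?thesis using sm z by (simp add: smooth_def)
qed

section \<open>Mollifiers\<close>

definition bump_profile :: "nat \<Rightarrow> complex \<Rightarrow> real" where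
  "bump_profile n z = flat 0 (1 - (cmod (real (Suc n) *\<^sub>R z))\<^sup>2)"

definition moll_real :: "nat \<Rightarrow> complex \<Rightarrow> real" where
  "moll_real n z = bump_profile n z / (LINT w|lborel. bump_profile n w)"

definition moll :: "nat \<Rightarrow> complex \<Rightarrow> complex" where
  "moll n z = of_real (moll_real n z)"

lemma bump_profile_smooth: "smooth (\<lambda>z. complex_of_real (bump_profile n z))"
  unfolding smooth_def bump_profile_def
  using C_k_affine[OF C_k_flat[of _ 0], where a = 0 and c = "real (Suc n)"]
  by (simp del: of_nat_Suc norm_scaleR)

lemma bump_profile_nonneg: "bump_profile n z \<ge> 0"
  by (simp add: bump_profile_def flat_def)

lemma bump_profile_pos_iff: "bump_profile n z > 0 \<longleftrightarrow> cmod z < 1 / Suc n"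
proof -
  have "bump_profile n z > 0 \<longleftrightarrow> (real (Suc n) * cmod z)\<^sup>2 < 1"
    by (simp add: bump_profile_def flat_def del: of_nat_Suc)
  also have "\<dots> \<longleftrightarrow> real (Suc n) * cmod z < 1"
    by (subst abs_square_less_1) (simp del: of_nat_Suc)
  also have "\<dots> \<longleftrightarrow> cmod z < 1 / Suc n" by (simp add: field_simps del: of_nat_Suc)
  finally show ?thesis .
qed

lemma bump_profile_continuous: "continuous_on S (bump_profile n)"
proof -
  have "continuous_on S (\<lambda>z. Re (complex_of_real (bump_profile n z)))"
    by (intro continuous_intros smooth_continuous bump_profile_smooth)
  then show ?thesis by simp
qed

lemma bump_profile_measurable [measurable]: "bump_profile n \<in> borel_measurable borel"
  by (intro borel_measurable_continuous_onI bump_profile_continuous)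

lemma bump_profile_outside: "1 / Suc n \<le> cmod z \<Longrightarrow> bump_profile n z = 0"
  using bump_profile_pos_iff[of n z] bump_profile_nonneg[of n z] by linarith

lemma bump_profile_integrable: "integrable lborel (bump_profile n)"
proof -
  have "integrable lborel (\<lambda>z. indicator (cball 0 1) z *\<^sub>R bump_profile n z)"
    using borel_integrable_compact[OF compact_cball bump_profile_continuous[of "cball 0 1" n]] by simp
  also have "(\<lambda>z. indicator (cball 0 1) z *\<^sub>R bump_profile n z) = bump_profile n"
  proof
    fix z show "indicator (cball 0 1) z *\<^sub>R bump_profile n z = bump_profile n z"
    proof (cases "cmod z \<le> 1")
      case False
      have "1 / real (Suc n) \<le> 1" by (simp add: field_simps)
      then have "1 / real (Suc n) \<le> cmod z" using False by linarith
      then show ?thesis by (simp only: bump_profile_outside scaleR_zero_right)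
    qed simp
  qed
  finally show ?thesis .
qed

lemma bump_profile_integral_pos: "(LINT w|lborel. bump_profile n w) > 0"
proof -
  have "(LINT w|lborel. bump_profile n w) \<ge> 0" by (intro integral_nonneg_AE AE_I2 bump_profile_nonneg)
  moreover have "(LINT w|lborel. bump_profile n w) \<noteq> 0"
  proof
    assume "(LINT w|lborel. bump_profile n w) = 0"
    then have "AE w in lborel. bump_profile n w = 0"
      by (subst (asm) integral_nonneg_eq_0_iff_AE) (auto simp: bump_profile_integrable bump_profile_nonneg)
    then have "AE w in lborel. w \<notin> ball (0::complex) (1 / Suc n)"
      by eventually_elim (use bump_profile_pos_iff[of n] in force)
    then have "emeasure lborel (ball (0::complex) (1 / Suc n)) = 0"
      by (subst (asm) AE_iff_measurable[OF _ refl]) (auto simp: space_lborel ball_def)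
    then have "ball (0::complex) (1 / Suc n) \<in> null_sets lebesgue"
      by (intro null_sets_completionI) (auto simp: null_sets_def)
    then have "negligible (ball (0::complex) (1 / Suc n))"
      by (simp add: negligible_iff_null_sets)
    then show False using open_not_negligible[of "ball (0::complex) (1 / Suc n)"] by simp
  qed
  ultimately show ?thesis by linarith
qed

lemma moll_smooth: "smooth (moll n)"
proof -
  have "smooth (\<lambda>z. complex_of_real (bump_profile n z) * of_real (1 / (LINT w|lborel. bump_profile n w)))"
    using bump_profile_smooth[of n] unfolding smooth_def by (intro allI C_k_mult C_k_const) auto
  then show ?thesis by (simp add: moll_def[abs_def] moll_real_def)
qed

lemma moll_real_nonneg: "moll_real n z \<ge> 0"
  using bump_profile_nonneg bump_profile_integral_pos[of n] by (simp add: moll_real_def)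

lemma moll_real_outside: "1 / Suc n \<le> cmod z \<Longrightarrow> moll_real n z = 0"
  by (simp add: moll_real_def bump_profile_outside)

lemma moll_outside: "1 / Suc n < cmod z \<Longrightarrow> moll n z = 0"
  by (simp add: moll_def moll_real_outside)

lemma moll_real_minus: "moll_real n (z - w) = moll_real n (w - z)"
proof -
  have "cmod (real (Suc n) *\<^sub>R (z - w)) = cmod (real (Suc n) *\<^sub>R (w - z))"
    by (simp only: norm_scaleR norm_minus_commute)
  then show ?thesis by (simp only: moll_real_def bump_profile_def)
qed

lemma moll_real_measurable [measurable]: "moll_real n \<in> borel_measurable borel"
  unfolding moll_real_def[abs_def] by measurable

lemma moll_real_integrable: "integrable lborel (moll_real n)"
  unfolding moll_real_def[abs_def] by (intro integrable_divide bump_profile_integrable)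

lemma moll_real_integral: "(LINT z|lborel. moll_real n z) = 1"
  unfolding moll_real_def[abs_def] using bump_profile_integral_pos[of n] by simp

lemma nn_integral_translate:
  assumes [measurable]: "f \<in> borel_measurable borel"
  shows "(\<integral>\<^sup>+z. f (z - c) \<partial>lborel) = (\<integral>\<^sup>+z. f z \<partial>(lborel :: complex measure))"
proof -
  have "(\<integral>\<^sup>+z. f z \<partial>lborel) = (\<integral>\<^sup>+z. f z \<partial>distr lborel borel ((+) (- c)))"
    by (simp add: lborel_distr_plus)
  also have "\<dots> = (\<integral>\<^sup>+z. f (z - c) \<partial>lborel)"
    by (subst nn_integral_distr) (auto simp: add.commute)
  finally show ?thesis ..
qed

lemma nn_integral_moll_real: "(\<integral>\<^sup>+z. ennreal (moll_real n (z - c)) \<partial>lborel) = 1"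
proof -
  have "(\<integral>\<^sup>+z. ennreal (moll_real n (z - c)) \<partial>lborel) = (\<integral>\<^sup>+z. ennreal (moll_real n z) \<partial>lborel)"
    by (rule nn_integral_translate) simp
  also have "\<dots> = ennreal (LINT z|lborel. moll_real n z)"
    by (rule nn_integral_eq_integral) (auto simp: moll_real_integrable moll_real_nonneg)
  finally show ?thesis by (simp add: moll_real_integral)
qed

lemma moll_translate:
  "integrable lborel (\<lambda>w. moll_real n (z - w))" "(LINT w|lborel. moll_real n (z - w)) = 1"
proof -
  have n: "(\<integral>\<^sup>+w. ennreal (moll_real n (z - w)) \<partial>lborel) = 1"
    using nn_integral_moll_real[of n z] by (simp add: moll_real_minus[of n z])
  show i: "integrable lborel (\<lambda>w. moll_real n (z - w))"
    by (rule integrableI_nonneg) (auto simp: n moll_real_nonneg)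
  show "(LINT w|lborel. moll_real n (z - w)) = 1"
    using n i by (subst integral_eq_nn_integral) (auto simp: moll_real_nonneg)
qed

lemma cball_measurable [measurable]: "cball (a::complex) r \<in> sets borel"
  by simp

section \<open>Smooth cutoff functions\<close>

text \<open>The indicator function of the disc of radius \<open>(r + R) / 2\<close>, mollified on a scale below \<open>(R - r) / 2\<close>: from a point at distance at most \<open>r\<close>
or at least \<open>R\<close> from the centre, the mollifier does not reach the boundary circle, so it averages a constant.\<close>

lemma smooth_plateau:
  assumes "0 < r" "r < R"
  obtains \<eta> :: "complex \<Rightarrow> real" where "smooth (\<lambda>z. of_real (\<eta> z))"
    "\<And>z. 0 \<le> \<eta> z" "\<And>z. \<eta> z \<le> 1" "\<And>z. dist a z \<le> r \<Longrightarrow> \<eta> z = 1" "\<And>z. R \<le> dist a z \<Longrightarrow> \<eta> z = 0"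
proof -
  define s where "s = (r + R) / 2"
  obtain n where n: "1 / real (Suc n) < (R - r) / 2"
    using reals_Archimedean[of "(R - r) / 2"] assms by (auto simp: inverse_eq_divide)
  define I :: "complex \<Rightarrow> real" where "I = indicator (cball a s)"
  have [measurable]: "I \<in> borel_measurable borel" unfolding I_def
    by (intro borel_measurable_indicator borel_closed closed_cball)
  have I01: "0 \<le> I w" "I w \<le> 1" for w by (auto simp: I_def indicator_def)
  define \<eta> where "\<eta> z = (LINT w|lborel. I w * moll_real n (z - w))" for z
  have int: "integrable lborel (\<lambda>w. I w * moll_real n (z - w))" for z
    by (rule Bochner_Integration.integrable_bound[OF moll_translate(1)[of n z]])
      (auto simp: I_def indicator_def)
  have u: "loc_int (\<lambda>w. complex_of_real (I w))"
    unfolding loc_int_def set_integrable_def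
  proof (intro conjI allI)
    fix R :: real
    have "integrable lborel (\<lambda>w. indicator (cball (0::complex) R) w *\<^sub>R (1::complex))"
      using borel_integrable_compact[OF compact_cball continuous_on_const, of 0 R "1::complex"] .
    then show "integrable lborel (\<lambda>w. indicator (cball (0::complex) R) w *\<^sub>R complex_of_real (I w))"
      by (rule Bochner_Integration.integrable_bound) (auto simp: I_def indicator_def)
  qed measurable
  have eq: "complex_of_real (\<eta> z) = conv (\<lambda>w. of_real (I w)) (moll n) z" for z
    unfolding \<eta>_def conv_def moll_def by (simp flip: integral_complex_of_real)
  show ?thesis
  proof (rule that[of \<eta>])
    have "smooth (conv (\<lambda>w. of_real (I w)) (moll n))"
      by (rule smooth_conv[OF u moll_smooth moll_outside])
    then show "smooth (\<lambda>z. of_real (\<eta> z))" by (simp add: eq)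
    fix z
    show "0 \<le> \<eta> z" unfolding \<eta>_def using I01 moll_real_nonneg by (intro integral_nonneg_AE AE_I2) simp
    have "\<eta> z \<le> (LINT w|lborel. moll_real n (z - w))"
      unfolding \<eta>_def using I01 moll_real_nonneg
      by (intro integral_mono int moll_translate) (simp add: mult_left_le_one_le)
    then show "\<eta> z \<le> 1" by (simp add: moll_translate)
    have far: "moll_real n (z - w) = 0" if "(R - r) / 2 \<le> dist z w" for w
      using that n by (intro moll_real_outside) (simp add: dist_norm)
    show "\<eta> z = 1" if "dist a z \<le> r"
    proof -
      have "I w * moll_real n (z - w) = moll_real n (z - w)" for w
        using dist_triangle[of a w z] that far[of w]
        by (cases "dist z w < (R - r) / 2") (auto simp: I_def s_def indicator_def field_simps)
      then show ?thesis by (simp only: \<eta>_def moll_translate)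
    qed
    show "\<eta> z = 0" if "R \<le> dist a z"
    proof -
      have "I w * moll_real n (z - w) = 0" for w
        using dist_triangle[of a z w] that far[of w]
        by (cases "dist z w < (R - r) / 2") (auto simp: I_def s_def indicator_def field_simps dist_commute)
      then show ?thesis unfolding \<eta>_def by (simp only: Bochner_Integration.integral_zero)
    qed
  qed
qed

section \<open>Local square integrability and continuous approximation\<close>

definition loc_L2 :: "(complex \<Rightarrow> complex) \<Rightarrow> bool" where
  "loc_L2 v \<longleftrightarrow> v \<in> borel_measurable borel \<and>
     (\<forall>R. integrable lborel (\<lambda>z. indicator (cball 0 R) z * (cmod (v z))\<^sup>2))"

lemma integrable_indicator_cball: "integrable lborel (indicator (cball (0::complex) R) :: complex \<Rightarrow> real)"
  using borel_integrable_compact[OF compact_cball continuous_on_const, of 0 R "1::real"] by simp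

lemma loc_L2_imp_loc_int:
  assumes v: "loc_L2 v" shows "loc_int v"
  unfolding loc_int_def set_integrable_def
proof (intro conjI allI)
  have [measurable]: "v \<in> borel_measurable borel" using v by (simp add: loc_L2_def)
  then show "v \<in> borel_measurable borel" .
  fix R :: real
  have "integrable lborel (\<lambda>w. indicator (cball (0::complex) R) w + indicator (cball 0 R) w * (cmod (v w))\<^sup>2)"
    using v by (intro Bochner_Integration.integrable_add integrable_indicator_cball) (simp add: loc_L2_def)
  then show "integrable lborel (\<lambda>w. indicator (cball (0::complex) R) w *\<^sub>R v w)"
  proof (rule Bochner_Integration.integrable_bound)
    have "x \<le> 1 + x\<^sup>2" for x :: real
      using zero_le_power2[of "x - 1/2"] by (simp add: power2_eq_square algebra_simps)
    then show "AE w in lborel. norm (indicator (cball (0::complex) R) w *\<^sub>R v w)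
        \<le> norm (indicator (cball (0::complex) R) w + indicator (cball 0 R) w * (cmod (v w))\<^sup>2)"
      by (auto simp: indicator_def)
  qed measurable
qed

lemma square_sum_le: "(a + b)\<^sup>2 \<le> 2 * a\<^sup>2 + 2 * (b::real)\<^sup>2"
  using zero_le_power2[of "a - b"] by (simp add: power2_eq_square algebra_simps)

lemma norm_square_sum_le: "(cmod (a + b))\<^sup>2 \<le> 2 * (cmod a)\<^sup>2 + 2 * (cmod b)\<^sup>2"
  using order_trans[OF power_mono[OF norm_triangle_ineq[of a b]] square_sum_le] by simp

text \<open>Project the values of \<open>v\<close> to a large disc to make it bounded, and approximate it almost everywhere by continuous functions,
projected to the same disc; dominated convergence turns this into convergence in the mean.\<close>

lemma continuous_L2_approximation:
  assumes v: "loc_L2 v" and e: "e > 0"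
  obtains c where "continuous_on UNIV c"
    "(LINT z|lborel. indicator (cball 0 R) z * (cmod (v z - c z))\<^sup>2) < e"
proof -
  define B where "B m = cball (0::complex) (real m)" for m
  define P where "P m = closest_point (B m)" for m
  have ne: "B m \<noteq> {}" "closed (B m)" "convex (B m)" for m by (auto simp: B_def)
  have Pc: "continuous_on S (P m)" for m S
    unfolding P_def by (rule continuous_on_closest_point[OF ne(3,2,1)])
  have Pb: "cmod (P m z) \<le> real m" for m z
    using closest_point_in_set[OF ne(2,1), of m z] by (simp add: P_def B_def)
  have Pm [measurable]: "P m \<in> borel_measurable borel" for m
    by (rule borel_measurable_continuous_onI[OF Pc])
  have [measurable]: "v \<in> borel_measurable borel" using v by (simp add: loc_L2_def)
  have "(\<lambda>m. LINT z|lborel. indicator (cball 0 R) z * (cmod (v z - P m (v z)))\<^sup>2) \<longlonglongrightarrow> (LINT z|(lborel :: complex measure). (0::real))"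
  proof (rule integral_dominated_convergence[where w = "\<lambda>z. indicator (cball 0 R) z * (cmod (v z))\<^sup>2"])
    show "integrable lborel (\<lambda>z. indicator (cball 0 R) z * (cmod (v z))\<^sup>2)"
      using v by (simp add: loc_L2_def)
    have "(\<lambda>m. indicator (cball 0 R) z * (cmod (v z - P m (v z)))\<^sup>2) \<longlonglongrightarrow> (0::real)" for z
    proof (rule tendsto_eventually)
      obtain k where k: "cmod (v z) \<le> real k" using real_arch_simple by blast
      show "\<forall>\<^sub>F m in sequentially. indicator (cball 0 R) z * (cmod (v z - P m (v z)))\<^sup>2 = (0::real)"
        using eventually_ge_at_top[of k]
      proof eventually_elim
        case (elim m)
        then have "P m (v z) = v z" unfolding P_def using k by (intro closest_point_self) (simp add: B_def)
        then show ?case by simp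
      qed
    qed
    then show "AE z in lborel. (\<lambda>m. indicator (cball 0 R) z * (cmod (v z - P m (v z)))\<^sup>2) \<longlonglongrightarrow> (0::real)" by simp
    fix m
    have "cmod (v z - P m (v z)) \<le> cmod (v z)" for z
      using closest_point_le[OF ne(2), of 0 m "v z"] by (simp add: P_def dist_norm B_def)
    then show "AE z in lborel. norm (indicator (cball 0 R) z * (cmod (v z - P m (v z)))\<^sup>2) \<le> indicator (cball 0 R) z * (cmod (v z))\<^sup>2"
      by (intro AE_I2) (simp add: indicator_def power_mono)
  qed measurable
  then have "(\<lambda>m. LINT z|lborel. indicator (cball 0 R) z * (cmod (v z - P m (v z)))\<^sup>2) \<longlonglongrightarrow> 0" by simp
  then have "\<forall>\<^sub>F m in sequentially. (LINT z|lborel. indicator (cball 0 R) z * (cmod (v z - P m (v z)))\<^sup>2) < e / 4"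
    using e by (intro order_tendstoD(2)) auto
  then obtain m where m: "(LINT z|lborel. indicator (cball 0 R) z * (cmod (v z - P m (v z)))\<^sup>2) < e / 4"
    using eventually_happens'[OF sequentially_bot] by blast
  \<comment> \<open>Two points in the disc of radius \<open>m\<close> are at most this far apart.\<close>
  define M where "M = real m + real m"
  have "v \<in> borel_measurable lebesgue" by (rule measurable_completion) simp
  then have "v measurable_on UNIV" by (rule lebesgue_measurable_imp_measurable_on) simp
  then obtain N g where N: "negligible N" and g: "\<And>n. continuous_on UNIV (g n)" "\<And>x. x \<notin> N \<Longrightarrow> (\<lambda>n. g n x) \<longlonglongrightarrow> v x"
    unfolding measurable_on_def by auto
  have "AE x in lebesgue. (\<lambda>n. g n x) \<longlonglongrightarrow> v x"
    by (rule AE_I'[of N]) (use N g(2) in \<open>auto simp: negligible_iff_null_sets\<close>)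
  then have gv: "AE x in lborel. (\<lambda>n. g n x) \<longlonglongrightarrow> v x" by (simp add: AE_completion_iff)
  have [measurable]: "g n \<in> borel_measurable borel" for n
    by (rule borel_measurable_continuous_onI[OF g(1)])
  have "(\<lambda>n. LINT z|lborel. indicator (cball 0 R) z * (cmod (P m (v z) - P m (g n z)))\<^sup>2) \<longlonglongrightarrow> (LINT z|(lborel :: complex measure). (0::real))"
  proof (rule integral_dominated_convergence[where w = "\<lambda>z. indicator (cball 0 R) z * M\<^sup>2"])
    show "integrable lborel (\<lambda>z. indicator (cball (0::complex) R) z * M\<^sup>2)"
      by (intro integrable_mult_left integrable_indicator_cball)
    show "AE z in lborel. (\<lambda>n. indicator (cball 0 R) z * (cmod (P m (v z) - P m (g n z)))\<^sup>2) \<longlonglongrightarrow> (0::real)"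
      using gv
    proof eventually_elim
      case (elim z)
      have "(\<lambda>n. P m (g n z)) \<longlonglongrightarrow> P m (v z)"
        by (rule continuous_on_tendsto_compose[OF Pc[of UNIV] elim]) auto
      then have "(\<lambda>n. indicator (cball 0 R) z * (cmod (P m (v z) - P m (g n z)))\<^sup>2) \<longlonglongrightarrow>
          indicator (cball 0 R) z * (cmod (P m (v z) - P m (v z)))\<^sup>2"
        by (intro tendsto_intros)
      then show ?case by simp
    qed
    fix n
    have "cmod (P m (v z) - P m (g n z)) \<le> M" for z
      unfolding M_def by (rule order_trans[OF norm_triangle_ineq4 add_mono[OF Pb Pb]])
    then show "AE z in lborel. norm (indicator (cball 0 R) z * (cmod (P m (v z) - P m (g n z)))\<^sup>2) \<le> indicator (cball 0 R) z * M\<^sup>2"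
      by (intro AE_I2) (simp add: indicator_def power_mono)
  qed measurable
  then have "(\<lambda>n. LINT z|lborel. indicator (cball 0 R) z * (cmod (P m (v z) - P m (g n z)))\<^sup>2) \<longlonglongrightarrow> 0" by simp
  then have "\<forall>\<^sub>F n in sequentially. (LINT z|lborel. indicator (cball 0 R) z * (cmod (P m (v z) - P m (g n z)))\<^sup>2) < e / 4"
    using e by (intro order_tendstoD(2)) auto
  then obtain n where n: "(LINT z|lborel. indicator (cball 0 R) z * (cmod (P m (v z) - P m (g n z)))\<^sup>2) < e / 4"
    using eventually_happens'[OF sequentially_bot] by blast
  have i1: "integrable lborel (\<lambda>z. indicator (cball 0 R) z * (cmod (v z - P m (v z)))\<^sup>2)"
  proof (rule Bochner_Integration.integrable_bound)
    show "integrable lborel (\<lambda>z. indicator (cball 0 R) z * (cmod (v z))\<^sup>2)"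
      using v by (simp add: loc_L2_def)
    have "cmod (v z - P m (v z)) \<le> cmod (v z)" for z
      using closest_point_le[OF ne(2), of 0 m "v z"] by (simp add: P_def dist_norm B_def)
    then show "AE z in lborel. norm (indicator (cball 0 R) z * (cmod (v z - P m (v z)))\<^sup>2) \<le> norm (indicator (cball 0 R) z * (cmod (v z))\<^sup>2)"
      by (intro AE_I2) (simp add: indicator_def power_mono)
  qed measurable
  have i2: "integrable lborel (\<lambda>z. indicator (cball 0 R) z * (cmod (P m (v z) - P m (g n z)))\<^sup>2)"
  proof (rule Bochner_Integration.integrable_bound)
    show "integrable lborel (\<lambda>z. indicator (cball (0::complex) R) z * M\<^sup>2)"
      by (intro integrable_mult_left integrable_indicator_cball)
    have "cmod (P m (v z) - P m (g n z)) \<le> M" for z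
      unfolding M_def by (rule order_trans[OF norm_triangle_ineq4 add_mono[OF Pb Pb]])
    then show "AE z in lborel. norm (indicator (cball 0 R) z * (cmod (P m (v z) - P m (g n z)))\<^sup>2) \<le> norm (indicator (cball 0 R) z * M\<^sup>2)"
      by (intro AE_I2) (simp add: indicator_def power_mono)
  qed measurable
  show ?thesis
  proof (rule that[of "\<lambda>z. P m (g n z)"])
    show "continuous_on UNIV (\<lambda>z. P m (g n z))"
      by (rule continuous_on_compose2[OF Pc g(1)]) auto
    have "(LINT z|lborel. indicator (cball 0 R) z * (cmod (v z - P m (g n z)))\<^sup>2) \<le>
       (LINT z|lborel. 2 * (indicator (cball 0 R) z * (cmod (v z - P m (v z)))\<^sup>2) + 2 * (indicator (cball 0 R) z * (cmod (P m (v z) - P m (g n z)))\<^sup>2))"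
    proof (rule integral_mono_AE')
      show "integrable lborel (\<lambda>z. 2 * (indicator (cball 0 R) z * (cmod (v z - P m (v z)))\<^sup>2) + 2 * (indicator (cball 0 R) z * (cmod (P m (v z) - P m (g n z)))\<^sup>2))"
        using i1 i2 by simp
      have "(cmod (v z - P m (g n z)))\<^sup>2 \<le> 2 * (cmod (v z - P m (v z)))\<^sup>2 + 2 * (cmod (P m (v z) - P m (g n z)))\<^sup>2" for z
        using norm_square_sum_le[of "v z - P m (v z)" "P m (v z) - P m (g n z)"] by simp
      then show "AE z in lborel. indicator (cball 0 R) z * (cmod (v z - P m (g n z)))\<^sup>2 \<le>
          2 * (indicator (cball 0 R) z * (cmod (v z - P m (v z)))\<^sup>2) + 2 * (indicator (cball 0 R) z * (cmod (P m (v z) - P m (g n z)))\<^sup>2)"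
        by (intro AE_I2) (simp add: indicator_def)
    qed simp
    also have "\<dots> < e" using i1 i2 m n by simp
    finally show "(LINT z|lborel. indicator (cball 0 R) z * (cmod (v z - P m (g n z)))\<^sup>2) < e" .
  qed
qed

section \<open>Mollification in the mean\<close>

lemma moll_continuous: "continuous_on S (moll n)"
  using moll_smooth smooth_continuous by blast

lemma conv_moll_integrable:
  assumes "loc_int v" shows "integrable lborel (\<lambda>w. v w * moll n (z - w))"
  by (rule integrable_conv[OF assms moll_continuous moll_outside])

lemma conv_moll_measurable:
  assumes "loc_int v" shows "conv v (moll n) \<in> borel_measurable borel"
  by (intro borel_measurable_continuous_onI smooth_continuous smooth_conv[OF assms moll_smooth moll_outside])

text \<open>Jensen's inequality for the probability density \<open>moll_real n\<close>, in the form of the Cauchy-Schwarz inequality, followed by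
Tonelli's theorem.\<close>

lemma conv_moll_L2_bound:
  assumes v: "loc_int v"
  shows "(\<integral>\<^sup>+z. ennreal ((cmod (conv v (moll n) z))\<^sup>2) \<partial>lborel) \<le> (\<integral>\<^sup>+w. ennreal ((cmod (v w))\<^sup>2) \<partial>lborel)"
proof -
  have [measurable]: "v \<in> borel_measurable borel" using v by (simp add: loc_int_def)
  have pw: "ennreal ((cmod (conv v (moll n) z))\<^sup>2) \<le> (\<integral>\<^sup>+w. ennreal ((cmod (v w))\<^sup>2) * ennreal (moll_real n (z - w)) \<partial>lborel)" for z
  proof -
    let ?m = "\<lambda>w. moll_real n (z - w)"
    have "ennreal (cmod (conv v (moll n) z)) \<le> (\<integral>\<^sup>+w. ennreal (norm (v w * moll n (z - w))) \<partial>lborel)"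
      unfolding conv_def by (rule integral_norm_bound_ennreal[OF conv_moll_integrable[OF v]])
    also have "\<dots> = (\<integral>\<^sup>+w. ennreal (cmod (v w) * sqrt (?m w)) * ennreal (sqrt (?m w)) \<partial>lborel)"
    proof (rule nn_integral_cong)
      fix w
      have "norm (v w * moll n (z - w)) = cmod (v w) * ?m w"
        using moll_real_nonneg[of n "z - w"] by (simp add: norm_mult moll_def)
      also have "\<dots> = (cmod (v w) * sqrt (?m w)) * sqrt (?m w)"
        using moll_real_nonneg[of n "z - w"] by (simp add: mult.assoc)
      finally show "ennreal (norm (v w * moll n (z - w))) = ennreal (cmod (v w) * sqrt (?m w)) * ennreal (sqrt (?m w))"
        using moll_real_nonneg[of n "z - w"] by (simp add: ennreal_mult)
    qed
    finally have "(ennreal (cmod (conv v (moll n) z)))\<^sup>2 \<le> (\<integral>\<^sup>+w. ennreal (cmod (v w) * sqrt (?m w)) * ennreal (sqrt (?m w)) \<partial>lborel)\<^sup>2"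
      by (rule power_mono) simp
    also have "\<dots> \<le> (\<integral>\<^sup>+w. (ennreal (cmod (v w) * sqrt (?m w)))\<^sup>2 \<partial>lborel) * (\<integral>\<^sup>+w. (ennreal (sqrt (?m w)))\<^sup>2 \<partial>lborel)"
      by (rule Cauchy_Schwarz_nn_integral) measurable
    also have "(\<integral>\<^sup>+w. (ennreal (sqrt (?m w)))\<^sup>2 \<partial>lborel) = (\<integral>\<^sup>+w. ennreal (moll_real n (w - z)) \<partial>lborel)"
      by (rule nn_integral_cong) (simp add: ennreal_power moll_real_nonneg moll_real_minus[of n z])
    also have "\<dots> = 1" by (rule nn_integral_moll_real)
    also have "(\<integral>\<^sup>+w. (ennreal (cmod (v w) * sqrt (?m w)))\<^sup>2 \<partial>lborel) = (\<integral>\<^sup>+w. ennreal ((cmod (v w))\<^sup>2) * ennreal (?m w) \<partial>lborel)"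
      by (rule nn_integral_cong) (simp add: ennreal_power moll_real_nonneg power_mult_distrib flip: ennreal_mult)
    finally show ?thesis by (simp add: ennreal_power)
  qed
  have "(\<integral>\<^sup>+z. ennreal ((cmod (conv v (moll n) z))\<^sup>2) \<partial>lborel)
      \<le> (\<integral>\<^sup>+z. \<integral>\<^sup>+w. ennreal ((cmod (v w))\<^sup>2) * ennreal (moll_real n (z - w)) \<partial>lborel \<partial>lborel)"
    by (rule nn_integral_mono) (rule pw)
  also have "\<dots> = (\<integral>\<^sup>+w. \<integral>\<^sup>+z. ennreal ((cmod (v w))\<^sup>2) * ennreal (moll_real n (z - w)) \<partial>lborel \<partial>lborel)"
    by (rule lborel_pair.Fubini') measurable
  also have "\<dots> = (\<integral>\<^sup>+w. ennreal ((cmod (v w))\<^sup>2) \<partial>lborel)"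
    by (rule nn_integral_cong) (simp add: nn_integral_cmult nn_integral_moll_real)
  finally show ?thesis .
qed

lemma continuous_conv_moll_uniform:
  assumes c: "continuous_on UNIV c" and e: "e > 0"
  shows "\<forall>\<^sub>F n in sequentially. \<forall>z\<in>cball 0 R. cmod (conv c (moll n) z - c z) \<le> e"
proof -
  have "uniformly_continuous_on (cball 0 (R + 1)) c"
    by (intro compact_uniformly_continuous) (auto intro: continuous_on_subset[OF c])
  then obtain d where d: "d > 0" "\<And>x x'. x \<in> cball 0 (R+1) \<Longrightarrow> x' \<in> cball 0 (R+1) \<Longrightarrow> dist x' x < d \<Longrightarrow> dist (c x') (c x) < e"
    using e unfolding uniformly_continuous_on_def by meson
  have l: "loc_int c"
    unfolding loc_int_def set_integrable_def
    using c borel_integrable_compact[OF compact_cball] borel_measurable_continuous_onI continuous_on_subset by blast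
  have "\<forall>\<^sub>F n in sequentially. 1 / real (Suc n) < d"
    using d(1) LIMSEQ_inverse_real_of_nat by (intro order_tendstoD(2)[of _ 0]) (auto simp: inverse_eq_divide)
  then show ?thesis
  proof eventually_elim
    case (elim n)
    show ?case
    proof
      fix z :: complex assume z: "z \<in> cball 0 R"
      have I: "integrable lborel (\<lambda>w. c z * moll n (z - w))"
        unfolding moll_def using moll_translate(1)[of n z] by simp
      have one: "(LINT w|lborel. c z * moll n (z - w)) = c z"
        unfolding moll_def using moll_translate[of n z] by simp
      have "conv c (moll n) z - c z = (LINT w|lborel. c w * moll n (z - w)) - (LINT w|lborel. c z * moll n (z - w))"
        unfolding conv_def one by simp
      then have eq: "conv c (moll n) z - c z = (LINT w|lborel. c w * moll n (z - w) - c z * moll n (z - w))"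
        using conv_moll_integrable[OF l, of n z] I by simp
      have "norm (LINT w|lborel. c w * moll n (z - w) - c z * moll n (z - w)) \<le> (LINT w|lborel. e * moll_real n (z - w))"
      proof (rule Bochner_Integration.integral_norm_bound_integral)
        show "integrable lborel (\<lambda>w. c w * moll n (z - w) - c z * moll n (z - w))"
          using conv_moll_integrable[OF l, of n z] I by simp
        show "integrable lborel (\<lambda>w. e * moll_real n (z - w))" using moll_translate(1)[of n z] by simp
        fix w
        show "norm (c w * moll n (z - w) - c z * moll n (z - w)) \<le> e * moll_real n (z - w)"
        proof (cases "cmod (z - w) < 1 / Suc n")
          case True
          have "1 / real (Suc n) \<le> 1" by simp
          then have "cmod (z - w) \<le> 1" using True by linarith
          moreover have "cmod w \<le> cmod z + cmod (z - w)" using norm_triangle_ineq4[of z "z - w"] by simp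
          ultimately have "w \<in> cball 0 (R + 1)" "z \<in> cball 0 (R + 1)" using z by auto
          moreover have "dist w z < d" using True elim by (simp add: dist_norm norm_minus_commute)
          ultimately have "cmod (c w - c z) \<le> e" using d(2)[of z w] by (simp add: dist_norm less_imp_le)
          then have "cmod (c w - c z) * moll_real n (z - w) \<le> e * moll_real n (z - w)"
            by (rule mult_right_mono) (rule moll_real_nonneg)
          then show ?thesis
            using moll_real_nonneg[of n "z - w"] by (simp add: moll_def norm_mult flip: left_diff_distrib)
        next
          case False
          then show ?thesis using moll_real_outside[of n "z - w"] by (simp add: moll_def)
        qed
      qed
      then show "cmod (conv c (moll n) z - c z) \<le> e" using moll_translate[of n z] by (simp add: eq)
    qed
  qed
qed

lemma conv_moll_local:
  assumes "\<And>w. dist z w \<le> 1 \<Longrightarrow> u w = v w"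
  shows "conv u (moll n) z = conv v (moll n) z"
  unfolding conv_def
proof (rule Bochner_Integration.integral_cong)
  fix w
  show "u w * moll n (z - w) = v w * moll n (z - w)"
  proof (cases "dist z w \<le> 1")
    case False
    have "1 / real (Suc n) \<le> 1" by simp
    then have "1 / real (Suc n) < cmod (z - w)" using False by (simp only: dist_norm)
    then show ?thesis by (simp only: moll_outside mult_zero_right)
  qed (use assms in simp)
qed simp

lemma loc_L2_continuous: "continuous_on UNIV c \<Longrightarrow> loc_L2 c"
  unfolding loc_L2_def
proof (intro conjI allI)
  assume c: "continuous_on UNIV c"
  then show "c \<in> borel_measurable borel" by (rule borel_measurable_continuous_onI)
  fix R :: real
  have "continuous_on (cball 0 R) (\<lambda>z. (cmod (c z))\<^sup>2)"
    by (intro continuous_intros continuous_on_subset[OF c]) auto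
  from borel_integrable_compact[OF compact_cball this]
  show "integrable lborel (\<lambda>z. indicator (cball 0 R) z * (cmod (c z))\<^sup>2)" by simp
qed

lemma loc_L2_add:
  assumes u: "loc_L2 u" and v: "loc_L2 v" shows "loc_L2 (\<lambda>z. u z + v z)"
  unfolding loc_L2_def
proof (intro conjI allI)
  have [measurable]: "u \<in> borel_measurable borel" "v \<in> borel_measurable borel" using u v by (auto simp: loc_L2_def)
  show "(\<lambda>z. u z + v z) \<in> borel_measurable borel" by measurable
  fix R :: real
  have "integrable lborel (\<lambda>z. 2 * (indicator (cball 0 R) z * (cmod (u z))\<^sup>2) + 2 * (indicator (cball 0 R) z * (cmod (v z))\<^sup>2))"
    using u v by (simp add: loc_L2_def)
  then show "integrable lborel (\<lambda>z. indicator (cball 0 R) z * (cmod (u z + v z))\<^sup>2)"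
    by (rule Bochner_Integration.integrable_bound)
      (auto simp: indicator_def intro!: AE_I2 norm_square_sum_le)
qed

lemma loc_L2_bounded_mult:
  assumes u: "loc_L2 u" and b[measurable]: "b \<in> borel_measurable borel" and B: "\<And>z. cmod (b z) \<le> B"
  shows "loc_L2 (\<lambda>z. b z * u z)"
  unfolding loc_L2_def
proof (intro conjI allI)
  have [measurable]: "u \<in> borel_measurable borel" using u by (auto simp: loc_L2_def)
  show "(\<lambda>z. b z * u z) \<in> borel_measurable borel" by measurable
  fix R :: real
  have "integrable lborel (\<lambda>z. B\<^sup>2 * (indicator (cball 0 R) z * (cmod (u z))\<^sup>2))"
    using u by (simp add: loc_L2_def)
  then show "integrable lborel (\<lambda>z. indicator (cball 0 R) z * (cmod (b z * u z))\<^sup>2)"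
  proof (rule Bochner_Integration.integrable_bound)
    have "(cmod (b z * u z))\<^sup>2 \<le> B\<^sup>2 * (cmod (u z))\<^sup>2" for z
      using B[of z] by (simp add: norm_mult power_mult_distrib mult_right_mono power_mono)
    then show "AE z in lborel. norm (indicator (cball 0 R) z * (cmod (b z * u z))\<^sup>2)
        \<le> norm (B\<^sup>2 * (indicator (cball 0 R) z * (cmod (u z))\<^sup>2))"
      by (intro AE_I2) (simp add: indicator_def)
  qed measurable
qed

lemma loc_L2_minus: "loc_L2 u \<Longrightarrow> loc_L2 (\<lambda>z. - u z)"
  using loc_L2_bounded_mult[of u "\<lambda>_. -1" 1] by simp

lemma loc_L2_diff: "loc_L2 u \<Longrightarrow> loc_L2 v \<Longrightarrow> loc_L2 (\<lambda>z. u z - v z)"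
  using loc_L2_add[of u "\<lambda>z. - v z"] loc_L2_minus[of v] by simp

lemma conv_add:
  assumes "loc_int u" "loc_int v"
  shows "conv (\<lambda>z. u z + v z) (moll n) z = conv u (moll n) z + conv v (moll n) z"
  unfolding conv_def using conv_moll_integrable[OF assms(1), of n z] conv_moll_integrable[OF assms(2), of n z]
  by (simp add: distrib_right)

text \<open>The contraction property \<open>conv_moll_L2_bound\<close> reduces the claim to continuous functions, for which mollification converges
locally uniformly.  As the mollifiers are supported in the unit disc, only the values of \<open>v\<close> in a slightly larger disc count.\<close>

theorem conv_moll_tendsto_L2:
  assumes v: "loc_L2 v"
  shows "(\<lambda>n. LINT z|lborel. indicator (cball 0 R) z * (cmod (conv v (moll n) z - v z))\<^sup>2) \<longlonglongrightarrow> 0"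
proof (rule order_tendstoI)
  fix a :: real assume "a < 0"
  then show "\<forall>\<^sub>F n in sequentially. a < (LINT z|lborel. indicator (cball 0 R) z * (cmod (conv v (moll n) z - v z))\<^sup>2)"
    by (intro always_eventually allI less_le_trans[OF \<open>a < 0\<close>] integral_nonneg_AE AE_I2) (auto simp: indicator_def)
next
  fix e :: real assume e: "e > 0"
  define Q where "Q = (LINT z|lborel. indicator (cball (0::complex) R) z :: real)"
  have Q: "Q \<ge> 0" unfolding Q_def by (intro integral_nonneg_AE AE_I2) simp
  define \<epsilon> where "\<epsilon> = sqrt (e / (8 * (Q + 1)))"
  have \<epsilon>: "\<epsilon> > 0" "\<epsilon>\<^sup>2 * Q < e / 4"
  proof -
    show "\<epsilon> > 0" using e Q by (simp add: \<epsilon>_def)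
    have "\<epsilon>\<^sup>2 * Q = e / 8 * (Q / (Q + 1))" using e Q by (simp add: \<epsilon>_def field_simps)
    also have "\<dots> \<le> e / 8 * 1" using e Q by (intro mult_left_mono) (auto simp: divide_le_eq)
    finally show "\<epsilon>\<^sup>2 * Q < e / 4" using e by simp
  qed
  have "e / 16 > 0" using e by simp
  then obtain c where c: "continuous_on UNIV c"
    "(LINT z|lborel. indicator (cball 0 (R + 1)) z * (cmod (v z - c z))\<^sup>2) < e / 16"
    using continuous_L2_approximation[OF v] by blast
  define d where "d z = indicator (cball 0 (R + 1)) z * (v z - c z)" for z
  have [measurable]: "v \<in> borel_measurable borel" using v by (simp add: loc_L2_def)
  have [measurable]: "c \<in> borel_measurable borel" using c(1) by (rule borel_measurable_continuous_onI)
  have vc: "loc_L2 (\<lambda>z. v z - c z)" by (intro loc_L2_diff v loc_L2_continuous c(1))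
  have d: "loc_L2 d"
    unfolding d_def[abs_def] by (rule loc_L2_bounded_mult[OF vc, where B = 1]) (auto simp: indicator_def)
  have [measurable]: "d \<in> borel_measurable borel" using d by (simp add: loc_L2_def)
  note li = loc_L2_imp_loc_int
  have dn: "(cmod (d z))\<^sup>2 = indicator (cball 0 (R + 1)) z * (cmod (v z - c z))\<^sup>2" for z
    by (simp add: d_def indicator_def)
  have di: "integrable lborel (\<lambda>z. (cmod (d z))\<^sup>2)"
    unfolding dn using vc by (simp add: loc_L2_def)
  have dl: "(LINT z|lborel. (cmod (d z))\<^sup>2) < e / 16" unfolding dn by (rule c(2))
  have nn: "(\<integral>\<^sup>+z. ennreal ((cmod (conv d (moll n) z))\<^sup>2) \<partial>lborel) \<le> ennreal (LINT z|lborel. (cmod (d z))\<^sup>2)" for n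
    using conv_moll_L2_bound[OF li[OF d], of n] by (simp add: nn_integral_eq_integral[OF di])
  have cm [measurable]: "conv d (moll n) \<in> borel_measurable borel" for n by (rule conv_moll_measurable[OF li[OF d]])
  have ci: "integrable lborel (\<lambda>z. (cmod (conv d (moll n) z))\<^sup>2)" for n
    by (rule integrableI_bounded) (use le_less_trans[OF nn ennreal_less_top] in auto)
  have cl: "(LINT z|lborel. (cmod (conv d (moll n) z))\<^sup>2) < e / 16" for n
  proof -
    have "ennreal (LINT z|lborel. (cmod (conv d (moll n) z))\<^sup>2) \<le> ennreal (LINT z|lborel. (cmod (d z))\<^sup>2)"
      using nn[of n] by (simp add: nn_integral_eq_integral[OF ci])
    then show ?thesis using dl by (subst (asm) ennreal_le_iff) (auto intro: integral_nonneg_AE)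
  qed
  show "\<forall>\<^sub>F n in sequentially. (LINT z|lborel. indicator (cball 0 R) z * (cmod (conv v (moll n) z - v z))\<^sup>2) < e"
    using continuous_conv_moll_uniform[OF c(1) \<epsilon>(1), of R]
  proof eventually_elim
    case (elim n)
    let ?B = "\<lambda>z. 4 * (cmod (conv d (moll n) z))\<^sup>2 + (4 * (cmod (d z))\<^sup>2 + 2 * \<epsilon>\<^sup>2 * indicator (cball 0 R) z)"
    have bi: "integrable lborel ?B"
      using ci di integrable_indicator_cball by simp
    have pw: "indicator (cball 0 R) z * (cmod (conv v (moll n) z - v z))\<^sup>2 \<le> ?B z" for z
    proof (cases "z \<in> cball 0 R")
      case True
      have "conv v (moll n) z = conv (\<lambda>w. d w + c w) (moll n) z"
      proof (rule conv_moll_local)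
        fix w assume "dist z w \<le> 1"
        then have "w \<in> cball 0 (R + 1)" using True norm_triangle_ineq4[of z "z - w"] by (simp add: dist_norm)
        then show "v w = d w + c w" by (simp add: d_def)
      qed
      also have "\<dots> = conv d (moll n) z + conv c (moll n) z"
        by (intro conv_add li d loc_L2_continuous c(1))
      finally have "conv v (moll n) z - v z = (conv d (moll n) z - d z) + (conv c (moll n) z - c z)"
        using True by (simp add: d_def indicator_def)
      then have "(cmod (conv v (moll n) z - v z))\<^sup>2 \<le> 2 * (cmod (conv d (moll n) z - d z))\<^sup>2 + 2 * (cmod (conv c (moll n) z - c z))\<^sup>2"
        using norm_square_sum_le by metis
      moreover have "(cmod (conv d (moll n) z - d z))\<^sup>2 \<le> 2 * (cmod (conv d (moll n) z))\<^sup>2 + 2 * (cmod (d z))\<^sup>2"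
        using norm_square_sum_le[of "conv d (moll n) z" "- d z"] by simp
      moreover have "(cmod (conv c (moll n) z - c z))\<^sup>2 \<le> \<epsilon>\<^sup>2"
        using elim True by (intro power_mono) auto
      ultimately show ?thesis using True by simp
    qed simp
    have "(LINT z|lborel. indicator (cball 0 R) z * (cmod (conv v (moll n) z - v z))\<^sup>2) \<le> integral\<^sup>L lborel ?B"
      by (rule integral_mono_AE'[OF bi]) (use pw in auto)
    also have "integral\<^sup>L lborel ?B = 4 * (LINT z|lborel. (cmod (conv d (moll n) z))\<^sup>2) + (4 * (LINT z|lborel. (cmod (d z))\<^sup>2) + 2 * (\<epsilon>\<^sup>2 * Q))"
      unfolding Q_def using ci[of n] di integrable_indicator_cball[of R] by simp
    also have "\<dots> < e" using cl[of n] dl \<epsilon>(2) by linarith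
    finally show ?case .
  qed
qed

section \<open>Wirtinger calculus and the fundamental lemma of the calculus of variations\<close>

lemma integrable_mult_L2:
  fixes f g :: "complex \<Rightarrow> real"
  assumes [measurable]: "f \<in> borel_measurable borel" "g \<in> borel_measurable borel"
    and f: "integrable lborel (\<lambda>z. (f z)\<^sup>2)" and g: "integrable lborel (\<lambda>z. (g z)\<^sup>2)"
  shows "integrable lborel (\<lambda>z. f z * g z)"
    "(LINT z|lborel. \<bar>f z * g z\<bar>) \<le> sqrt (LINT z|lborel. (f z)\<^sup>2) * sqrt (LINT z|lborel. (g z)\<^sup>2)"
proof -
  have ab: "\<bar>f z * g z\<bar> \<le> (f z)\<^sup>2 + (g z)\<^sup>2" for z
  proof -
    have "2 * (\<bar>f z\<bar> * \<bar>g z\<bar>) \<le> (f z)\<^sup>2 + (g z)\<^sup>2"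
      using sum_squares_bound[of "\<bar>f z\<bar>" "\<bar>g z\<bar>"] by (simp add: mult.assoc)
    moreover have "0 \<le> \<bar>f z\<bar> * \<bar>g z\<bar>" by simp
    ultimately show ?thesis unfolding abs_mult by linarith
  qed
  show I: "integrable lborel (\<lambda>z. f z * g z)"
    by (rule Bochner_Integration.integrable_bound[OF Bochner_Integration.integrable_add[OF f g]])
      (use ab in \<open>auto intro: order_trans[OF _ abs_ge_self]\<close>)
  have nnI: "integrable lborel (\<lambda>z. \<bar>f z * g z\<bar>)" using I by simp
  let ?A = "LINT z|lborel. \<bar>f z * g z\<bar>" and ?F = "LINT z|lborel. (f z)\<^sup>2" and ?G = "LINT z|lborel. (g z)\<^sup>2"
  have nn: "?A \<ge> 0" "?F \<ge> 0" "?G \<ge> 0" by (auto intro!: integral_nonneg_AE)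
  have "(\<integral>\<^sup>+z. ennreal \<bar>f z\<bar> * ennreal \<bar>g z\<bar> \<partial>lborel)\<^sup>2
    \<le> (\<integral>\<^sup>+z. (ennreal \<bar>f z\<bar>)\<^sup>2 \<partial>lborel) * (\<integral>\<^sup>+z. (ennreal \<bar>g z\<bar>)\<^sup>2 \<partial>lborel)"
    by (rule Cauchy_Schwarz_nn_integral) measurable
  also have "(\<integral>\<^sup>+z. (ennreal \<bar>f z\<bar>)\<^sup>2 \<partial>lborel) = ennreal ?F"
    by (subst nn_integral_eq_integral[OF f, symmetric]) (auto simp: ennreal_power)
  also have "(\<integral>\<^sup>+z. (ennreal \<bar>g z\<bar>)\<^sup>2 \<partial>lborel) = ennreal ?G"
    by (subst nn_integral_eq_integral[OF g, symmetric]) (auto simp: ennreal_power)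
  also have "(\<integral>\<^sup>+z. ennreal \<bar>f z\<bar> * ennreal \<bar>g z\<bar> \<partial>lborel) = ennreal ?A"
    by (subst nn_integral_eq_integral[OF nnI, symmetric]) (auto simp: abs_mult ennreal_mult)
  finally have "ennreal (?A\<^sup>2) \<le> ennreal (?F * ?G)"
    using nn by (simp add: ennreal_power ennreal_mult)
  then have "?A\<^sup>2 \<le> ?F * ?G" using nn by (subst (asm) ennreal_le_iff) auto
  then have "?A \<le> sqrt (?F * ?G)" using nn by (intro real_le_rsqrt) auto
  then show "?A \<le> sqrt ?F * sqrt ?G" by (simp add: real_sqrt_mult)
qed

lemma smooth_add: "smooth \<phi> \<Longrightarrow> smooth \<psi> \<Longrightarrow> smooth (\<lambda>z. \<phi> z + \<psi> z)"
  by (simp add: smooth_def C_k_add)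
lemma smooth_mult: "smooth \<phi> \<Longrightarrow> smooth \<psi> \<Longrightarrow> smooth (\<lambda>z. \<phi> z * \<psi> z)"
  by (simp add: smooth_def C_k_mult)
lemma smooth_const: "smooth (\<lambda>_. c)"
  by (simp add: smooth_def)
lemma smooth_cnj: "smooth \<phi> \<Longrightarrow> smooth (\<lambda>z. cnj (\<phi> z))"
  using C_k_linear_comp[OF bounded_linear_cnj] by (simp add: smooth_def)
lemma smooth_reflect: "smooth \<phi> \<Longrightarrow> smooth (\<lambda>w. \<phi> (z - w))"
  using C_k_affine[where a = z and c = "-1"] by (simp add: smooth_def)
lemma smooth_scale: "smooth \<phi> \<Longrightarrow> smooth (\<lambda>w. \<phi> (c *\<^sub>R w))"
  using C_k_affine[where a = 0 and c = c] by (simp add: smooth_def)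

lemma smooth_d_z: "smooth \<phi> \<Longrightarrow> smooth (d_z \<phi>)"
  and smooth_d_zbar: "smooth \<phi> \<Longrightarrow> smooth (d_zbar \<phi>)"
proof -
  assume s: "smooth \<phi>"
  note s' = smooth_d[OF s]
  have "smooth (\<lambda>z. (1/2) * (d_x \<phi> z + (- \<i>) * d_y \<phi> z))"
    by (intro smooth_mult smooth_add smooth_const s')
  then show "smooth (d_z \<phi>)" by (simp add: d_z_def[abs_def])
  have "smooth (\<lambda>z. (1/2) * (d_x \<phi> z + \<i> * d_y \<phi> z))"
    by (intro smooth_mult smooth_add smooth_const s')
  then show "smooth (d_zbar \<phi>)" by (simp add: d_zbar_def[abs_def])
qed

lemma frechet_combination:
  assumes "smooth a" "smooth b"
  shows "frechet_derivative (\<lambda>z. (a z + c * b z) / 2) (at z) d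
     = (frechet_derivative a (at z) d + c * frechet_derivative b (at z) d) / 2"
proof -
  have "((\<lambda>z. (1/2) * (a z + c * b z)) has_derivative
     (\<lambda>d. (1/2) * (frechet_derivative a (at z) d + c * frechet_derivative b (at z) d))) (at z)"
    by (intro has_derivative_mult_right has_derivative_add smooth_differentiable assms)
  then have D: "((\<lambda>z. (a z + c * b z) / 2) has_derivative
     (\<lambda>d. (frechet_derivative a (at z) d + c * frechet_derivative b (at z) d) / 2)) (at z)"
    by simp
  show ?thesis using fun_cong[OF frechet_derivative_at[OF D], of d] by (rule sym)
qed

lemma d_z_d_zbar_commute:
  assumes "smooth \<phi>" shows "d_z (d_zbar \<phi>) z = d_zbar (d_z \<phi>) z"
proof -
  note s = smooth_d[OF assms]
  have a: "d_zbar \<phi> = (\<lambda>z. (d_x \<phi> z + \<i> * d_y \<phi> z) / 2)" by (simp add: d_zbar_def[abs_def])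
  have b: "d_z \<phi> = (\<lambda>z. (d_x \<phi> z + (- \<i>) * d_y \<phi> z) / 2)" by (simp add: d_z_def[abs_def])
  have A: "d_z (d_zbar \<phi>) z = ((d_x (d_x \<phi>) z + \<i> * d_x (d_y \<phi>) z) / 2 - \<i> * ((d_y (d_x \<phi>) z + \<i> * d_y (d_y \<phi>) z) / 2)) / 2"
    unfolding d_z_def[of "d_zbar \<phi>"] unfolding a frechet_combination[OF s] ..
  have B: "d_zbar (d_z \<phi>) z = ((d_x (d_x \<phi>) z + (- \<i>) * d_x (d_y \<phi>) z) / 2 + \<i> * ((d_y (d_x \<phi>) z + (- \<i>) * d_y (d_y \<phi>) z) / 2)) / 2"
    unfolding d_zbar_def[of "d_z \<phi>"] unfolding b frechet_combination[OF s] ..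
  show ?thesis unfolding A B using mixed_partials_commute[OF assms, of z] by (simp add: field_simps)
qed

lemma d_z_mult:
  assumes "smooth a" "smooth b"
  shows "d_z (\<lambda>z. a z * b z) z = d_z a z * b z + a z * d_z b z"
    "d_zbar (\<lambda>z. a z * b z) z = d_zbar a z * b z + a z * d_zbar b z"
proof -
  have "((\<lambda>z. a z * b z) has_derivative
     (\<lambda>d. a z * frechet_derivative b (at z) d + frechet_derivative a (at z) d * b z)) (at z)"
    by (intro has_derivative_mult smooth_differentiable assms)
  from frechet_derivative_at[OF this, symmetric]
  have *: "frechet_derivative (\<lambda>z. a z * b z) (at z) =
     (\<lambda>d. a z * frechet_derivative b (at z) d + frechet_derivative a (at z) d * b z)" .
  show "d_z (\<lambda>z. a z * b z) z = d_z a z * b z + a z * d_z b z"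
    "d_zbar (\<lambda>z. a z * b z) z = d_zbar a z * b z + a z * d_zbar b z"
    unfolding d_z_def d_zbar_def * by (auto simp: field_simps)
qed

lemma d_z_outside:
  assumes "closed K" "\<And>w. w \<notin> K \<Longrightarrow> \<phi> w = 0" "z \<notin> K"
  shows "d_z \<phi> z = 0" "d_zbar \<phi> z = 0"
  using frechet_zero_outside[OF assms] by (auto simp: d_z_def d_zbar_def)

lemma test_functions_d_z:
  assumes "\<phi> \<in> test_functions U" shows "d_z \<phi> \<in> test_functions U" "d_zbar \<phi> \<in> test_functions U"
proof -
  note T = test_functionsD[OF assms]
  from T(2) obtain K where K: "compact K" "K \<subseteq> U" "\<And>z. z \<notin> K \<Longrightarrow> \<phi> z = 0" by metis
  note o = d_z_outside[OF compact_imp_closed[OF K(1)] K(3)]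
  show "d_z \<phi> \<in> test_functions U" "d_zbar \<phi> \<in> test_functions U"
    using K(1,2) o by (auto intro!: test_functionsI[where K = K] smooth_d_z smooth_d_zbar T(1))
qed

lemma test_functions_mult:
  assumes "\<phi> \<in> test_functions U" "smooth \<psi>" shows "(\<lambda>z. \<psi> z * \<phi> z) \<in> test_functions U"
proof -
  note T = test_functionsD[OF assms(1)]
  from T(2) obtain K where K: "compact K" "K \<subseteq> U" "\<And>z. z \<notin> K \<Longrightarrow> \<phi> z = 0" by metis
  then show ?thesis by (intro test_functionsI[where K = K] smooth_mult assms T(1)) auto
qed

lemma test_function_continuous: "\<phi> \<in> test_functions U \<Longrightarrow> continuous_on S \<phi>"
  using test_functionsD(1) smooth_continuous by blast

lemma integrable_test:
  assumes "loc_int v" "\<phi> \<in> test_functions UNIV" shows "integrable lborel (\<lambda>z. v z * \<phi> z)"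
proof -
  obtain R where "\<And>z. R < cmod z \<Longrightarrow> \<phi> z = 0" using assms(2) by (auto simp: test_functions_UNIV_iff)
  then show ?thesis
    by (intro integrable_mult_compact_support[OF assms(1) test_function_continuous[OF assms(2)]])
qed

lemma moll_reflect_test:
  assumes "cball z (1 / Suc n) \<subseteq> U" shows "(\<lambda>w. moll n (z - w)) \<in> test_functions U"
proof (rule test_functionsI[OF smooth_reflect[OF moll_smooth] compact_cball assms])
  fix w assume "w \<notin> cball z (1 / real (Suc n))"
  then show "moll n (z - w) = 0" by (intro moll_outside) (simp add: dist_norm)
qed

text \<open>Mollifying \<open>v\<close> at a point is testing it with a translated bump, so on each compact subset of \<open>V\<close> the mollifications of \<open>v\<close> vanish eventually;
on the other hand they converge to \<open>v\<close> in the mean.\<close>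

theorem fundamental_lemma:
  assumes v: "loc_L2 v" and V: "open V"
    and zero: "\<And>\<phi>. \<phi> \<in> test_functions V \<Longrightarrow> (LINT z|lborel. v z * \<phi> z) = 0"
  shows "AE z in lborel. z \<in> V \<longrightarrow> v z = 0"
proof -
  have [measurable]: "v \<in> borel_measurable borel" using v by (simp add: loc_L2_def)
  have K: "AE z in lborel. z \<in> K \<longrightarrow> v z = 0" if K: "compact K" "K \<subseteq> V" for K
  proof -
    obtain d where d: "d > 0" "(\<Union>z\<in>K. ball z d) \<subseteq> V"
      using compact_subset_open_imp_ball_epsilon_subset[OF K(1) V K(2)] by blast
    obtain R where R: "\<forall>x\<in>K. cmod x \<le> R"
      using compact_imp_bounded[OF K(1)] by (auto simp: bounded_iff)
    have [measurable]: "K \<in> sets borel" using K by (simp add: compact_imp_closed)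
    have "\<forall>\<^sub>F n in sequentially. 1 / real (Suc n) < d"
      using d(1) LIMSEQ_inverse_real_of_nat by (intro order_tendstoD(2)[of _ 0]) (auto simp: inverse_eq_divide)
    then have "\<forall>\<^sub>F n in sequentially. (LINT z|lborel. indicator K z * (cmod (v z))\<^sup>2)
       \<le> (LINT z|lborel. indicator (cball 0 R) z * (cmod (conv v (moll n) z - v z))\<^sup>2)"
    proof eventually_elim
      case (elim n)
      have z: "conv v (moll n) z = 0" if "z \<in> K" for z
        unfolding conv_def
      proof (rule zero, rule moll_reflect_test)
        have "cball z (1 / real (Suc n)) \<subseteq> ball z d" using elim by auto
        then show "cball z (1 / real (Suc n)) \<subseteq> V" using d that by blast
      qed
      have cL: "loc_L2 (\<lambda>z. conv v (moll n) z - v z)"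
        by (intro loc_L2_diff v loc_L2_continuous smooth_continuous
            smooth_conv[OF loc_L2_imp_loc_int[OF v] moll_smooth moll_outside])
      show ?case
      proof (rule integral_mono_AE')
        show "integrable lborel (\<lambda>z. indicator (cball 0 R) z * (cmod (conv v (moll n) z - v z))\<^sup>2)"
          using cL by (simp add: loc_L2_def)
        show "AE z in lborel. indicator K z * (cmod (v z))\<^sup>2 \<le> indicator (cball 0 R) z * (cmod (conv v (moll n) z - v z))\<^sup>2"
          using z R by (intro AE_I2) (auto simp: indicator_def)
      qed simp
    qed
    from tendsto_lowerbound[OF conv_moll_tendsto_L2[OF v] this]
    have le: "(LINT z|lborel. indicator K z * (cmod (v z))\<^sup>2) \<le> 0" by simp
    have "integrable lborel (\<lambda>z. indicator (cball 0 R) z * (cmod (v z))\<^sup>2)" using v by (simp add: loc_L2_def)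
    then have I: "integrable lborel (\<lambda>z. indicator K z * (cmod (v z))\<^sup>2)"
      by (rule Bochner_Integration.integrable_bound) (use R in \<open>auto simp: indicator_def\<close>)
    have "(LINT z|lborel. indicator K z * (cmod (v z))\<^sup>2) = 0"
      using le by (intro antisym integral_nonneg_AE AE_I2) auto
    then have "AE z in lborel. indicator K z * (cmod (v z))\<^sup>2 = 0"
      using integral_nonneg_eq_0_iff_AE[OF I] by simp
    then show ?thesis by eventually_elim (auto simp: indicator_def)
  qed
  obtain F where F: "countable F" "\<And>C. C \<in> F \<Longrightarrow> compact C \<and> C \<subseteq> V" "V = \<Union>F"
  proof -
    obtain D where D: "range D \<subseteq> Collect compact" "V = \<Union>(range (D :: nat \<Rightarrow> _))"
      using open_Union_compact_subsets[OF V] by (metis image_subset_iff mem_Collect_eq)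
    show ?thesis by (rule that[of "range D"]) (use D in auto)
  qed
  have "AE z in lborel. \<forall>C\<in>F. z \<in> C \<longrightarrow> v z = 0"
    using F by (intro AE_ball_countable' K) auto
  then show ?thesis by eventually_elim (use F(3) in auto)
qed

section \<open>Weak derivatives\<close>

text \<open>Here \<open>h\<close> and \<open>w\<close> stand for the derivatives of \<open>g\<close> with respect to \<open>z\<close> and \<open>cnj z\<close>.  Continuity and local square integrability belong
to the notion, so that all integrals against test functions converge.\<close>

definition weak_derivs :: "(complex \<Rightarrow> complex) \<Rightarrow> (complex \<Rightarrow> complex) \<Rightarrow> (complex \<Rightarrow> complex) \<Rightarrow> bool" where
  "weak_derivs g h w \<longleftrightarrow> continuous_on UNIV g \<and> loc_L2 h \<and> loc_L2 w \<and>
     (\<forall>\<phi>\<in>test_functions UNIV.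
        (LINT z|lborel. h z * \<phi> z) = - (LINT z|lborel. g z * d_z \<phi> z) \<and>
        (LINT z|lborel. w z * \<phi> z) = - (LINT z|lborel. g z * d_zbar \<phi> z))"

lemma weak_derivsD:
  assumes "weak_derivs g h w"
  shows "continuous_on UNIV g" "loc_L2 h" "loc_L2 w"
    "\<phi> \<in> test_functions UNIV \<Longrightarrow> (LINT z|lborel. h z * \<phi> z) = - (LINT z|lborel. g z * d_z \<phi> z)"
    "\<phi> \<in> test_functions UNIV \<Longrightarrow> (LINT z|lborel. w z * \<phi> z) = - (LINT z|lborel. g z * d_zbar \<phi> z)"
  using assms by (auto simp: weak_derivs_def)

text \<open>Testing each of the two derivatives with the other derivative of \<open>\<phi>\<close> gives the integral of \<open>g\<close> against the same
second derivative of \<open>\<phi>\<close>.\<close>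

lemma weak_derivs_mixed:
  assumes w: "weak_derivs g h w" and \<phi>: "\<phi> \<in> test_functions UNIV"
  shows "(LINT z|lborel. h z * d_zbar \<phi> z) = (LINT z|lborel. w z * d_z \<phi> z)"
  using weak_derivsD(4)[OF w test_functions_d_z(2)[OF \<phi>]] weak_derivsD(5)[OF w test_functions_d_z(1)[OF \<phi>]]
  by (simp add: d_z_d_zbar_commute[OF test_functionsD(1)[OF \<phi>]])

lemma frechet_cnj:
  assumes "smooth \<phi>"
  shows "frechet_derivative (\<lambda>z. cnj (\<phi> z)) (at z) d = cnj (frechet_derivative \<phi> (at z) d)"
proof -
  have "((\<lambda>z. cnj (\<phi> z)) has_derivative (\<lambda>d. cnj (frechet_derivative \<phi> (at z) d))) (at z)"
    by (rule bounded_linear.has_derivative[OF bounded_linear_cnj smooth_differentiable[OF assms]])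
  from fun_cong[OF frechet_derivative_at[OF this], of d] show ?thesis by simp
qed

lemma d_z_cnj:
  assumes "smooth \<phi>"
  shows "d_z (\<lambda>z. cnj (\<phi> z)) z = cnj (d_zbar \<phi> z)" "d_zbar (\<lambda>z. cnj (\<phi> z)) z = cnj (d_z \<phi> z)"
  by (simp_all add: d_z_def d_zbar_def frechet_cnj[OF assms])

lemma loc_L2_cnj: "loc_L2 h \<Longrightarrow> loc_L2 (\<lambda>z. cnj (h z))"
  by (auto simp: loc_L2_def intro: borel_measurable_continuous_on[OF continuous_on_cnj[OF continuous_on_id]])

lemma test_functions_cnj:
  assumes "\<phi> \<in> test_functions U" shows "(\<lambda>z. cnj (\<phi> z)) \<in> test_functions U"
proof -
  note T = test_functionsD[OF assms]
  from T(2) obtain K where K: "compact K" "K \<subseteq> U" "\<And>z. z \<notin> K \<Longrightarrow> \<phi> z = 0" by metis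
  then show ?thesis by (intro test_functionsI[where K = K] smooth_cnj T(1)) auto
qed

lemma weak_derivs_cnj:
  assumes w: "weak_derivs g h w"
  shows "weak_derivs (\<lambda>z. cnj (g z)) (\<lambda>z. cnj (w z)) (\<lambda>z. cnj (h z))"
  unfolding weak_derivs_def
proof (intro conjI ballI)
  show "continuous_on UNIV (\<lambda>z. cnj (g z))" by (intro continuous_intros weak_derivsD(1)[OF w])
  show "loc_L2 (\<lambda>z. cnj (w z))" "loc_L2 (\<lambda>z. cnj (h z))" using weak_derivsD[OF w] loc_L2_cnj by blast+
  fix \<phi> assume \<phi>: "\<phi> \<in> test_functions UNIV"
  define \<psi> where "\<psi> z = cnj (\<phi> z)" for z
  have \<psi>: "\<psi> \<in> test_functions UNIV" unfolding \<psi>_def[abs_def] by (rule test_functions_cnj[OF \<phi>])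
  note s = test_functionsD(1)[OF \<phi>]
  have d: "d_z \<psi> z = cnj (d_zbar \<phi> z)" "d_zbar \<psi> z = cnj (d_z \<phi> z)" for z
    unfolding \<psi>_def[abs_def] by (rule d_z_cnj[OF s])+
  have c: "(LINT z|lborel. cnj (a z) * b z) = cnj (LINT z|lborel. a z * cnj (b z))" for a b :: "complex \<Rightarrow> complex"
    by (subst Bochner_Integration.integral_cnj[symmetric]) simp
  show "(LINT z|lborel. cnj (w z) * \<phi> z) = - (LINT z|lborel. cnj (g z) * d_z \<phi> z)"
    using weak_derivsD(5)[OF w \<psi>] unfolding c d by (simp add: \<psi>_def)
  show "(LINT z|lborel. cnj (h z) * \<phi> z) = - (LINT z|lborel. cnj (g z) * d_zbar \<phi> z)"
    using weak_derivsD(4)[OF w \<psi>] unfolding c d by (simp add: \<psi>_def)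
qed

lemma d_z_reflect:
  assumes "smooth \<phi>"
  shows "d_z (\<lambda>w. \<phi> (z - w)) w = - d_z \<phi> (z - w)" "d_zbar (\<lambda>w. \<phi> (z - w)) w = - d_zbar \<phi> (z - w)"
proof -
  have "\<phi> differentiable at (z + (-1) *\<^sub>R w)" using smooth_differentiable[OF assms] by (auto simp: differentiable_def)
  from frechet_affine[OF this]
  have "frechet_derivative (\<lambda>w. \<phi> (z - w)) (at w) d = - frechet_derivative \<phi> (at (z - w)) d" for d by simp
  then show "d_z (\<lambda>w. \<phi> (z - w)) w = - d_z \<phi> (z - w)" "d_zbar (\<lambda>w. \<phi> (z - w)) w = - d_zbar \<phi> (z - w)"
    by (simp_all add: d_z_def d_zbar_def field_simps)
qed

text \<open>The derivative falls on the kernel, and a translated and reflected kernel is a test function, so it moves on to \<open>u\<close>; the two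
sign changes, from the reflection and from the weak derivative, cancel.\<close>

lemma d_z_conv:
  assumes w: "weak_derivs u s t"
  shows "d_z (conv u (moll n)) z = conv s (moll n) z" "d_zbar (conv u (moll n)) z = conv t (moll n) z"
proof -
  have u: "loc_int u" by (intro loc_L2_imp_loc_int loc_L2_continuous weak_derivsD(1)[OF w])
  have T: "(\<lambda>w. moll n (z - w)) \<in> test_functions UNIV" by (rule moll_reflect_test) simp
  have HD: "(conv u (moll n) has_derivative (\<lambda>d. Re d *\<^sub>R conv u (d_x (moll n)) z + Im d *\<^sub>R conv u (d_y (moll n)) z)) (at z)"
    by (rule has_derivative_conv[OF u moll_smooth moll_outside])
  from frechet_derivative_at[OF HD, symmetric]
  have D: "d_x (conv u (moll n)) z = conv u (d_x (moll n)) z" "d_y (conv u (moll n)) z = conv u (d_y (moll n)) z"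
    by simp_all
  have out: "frechet_derivative (moll n) (at z) = (\<lambda>_. 0)" if "1 / real (Suc n) < cmod z" for z
    by (rule frechet_zero_outside[of "cball 0 (1 / real (Suc n))"]) (use moll_outside that in auto)
  have I: "integrable lborel (\<lambda>w. u w * d_x (moll n) (z - w))" "integrable lborel (\<lambda>w. u w * d_y (moll n) (z - w))"
    by (rule integrable_conv[OF u, where r = "1 / real (Suc n)"];
        use smooth_continuous smooth_d[OF moll_smooth] out in simp)+
  have "d_z (conv u (moll n)) z = (LINT w|lborel. u w * d_z (moll n) (z - w))"
  proof -
    have "(LINT w|lborel. u w * d_z (moll n) (z - w)) = (LINT w|lborel. (u w * d_x (moll n) (z - w) - \<i> * (u w * d_y (moll n) (z - w))) / 2)"
      by (rule Bochner_Integration.integral_cong) (simp_all add: d_z_def algebra_simps)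
    also have "\<dots> = (conv u (d_x (moll n)) z - \<i> * conv u (d_y (moll n)) z) / 2"
      unfolding conv_def using I by simp
    finally show ?thesis by (simp only: d_z_def D)
  qed
  also have "\<dots> = - (LINT w|lborel. u w * d_z (\<lambda>w. moll n (z - w)) w)"
    by (simp add: d_z_reflect[OF moll_smooth])
  also have "\<dots> = conv s (moll n) z" using weak_derivsD(4)[OF w T] by (simp add: conv_def)
  finally show "d_z (conv u (moll n)) z = conv s (moll n) z" .
  have "d_zbar (conv u (moll n)) z = (LINT w|lborel. u w * d_zbar (moll n) (z - w))"
  proof -
    have "(LINT w|lborel. u w * d_zbar (moll n) (z - w)) = (LINT w|lborel. (u w * d_x (moll n) (z - w) + \<i> * (u w * d_y (moll n) (z - w))) / 2)"
      by (rule Bochner_Integration.integral_cong) (simp_all add: d_zbar_def algebra_simps)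
    also have "\<dots> = (conv u (d_x (moll n)) z + \<i> * conv u (d_y (moll n)) z) / 2"
      unfolding conv_def using I by simp
    finally show ?thesis by (simp only: d_zbar_def D)
  qed
  also have "\<dots> = - (LINT w|lborel. u w * d_zbar (\<lambda>w. moll n (z - w)) w)"
    by (simp add: d_z_reflect[OF moll_smooth])
  also have "\<dots> = conv t (moll n) z" using weak_derivsD(5)[OF w T] by (simp add: conv_def)
  finally show "d_zbar (conv u (moll n)) z = conv t (moll n) z" .
qed

lemma loc_L2_conv: "loc_L2 v \<Longrightarrow> loc_L2 (conv v (moll n))"
  by (rule loc_L2_continuous[OF smooth_continuous[OF smooth_conv[OF loc_L2_imp_loc_int moll_smooth moll_outside]]])

lemma integrable_test_L2:
  assumes a: "loc_L2 a" and v: "loc_L2 v" and \<psi>: "\<psi> \<in> test_functions UNIV"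
  shows "integrable lborel (\<lambda>z. a z * \<psi> z * v z)"
proof -
  obtain R where R: "\<And>z. R < cmod z \<Longrightarrow> \<psi> z = 0" using \<psi> by (auto simp: test_functions_UNIV_iff)
  have [measurable]: "a \<in> borel_measurable borel" "v \<in> borel_measurable borel" using a v by (auto simp: loc_L2_def)
  have c: "continuous_on UNIV \<psi>" using test_function_continuous[OF \<psi>] .
  then have [measurable]: "\<psi> \<in> borel_measurable borel" by (rule borel_measurable_continuous_onI)
  obtain B where B: "\<And>z. cmod (\<psi> z) \<le> B" using bounded_compact_support[OF c R] by blast
  have "loc_L2 (\<lambda>z. \<psi> z * v z)" by (rule loc_L2_bounded_mult[OF v _ B]) simp
  then have i: "integrable lborel (\<lambda>z. indicator (cball 0 R) z * (cmod (\<psi> z * v z))\<^sup>2)"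
    "integrable lborel (\<lambda>z. indicator (cball 0 R) z * (cmod (a z))\<^sup>2)" using a by (auto simp: loc_L2_def)
  have "integrable lborel (\<lambda>z. (indicator (cball 0 R) z * cmod (a z)) * (indicator (cball 0 R) z * cmod (\<psi> z * v z)))"
  proof (rule integrable_mult_L2(1))
    have e: "(indicator (cball 0 R) z * x)\<^sup>2 = indicator (cball 0 R) z * (x::real)\<^sup>2" for z :: complex and x
      by (simp add: indicator_def)
    show "integrable lborel (\<lambda>z. (indicator (cball 0 R) z * cmod (a z))\<^sup>2)"
      "integrable lborel (\<lambda>z. (indicator (cball 0 R) z * cmod (\<psi> z * v z))\<^sup>2)"
      using i unfolding e by auto
  qed measurable
  then show ?thesis
  proof (rule Bochner_Integration.integrable_bound)
    show "AE z in lborel. norm (a z * \<psi> z * v z) \<le> norm ((indicator (cball 0 R) z * cmod (a z)) * (indicator (cball 0 R) z * cmod (\<psi> z * v z)))"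
    proof (rule AE_I2)
      fix z
      show "norm (a z * \<psi> z * v z) \<le> norm ((indicator (cball 0 R) z * cmod (a z)) * (indicator (cball 0 R) z * cmod (\<psi> z * v z)))"
        using R[of z] by (cases "cmod z \<le> R") (auto simp: norm_mult indicator_def)
    qed
  qed measurable
qed

lemma conv_test_tendsto:
  assumes a: "loc_L2 a" and v: "loc_L2 v" and \<psi>: "\<psi> \<in> test_functions UNIV"
  shows "(\<lambda>n. LINT z|lborel. a z * \<psi> z * conv v (moll n) z) \<longlonglongrightarrow> (LINT z|lborel. a z * \<psi> z * v z)"
proof -
  obtain R where R: "\<And>z. R < cmod z \<Longrightarrow> \<psi> z = 0" using \<psi> by (auto simp: test_functions_UNIV_iff)
  have [measurable]: "a \<in> borel_measurable borel" "v \<in> borel_measurable borel" using a v by (auto simp: loc_L2_def)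
  have [measurable]: "conv v (moll n) \<in> borel_measurable borel" for n
    using loc_L2_conv[OF v] by (simp add: loc_L2_def)
  have c: "continuous_on UNIV \<psi>" using test_function_continuous[OF \<psi>] .
  then have [measurable]: "\<psi> \<in> borel_measurable borel" by (rule borel_measurable_continuous_onI)
  obtain B where B: "\<And>z. cmod (\<psi> z) \<le> B" using bounded_compact_support[OF c R] by blast
  have L: "loc_L2 (\<lambda>z. \<psi> z * a z)" by (rule loc_L2_bounded_mult[OF a _ B]) simp
  define Q where "Q = (LINT z|lborel. indicator (cball 0 R) z * (cmod (\<psi> z * a z))\<^sup>2)"
  define e where "e n = (LINT z|lborel. indicator (cball 0 R) z * (cmod (conv v (moll n) z - v z))\<^sup>2)" for n
  have "(\<lambda>n. (LINT z|lborel. a z * \<psi> z * conv v (moll n) z) - (LINT z|lborel. a z * \<psi> z * v z)) \<longlonglongrightarrow> 0"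
  proof (rule Lim_null_comparison)
    have "e \<longlonglongrightarrow> 0" unfolding e_def[abs_def] by (rule conv_moll_tendsto_L2[OF v])
    then show "(\<lambda>n. sqrt Q * sqrt (e n)) \<longlonglongrightarrow> 0" by (auto intro!: tendsto_eq_intros)
    show "\<forall>\<^sub>F n in sequentially. norm ((LINT z|lborel. a z * \<psi> z * conv v (moll n) z) - (LINT z|lborel. a z * \<psi> z * v z)) \<le> sqrt Q * sqrt (e n)"
    proof (intro always_eventually allI)
      fix n
      let ?f = "\<lambda>z. indicator (cball 0 R) z * cmod (\<psi> z * a z)" and ?g = "\<lambda>z. indicator (cball 0 R) z * cmod (conv v (moll n) z - v z)"
      have e: "(indicator (cball 0 R) z * x)\<^sup>2 = indicator (cball 0 R) z * (x::real)\<^sup>2" for z :: complex and x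
        by (simp add: indicator_def)
      have f2: "integrable lborel (\<lambda>z. (?f z)\<^sup>2)" using L unfolding e by (simp add: loc_L2_def)
      have g2: "integrable lborel (\<lambda>z. (?g z)\<^sup>2)"
        using loc_L2_diff[OF loc_L2_conv[OF v] v] unfolding e by (simp add: loc_L2_def)
      have CS: "integrable lborel (\<lambda>z. ?f z * ?g z)" "(LINT z|lborel. \<bar>?f z * ?g z\<bar>) \<le> sqrt Q * sqrt (e n)"
        using integrable_mult_L2[OF _ _ f2 g2] unfolding e Q_def e_def by auto
      have "(LINT z|lborel. a z * \<psi> z * conv v (moll n) z) - (LINT z|lborel. a z * \<psi> z * v z)
         = (LINT z|lborel. a z * \<psi> z * conv v (moll n) z - a z * \<psi> z * v z)"
        by (simp add: integrable_test_L2[OF a _ \<psi>] loc_L2_conv v)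
      then have "norm ((LINT z|lborel. a z * \<psi> z * conv v (moll n) z) - (LINT z|lborel. a z * \<psi> z * v z))
         = norm (LINT z|lborel. a z * \<psi> z * conv v (moll n) z - a z * \<psi> z * v z)" by simp
      also have "\<dots> \<le> (LINT z|lborel. \<bar>?f z * ?g z\<bar>)"
      proof (rule Bochner_Integration.integral_norm_bound_integral)
        show "integrable lborel (\<lambda>z. a z * \<psi> z * conv v (moll n) z - a z * \<psi> z * v z)"
          by (intro Bochner_Integration.integrable_diff integrable_test_L2[OF a _ \<psi>] loc_L2_conv v)
        show "integrable lborel (\<lambda>z. \<bar>?f z * ?g z\<bar>)" using CS(1) by (rule integrable_abs)
        fix z
        show "norm (a z * \<psi> z * conv v (moll n) z - a z * \<psi> z * v z) \<le> \<bar>?f z * ?g z\<bar>"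
          using R[of z] by (cases "cmod z \<le> R") (auto simp: norm_mult indicator_def abs_mult simp flip: right_diff_distrib)
      qed
      also note CS(2)
      finally show "norm ((LINT z|lborel. a z * \<psi> z * conv v (moll n) z) - (LINT z|lborel. a z * \<psi> z * v z)) \<le> sqrt Q * sqrt (e n)" .
    qed
  qed
  then show ?thesis by (rule LIM_zero_cancel)
qed

text \<open>If \<open>u\<close> were smooth, this would be \<open>weak_derivs_mixed\<close> for the test function \<open>u * \<eta>\<close>.  For general \<open>u\<close> its mollifications are inserted, and the limit
is taken in the mean.\<close>

theorem local_pairing:
  assumes g: "weak_derivs g h w" and u: "weak_derivs u s t" and \<eta>: "\<eta> \<in> test_functions UNIV"
  shows "(LINT z|lborel. h z * \<eta> z * t z) + (LINT z|lborel. h z * d_zbar \<eta> z * u z) =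
    (LINT z|lborel. w z * \<eta> z * s z) + (LINT z|lborel. w z * d_z \<eta> z * u z)"
proof -
  note G = weak_derivsD[OF g] and U = weak_derivsD[OF u]
  have uL: "loc_L2 u" by (rule loc_L2_continuous[OF U(1)])
  note \<eta>' = test_functions_d_z[OF \<eta>]
  have e: "(LINT z|lborel. h z * \<eta> z * conv t (moll n) z) + (LINT z|lborel. h z * d_zbar \<eta> z * conv u (moll n) z) =
    (LINT z|lborel. w z * \<eta> z * conv s (moll n) z) + (LINT z|lborel. w z * d_z \<eta> z * conv u (moll n) z)" for n
  proof -
    have sm: "smooth (conv u (moll n))" by (rule smooth_conv[OF loc_L2_imp_loc_int[OF uL] moll_smooth moll_outside])
    have T: "(\<lambda>z. conv u (moll n) z * \<eta> z) \<in> test_functions UNIV" by (rule test_functions_mult[OF \<eta> sm])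
    have d: "d_zbar (\<lambda>z. conv u (moll n) z * \<eta> z) z = conv t (moll n) z * \<eta> z + conv u (moll n) z * d_zbar \<eta> z"
      "d_z (\<lambda>z. conv u (moll n) z * \<eta> z) z = conv s (moll n) z * \<eta> z + conv u (moll n) z * d_z \<eta> z" for z
      using d_z_mult[OF sm test_functionsD(1)[OF \<eta>], of z] d_z_conv[OF u] by simp_all
    have "(LINT z|lborel. h z * \<eta> z * conv t (moll n) z + h z * d_zbar \<eta> z * conv u (moll n) z) =
      (LINT z|lborel. w z * \<eta> z * conv s (moll n) z + w z * d_z \<eta> z * conv u (moll n) z)"
      using weak_derivs_mixed[OF g T] unfolding d by (simp add: algebra_simps)
    then show ?thesis
      by (simp add: integrable_test_L2 G U uL \<eta> \<eta>' loc_L2_conv)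
  qed
  have "(\<lambda>n. (LINT z|lborel. h z * \<eta> z * conv t (moll n) z) + (LINT z|lborel. h z * d_zbar \<eta> z * conv u (moll n) z))
     \<longlonglongrightarrow> (LINT z|lborel. h z * \<eta> z * t z) + (LINT z|lborel. h z * d_zbar \<eta> z * u z)"
    by (intro tendsto_add conv_test_tendsto G U uL \<eta> \<eta>')
  moreover have "(\<lambda>n. (LINT z|lborel. w z * \<eta> z * conv s (moll n) z) + (LINT z|lborel. w z * d_z \<eta> z * conv u (moll n) z))
     \<longlonglongrightarrow> (LINT z|lborel. w z * \<eta> z * s z) + (LINT z|lborel. w z * d_z \<eta> z * u z)"
    by (intro tendsto_add conv_test_tendsto G U uL \<eta> \<eta>')
  ultimately show ?thesis unfolding e using LIMSEQ_unique by blast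
qed

section \<open>Finiteness of the energy\<close>

text \<open>In the plane the Dirichlet integral is invariant under scaling, so dilating one cutoff function by the factors \<open>n + 1\<close> gives cutoffs at larger and larger radii
whose energy stays bounded.\<close>

lemma cutoff_sequence:
  obtains \<eta> :: "nat \<Rightarrow> complex \<Rightarrow> real" and C where
    "\<And>n. (\<lambda>z. complex_of_real (\<eta> n z)) \<in> test_functions UNIV"
    "\<And>n z. 0 \<le> \<eta> n z" "\<And>n z. \<eta> n z \<le> 1" "\<And>n z. cmod z \<le> real (Suc n) \<Longrightarrow> \<eta> n z = 1"
    "\<And>n z. cmod z < real (Suc n) \<Longrightarrow> d_z (\<lambda>z. of_real (\<eta> n z)) z = 0 \<and> d_zbar (\<lambda>z. of_real (\<eta> n z)) z = 0"
    "\<And>n. integrable lborel (\<lambda>z. (cmod (d_z (\<lambda>z. of_real (\<eta> n z)) z))\<^sup>2)"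
    "\<And>n. integrable lborel (\<lambda>z. (cmod (d_zbar (\<lambda>z. of_real (\<eta> n z)) z))\<^sup>2)"
    "\<And>n. (LINT z|lborel. (cmod (d_z (\<lambda>z. of_real (\<eta> n z)) z))\<^sup>2) \<le> C"
    "\<And>n. (LINT z|lborel. (cmod (d_zbar (\<lambda>z. of_real (\<eta> n z)) z))\<^sup>2) \<le> C"
proof -
  have "(0::real) < 1" "(1::real) < 2" by auto
  from smooth_plateau[OF this, of 0]
  obtain \<eta> :: "complex \<Rightarrow> real" where \<eta>: "smooth (\<lambda>z. complex_of_real (\<eta> z))" "\<And>z. 0 \<le> \<eta> z" "\<And>z. \<eta> z \<le> 1"
    "\<And>z. cmod z \<le> 1 \<Longrightarrow> \<eta> z = 1" "\<And>z. 2 \<le> cmod z \<Longrightarrow> \<eta> z = 0" by auto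
  define e where "e n z = \<eta> ((1 / real (Suc n)) *\<^sub>R z)" for n z
  let ?E = "\<lambda>n z. complex_of_real (e n z)"
  have en: "?E n = (\<lambda>z. complex_of_real (\<eta> ((1 / real (Suc n)) *\<^sub>R z)))" for n
    unfolding e_def ..
  have sm: "smooth (?E n)" for n
    unfolding en by (rule smooth_scale[OF \<eta>(1)])
  have nrm: "cmod ((1 / real (Suc n)) *\<^sub>R z) = cmod z / real (Suc n)" for n z by simp
  have out: "e n z = 0" if "2 * real (Suc n) < cmod z" for n z
    unfolding e_def by (rule \<eta>(5)) (use that in \<open>simp add: nrm field_simps del: of_nat_Suc norm_scaleR\<close>)
  have T: "?E n \<in> test_functions UNIV" for n
    unfolding test_functions_UNIV_iff using sm out by (metis of_real_0)
  let ?h = "\<lambda>z. complex_of_real (\<eta> z)"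
  have hT: "?h \<in> test_functions UNIV"
    unfolding test_functions_UNIV_iff using \<eta>(1,5) by (auto intro!: exI[of _ 2])
  have dE: "frechet_derivative (?E n) (at z) d = (1 / real (Suc n)) *\<^sub>R frechet_derivative ?h (at ((1 / real (Suc n)) *\<^sub>R z)) d" for n z d
  proof -
    have "?h differentiable (at (0 + (1 / real (Suc n)) *\<^sub>R z))"
      using smooth_differentiable[OF \<eta>(1)] by (auto simp: differentiable_def)
    from frechet_affine[OF this, of d] show ?thesis unfolding en by simp
  qed
  have dz: "d_z (?E n) z = (1 / real (Suc n)) *\<^sub>R d_z ?h ((1 / real (Suc n)) *\<^sub>R z)"
    "d_zbar (?E n) z = (1 / real (Suc n)) *\<^sub>R d_zbar ?h ((1 / real (Suc n)) *\<^sub>R z)" for n z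
  proof -
    have "(c *\<^sub>R A - \<i> * (c *\<^sub>R B)) / 2 = c *\<^sub>R ((A - \<i> * B) / 2)"
      "(c *\<^sub>R A + \<i> * (c *\<^sub>R B)) / 2 = c *\<^sub>R ((A + \<i> * B) / 2)" for c :: real and A B :: complex
      by (simp_all add: scaleR_conv_of_real diff_divide_distrib add_divide_distrib algebra_simps)
    then show "d_z (?E n) z = (1 / real (Suc n)) *\<^sub>R d_z ?h ((1 / real (Suc n)) *\<^sub>R z)"
      "d_zbar (?E n) z = (1 / real (Suc n)) *\<^sub>R d_zbar ?h ((1 / real (Suc n)) *\<^sub>R z)"
      unfolding d_z_def d_zbar_def dE by (simp_all only:)
  qed
  have bd: "\<exists>B. \<forall>z. cmod (\<psi> z) \<le> B" if \<psi>: "\<psi> \<in> test_functions UNIV" for \<psi>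
  proof -
    obtain R where R: "\<And>z. R < cmod z \<Longrightarrow> \<psi> z = 0" using \<psi> by (auto simp: test_functions_UNIV_iff)
    show ?thesis using bounded_compact_support[OF test_function_continuous[OF \<psi>] R] by metis
  qed
  obtain B1 B2 where B: "\<And>z. cmod (d_z ?h z) \<le> B1" "\<And>z. cmod (d_zbar ?h z) \<le> B2"
    using bd[OF test_functions_d_z(1)[OF hT]] bd[OF test_functions_d_z(2)[OF hT]] by blast
  define B where "B = max B1 B2"
  have B': "cmod (d_z ?h z) \<le> B" "cmod (d_zbar ?h z) \<le> B" for z
    using B[of z] by (auto simp: B_def)
  have B0: "B \<ge> 0" using order_trans[OF norm_ge_zero B'(1)] .
  have zero: "d_z (?E n) z = 0 \<and> d_zbar (?E n) z = 0" if "2 * real (Suc n) < cmod z" for n z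
    using d_z_outside[of "cball 0 (2 * real (Suc n))" "?E n" z] out that by auto
  have key: "integrable lborel (\<lambda>z. (cmod (D z))\<^sup>2) \<and> (LINT z|lborel. (cmod (D z))\<^sup>2) \<le> 4 * pi * B\<^sup>2"
    if D: "smooth D" "\<And>z. cmod (D z) \<le> B / real (Suc n)" "\<And>z. 2 * real (Suc n) < cmod z \<Longrightarrow> D z = 0" for D n
  proof -
    let ?r = "2 * real (Suc n)"
    have [measurable]: "D \<in> borel_measurable borel"
      by (intro borel_measurable_continuous_onI smooth_continuous D(1))
    have I: "integrable lborel (\<lambda>z. (B / real (Suc n))\<^sup>2 * indicator (cball (0::complex) ?r) z)"
      by (intro integrable_mult_right integrable_indicator_cball)
    have pw: "(cmod (D z))\<^sup>2 \<le> (B / real (Suc n))\<^sup>2 * indicator (cball 0 ?r) z" for z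
      using D(3)[of z] power_mono[OF D(2)[of z], of 2] by (cases "cmod z \<le> ?r") (auto simp del: of_nat_Suc)
    have 1: "integrable lborel (\<lambda>z. (cmod (D z))\<^sup>2)"
      by (rule Bochner_Integration.integrable_bound[OF I]) (use pw in \<open>auto intro: order_trans[OF _ abs_ge_self]\<close>)
    have "(LINT z|lborel. (cmod (D z))\<^sup>2) \<le> (LINT z|lborel. (B / real (Suc n))\<^sup>2 * indicator (cball (0::complex) ?r) z)"
      by (rule integral_mono[OF 1 I pw])
    also have "\<dots> = (B / real (Suc n))\<^sup>2 * measure lborel (cball (0::complex) ?r)" by simp
    also have "measure lborel (cball (0::complex) ?r) = pi * ?r\<^sup>2"
      using content_cball[of ?r "0::complex"] by (simp add: unit_ball_vol_2 del: of_nat_Suc)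
    also have "(B / real (Suc n))\<^sup>2 * (pi * ?r\<^sup>2) = 4 * pi * B\<^sup>2"
      by (simp add: power_divide power_mult_distrib del: of_nat_Suc)
    finally show ?thesis using 1 by simp
  qed
  have k1: "integrable lborel (\<lambda>z. (cmod (d_z (?E n) z))\<^sup>2) \<and> (LINT z|lborel. (cmod (d_z (?E n) z))\<^sup>2) \<le> 4 * pi * B\<^sup>2" for n
  proof (rule key)
    show "cmod (d_z (?E n) z) \<le> B / real (Suc n)" for z
      unfolding dz norm_scaleR using B'(1) by (simp add: field_simps mult_right_mono del: of_nat_Suc)
  qed (use zero smooth_d_z[OF sm] in auto)
  have k2: "integrable lborel (\<lambda>z. (cmod (d_zbar (?E n) z))\<^sup>2) \<and> (LINT z|lborel. (cmod (d_zbar (?E n) z))\<^sup>2) \<le> 4 * pi * B\<^sup>2" for n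
  proof (rule key)
    show "cmod (d_zbar (?E n) z) \<le> B / real (Suc n)" for z
      unfolding dz norm_scaleR using B'(2) by (simp add: field_simps mult_right_mono del: of_nat_Suc)
  qed (use zero smooth_d_zbar[OF sm] in auto)
  have one: "e n z = 1" if "cmod z \<le> real (Suc n)" for n z
    unfolding e_def by (rule \<eta>(4)) (use that in \<open>simp add: nrm field_simps del: of_nat_Suc norm_scaleR\<close>)
  have flat: "d_z (?E n) z = 0 \<and> d_zbar (?E n) z = 0" if "cmod z < real (Suc n)" for n z
  proof -
    have "((\<lambda>_. 1) has_derivative (\<lambda>_. 0)) (at z)" by simp
    then have "(?E n has_derivative (\<lambda>_. 0)) (at z)"
      by (rule has_derivative_transform_within_open[where s = "ball 0 (real (Suc n))"])
        (use that one[of _ n] in \<open>auto simp: less_imp_le simp del: of_nat_Suc\<close>)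
    from frechet_derivative_at[OF this, symmetric] show ?thesis by (simp add: d_z_def d_zbar_def)
  qed
  show ?thesis
    by (rule that[of e "4 * pi * B\<^sup>2"]) (use T k1 k2 one flat \<eta>(2,3) in \<open>auto simp: e_def[of _ _] simp del: of_nat_Suc\<close>)
qed

lemma L2_from_exhaustion:
  fixes h :: "complex \<Rightarrow> complex"
  assumes [measurable]: "h \<in> borel_measurable borel"
    and b: "\<And>n. integrable lborel (\<lambda>z. indicator (cball 0 (real (Suc n))) z * (cmod (h z))\<^sup>2)"
      "\<And>n. (LINT z|lborel. indicator (cball 0 (real (Suc n))) z * (cmod (h z))\<^sup>2) \<le> C"
  shows "integrable lborel (\<lambda>z. (cmod (h z))\<^sup>2)"
proof -
  let ?f = "\<lambda>n (z::complex). ennreal (indicator (cball 0 (real (Suc n))) z * (cmod (h z))\<^sup>2)"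
  have lim: "(\<lambda>n. \<integral>\<^sup>+z. ?f n z \<partial>lborel) \<longlonglongrightarrow> (\<integral>\<^sup>+z. ennreal ((cmod (h z))\<^sup>2) \<partial>lborel)"
  proof (rule nn_integral_LIMSEQ)
    show "incseq ?f"
      by (intro incseq_SucI le_funI ennreal_leI mult_right_mono) (auto simp: indicator_def)
    fix z
    obtain N where N: "cmod z \<le> real N" using real_arch_simple by blast
    show "(\<lambda>n. ?f n z) \<longlonglongrightarrow> ennreal ((cmod (h z))\<^sup>2)"
      by (rule tendsto_eventually, rule eventually_sequentiallyI[of N])
        (use N in \<open>auto simp: indicator_def\<close>)
  qed measurable
  have le: "(\<integral>\<^sup>+z. ?f n z \<partial>lborel) \<le> ennreal C" for n
    by (subst nn_integral_eq_integral[OF b(1)]) (use b(2) in \<open>auto intro: ennreal_leI\<close>)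
  have "(\<integral>\<^sup>+z. ennreal ((cmod (h z))\<^sup>2) \<partial>lborel) \<le> ennreal C"
    by (rule LIMSEQ_le_const2[OF lim]) (use le in blast)
  then show ?thesis
    by (intro integrableI_bounded) (auto intro: le_less_trans)
qed

text \<open>A Caccioppoli estimate.  In \<open>local_pairing\<close> for \<open>g\<close> and \<open>cnj g\<close> with the squared cutoff, the terms with a derivative of the cutoff are absorbed up to a
small multiple of the energy, while the domination of \<open>w\<close> by \<open>h\<close> with a constant below \<open>1\<close> absorbs the energy of \<open>w\<close>.  The bound that
remains is independent of the radius of the cutoff, because \<open>g\<close> is bounded and the cutoffs have bounded energy.\<close>

theorem energy_finite:
  assumes g: "weak_derivs g h w" and M: "\<And>z. cmod (g z) \<le> M"
    and k: "0 \<le> k" "k < 1" and b: "integrable lborel b" "\<And>z. 0 \<le> b z"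
    and dom: "AE z in lborel. (cmod (w z))\<^sup>2 \<le> k * (cmod (h z))\<^sup>2 + b z"
  shows "integrable lborel (\<lambda>z. (cmod (h z))\<^sup>2)" "integrable lborel (\<lambda>z. (cmod (w z))\<^sup>2)"
proof -
  note G = weak_derivsD[OF g]
  have [measurable]: "h \<in> borel_measurable borel" "w \<in> borel_measurable borel" using G by (auto simp: loc_L2_def)
  obtain \<eta> C where \<eta>: "\<And>n. (\<lambda>z. complex_of_real (\<eta> n z)) \<in> test_functions UNIV"
    "\<And>n z. 0 \<le> \<eta> n z" "\<And>n z. \<eta> n z \<le> 1" "\<And>n z. cmod z \<le> real (Suc n) \<Longrightarrow> \<eta> n z = 1"
    "\<And>n z. cmod z < real (Suc n) \<Longrightarrow> d_z (\<lambda>z. of_real (\<eta> n z)) z = 0 \<and> d_zbar (\<lambda>z. of_real (\<eta> n z)) z = 0"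
    and \<eta>I: "\<And>n. integrable lborel (\<lambda>z. (cmod (d_z (\<lambda>z. of_real (\<eta> n z)) z))\<^sup>2)"
    "\<And>n. integrable lborel (\<lambda>z. (cmod (d_zbar (\<lambda>z. of_real (\<eta> n z)) z))\<^sup>2)"
    "\<And>n. (LINT z|lborel. (cmod (d_z (\<lambda>z. of_real (\<eta> n z)) z))\<^sup>2) \<le> C"
    "\<And>n. (LINT z|lborel. (cmod (d_zbar (\<lambda>z. of_real (\<eta> n z)) z))\<^sup>2) \<le> C"
    by (rule cutoff_sequence) blast
  \<comment> \<open>Small enough that absorbing \<open>\<delta>\<close> times the energies of \<open>h\<close> and \<open>w\<close> leaves the factor \<open>1 - \<delta> - (1 + \<delta>) * k \<ge> (1 - k) / 2\<close>.\<close>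
  define \<delta> where "\<delta> = (1 - k) / 4"
  have \<delta>: "\<delta> > 0" using k by (simp add: \<delta>_def)
  define b0 where "b0 = (LINT z|lborel. b z)"
  have b0: "b0 \<ge> 0" unfolding b0_def using b by (intro integral_nonneg_AE) auto
  define X where "X = 2 * ((1 + \<delta>) * b0 + M\<^sup>2 / \<delta> * (2 * C)) / (1 - k)"
  have main: "(LINT z|lborel. (\<eta> n z)\<^sup>2 * (cmod (h z))\<^sup>2) \<le> X \<and> integrable lborel (\<lambda>z. (\<eta> n z)\<^sup>2 * (cmod (h z))\<^sup>2)" for n
  proof -
    let ?e = "\<lambda>z. complex_of_real (\<eta> n z)"
    let ?e2 = "\<lambda>z. ?e z * ?e z"
    note sm = test_functionsD(1)[OF \<eta>(1)[of n]]
    have T2: "?e2 \<in> test_functions UNIV" by (rule test_functions_mult[OF \<eta>(1) sm])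
    have dz: "d_z ?e2 z = 2 * (?e z * d_z ?e z)" "d_zbar ?e2 z = 2 * (?e z * d_zbar ?e z)" for z
      using d_z_mult[OF sm sm, of z] by (simp_all add: algebra_simps)
    have gcL: "loc_L2 (\<lambda>z. cnj (g z))" by (intro loc_L2_cnj loc_L2_continuous G(1))
    have e1: "h z * ?e2 z * cnj (h z) = of_real ((\<eta> n z)\<^sup>2 * (cmod (h z))\<^sup>2)"
      "w z * ?e2 z * cnj (w z) = of_real ((\<eta> n z)\<^sup>2 * (cmod (w z))\<^sup>2)" for z
      using complex_norm_square[of "h z"] complex_norm_square[of "w z"] by (simp_all add: power2_eq_square algebra_simps)
    have Ih: "integrable lborel (\<lambda>z. (\<eta> n z)\<^sup>2 * (cmod (h z))\<^sup>2)"
      using integrable_test_L2[OF G(2) loc_L2_cnj[OF G(2)] T2] unfolding e1 complex_of_real_integrable_eq .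
    have Iw: "integrable lborel (\<lambda>z. (\<eta> n z)\<^sup>2 * (cmod (w z))\<^sup>2)"
      using integrable_test_L2[OF G(3) loc_L2_cnj[OF G(3)] T2] unfolding e1 complex_of_real_integrable_eq .
    define N W where "N = (LINT z|lborel. (\<eta> n z)\<^sup>2 * (cmod (h z))\<^sup>2)" and "W = (LINT z|lborel. (\<eta> n z)\<^sup>2 * (cmod (w z))\<^sup>2)"
    have N0: "N \<ge> 0" unfolding N_def by (intro integral_nonneg_AE) auto
    have I1: "integrable lborel (\<lambda>z. w z * d_z ?e2 z * cnj (g z))" "integrable lborel (\<lambda>z. h z * d_zbar ?e2 z * cnj (g z))"
      by (intro integrable_test_L2 G gcL test_functions_d_z T2)+
    have "of_real N + (LINT z|lborel. h z * d_zbar ?e2 z * cnj (g z)) = of_real W + (LINT z|lborel. w z * d_z ?e2 z * cnj (g z))"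
      using local_pairing[OF g weak_derivs_cnj[OF g] T2] unfolding e1 N_def W_def integral_complex_of_real .
    then have "complex_of_real (N - W) = (LINT z|lborel. w z * d_z ?e2 z * cnj (g z) - h z * d_zbar ?e2 z * cnj (g z))"
      using I1 by (simp add: algebra_simps)
    then have "norm (complex_of_real (N - W)) = norm (LINT z|lborel. w z * d_z ?e2 z * cnj (g z) - h z * d_zbar ?e2 z * cnj (g z))" by simp
    also have "\<dots> \<le> (LINT z|lborel. \<delta> * ((\<eta> n z)\<^sup>2 * (cmod (h z))\<^sup>2 + (\<eta> n z)\<^sup>2 * (cmod (w z))\<^sup>2)
        + M\<^sup>2 / \<delta> * ((cmod (d_z ?e z))\<^sup>2 + (cmod (d_zbar ?e z))\<^sup>2))"
    proof (rule Bochner_Integration.integral_norm_bound_integral)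
      fix z
      have am: "2 * x * y * M \<le> \<delta> * x\<^sup>2 + M\<^sup>2 / \<delta> * y\<^sup>2" for x y :: real
      proof -
        have "0 \<le> (\<delta> * x - M * y)\<^sup>2 / \<delta>" using \<delta> by simp
        also have "\<dots> = \<delta> * x\<^sup>2 + M\<^sup>2 / \<delta> * y\<^sup>2 - 2 * x * y * M"
          using \<delta> by (simp add: power2_eq_square field_simps)
        finally show ?thesis by simp
      qed
      have s: "cmod (a * (2 * (?e z * d)) * cnj (g z)) \<le> \<delta> * ((\<eta> n z)\<^sup>2 * (cmod a)\<^sup>2) + M\<^sup>2 / \<delta> * (cmod d)\<^sup>2" for a d
      proof -
        have "cmod (a * (2 * (?e z * d)) * cnj (g z)) = (2 * (\<eta> n z * cmod a) * cmod d) * cmod (g z)"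
          using \<eta>(2)[of n z] by (simp add: norm_mult)
        also have "\<dots> \<le> (2 * (\<eta> n z * cmod a) * cmod d) * M"
          using \<eta>(2)[of n z] M[of z] by (intro mult_left_mono) auto
        also have "\<dots> \<le> \<delta> * (\<eta> n z * cmod a)\<^sup>2 + M\<^sup>2 / \<delta> * (cmod d)\<^sup>2" by (rule am)
        finally show ?thesis by (simp add: power_mult_distrib)
      qed
      have "norm (w z * d_z ?e2 z * cnj (g z) - h z * d_zbar ?e2 z * cnj (g z))
         \<le> cmod (w z * d_z ?e2 z * cnj (g z)) + cmod (h z * d_zbar ?e2 z * cnj (g z))" by (rule norm_triangle_ineq4)
      also have "\<dots> \<le> (\<delta> * ((\<eta> n z)\<^sup>2 * (cmod (w z))\<^sup>2) + M\<^sup>2 / \<delta> * (cmod (d_z ?e z))\<^sup>2) + (\<delta> * ((\<eta> n z)\<^sup>2 * (cmod (h z))\<^sup>2) + M\<^sup>2 / \<delta> * (cmod (d_zbar ?e z))\<^sup>2)"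
        unfolding dz by (intro add_mono s)
      finally show "norm (w z * d_z ?e2 z * cnj (g z) - h z * d_zbar ?e2 z * cnj (g z))
         \<le> \<delta> * ((\<eta> n z)\<^sup>2 * (cmod (h z))\<^sup>2 + (\<eta> n z)\<^sup>2 * (cmod (w z))\<^sup>2) + M\<^sup>2 / \<delta> * ((cmod (d_z ?e z))\<^sup>2 + (cmod (d_zbar ?e z))\<^sup>2)"
        by (simp add: algebra_simps)
    qed (intro Bochner_Integration.integrable_diff Bochner_Integration.integrable_add integrable_mult_right I1 Ih Iw \<eta>I)+
    also have "\<dots> = \<delta> * (N + W) + M\<^sup>2 / \<delta> * ((LINT z|lborel. (cmod (d_z ?e z))\<^sup>2) + (LINT z|lborel. (cmod (d_zbar ?e z))\<^sup>2))"
      unfolding N_def W_def using Ih Iw \<eta>I[of n] by simp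
    also have "\<dots> \<le> \<delta> * (N + W) + M\<^sup>2 / \<delta> * (2 * C)"
      using \<eta>I(3,4)[of n] \<delta> by (intro add_left_mono mult_left_mono) auto
    finally have A: "N - W \<le> \<delta> * (N + W) + M\<^sup>2 / \<delta> * (2 * C)" by (simp only: norm_of_real)
    have "W \<le> (LINT z|lborel. k * ((\<eta> n z)\<^sup>2 * (cmod (h z))\<^sup>2) + b z)"
      unfolding W_def
    proof (rule integral_mono_AE[OF Iw])
      show "integrable lborel (\<lambda>z. k * ((\<eta> n z)\<^sup>2 * (cmod (h z))\<^sup>2) + b z)" using Ih b by simp
      show "AE z in lborel. (\<eta> n z)\<^sup>2 * (cmod (w z))\<^sup>2 \<le> k * ((\<eta> n z)\<^sup>2 * (cmod (h z))\<^sup>2) + b z"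
        using dom
      proof eventually_elim
        case (elim z)
        have "(\<eta> n z)\<^sup>2 * (cmod (w z))\<^sup>2 \<le> (\<eta> n z)\<^sup>2 * (k * (cmod (h z))\<^sup>2 + b z)"
          using elim by (intro mult_left_mono) auto
        also have "\<dots> \<le> k * ((\<eta> n z)\<^sup>2 * (cmod (h z))\<^sup>2) + 1 * b z"
          using mult_right_mono[OF power_le_one[OF \<eta>(2,3)], OF b(2), of n z 2 z] by (simp add: algebra_simps)
        finally show ?case by simp
      qed
    qed
    also have "\<dots> = k * N + b0" using Ih b by (simp add: N_def b0_def)
    finally have Wle: "W \<le> k * N + b0" .
    have "N * (1 - \<delta>) \<le> (1 + \<delta>) * W + M\<^sup>2 / \<delta> * (2 * C)" using A by (simp add: algebra_simps)
    also have "\<dots> \<le> (1 + \<delta>) * (k * N + b0) + M\<^sup>2 / \<delta> * (2 * C)"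
      using Wle \<delta> by (intro add_right_mono mult_left_mono) auto
    finally have "N * (1 - \<delta> - (1 + \<delta>) * k) \<le> (1 + \<delta>) * b0 + M\<^sup>2 / \<delta> * (2 * C)" by (simp add: algebra_simps)
    moreover have "N * ((1 - k) / 2) \<le> N * (1 - \<delta> - (1 + \<delta>) * k)"
    proof (rule mult_left_mono[OF _ N0])
      have dk: "\<delta> * k \<le> \<delta> * 1" using k \<delta> by (intro mult_left_mono) auto
      have "(1 - k) / 2 = 1 - k - 2 * \<delta>" by (simp add: \<delta>_def field_simps)
      also have "\<dots> \<le> 1 - k - \<delta> - \<delta> * k" using dk by simp
      also have "\<dots> = 1 - \<delta> - (1 + \<delta>) * k" by (simp add: algebra_simps)
      finally show "(1 - k) / 2 \<le> 1 - \<delta> - (1 + \<delta>) * k" .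
    qed
    ultimately have "N * ((1 - k) / 2) \<le> (1 + \<delta>) * b0 + M\<^sup>2 / \<delta> * (2 * C)" by linarith
    then have "N \<le> X" using k by (simp add: X_def field_simps)
    then show ?thesis using Ih by (simp add: N_def)
  qed
  show hI: "integrable lborel (\<lambda>z. (cmod (h z))\<^sup>2)"
  proof (rule L2_from_exhaustion)
    show "integrable lborel (\<lambda>z. indicator (cball 0 (real (Suc n))) z * (cmod (h z))\<^sup>2)" for n
      using G(2) by (simp add: loc_L2_def del: of_nat_Suc)
    show "(LINT z|lborel. indicator (cball 0 (real (Suc n))) z * (cmod (h z))\<^sup>2) \<le> X" for n
    proof (rule order_trans[OF integral_mono_AE' conjunct1[OF main[of n]]])
      show "integrable lborel (\<lambda>z. (\<eta> n z)\<^sup>2 * (cmod (h z))\<^sup>2)" using main[of n] by blast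
      show "AE z in lborel. indicator (cball 0 (real (Suc n))) z * (cmod (h z))\<^sup>2 \<le> (\<eta> n z)\<^sup>2 * (cmod (h z))\<^sup>2"
        using \<eta>(4)[of _ n] by (intro AE_I2) (auto simp: indicator_def simp del: of_nat_Suc)
    qed auto
  qed measurable
  show "integrable lborel (\<lambda>z. (cmod (w z))\<^sup>2)"
  proof (rule Bochner_Integration.integrable_bound)
    show "integrable lborel (\<lambda>z. k * (cmod (h z))\<^sup>2 + b z)" using hI b by simp
    show "AE z in lborel. norm ((cmod (w z))\<^sup>2) \<le> norm (k * (cmod (h z))\<^sup>2 + b z)"
      using dom by eventually_elim auto
  qed measurable
qed

section \<open>Pairings on the whole plane\<close>

text \<open>The terms of \<open>local_pairing\<close> with a derivative of the cutoff live outside a large disc.  By the Cauchy-Schwarz inequality they are at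
most a constant times the square root of the energy of \<open>h\<close> and \<open>w\<close> there, which tends to zero.\<close>

theorem global_pairing:
  assumes g: "weak_derivs g h w" and u: "weak_derivs u s t" and M: "\<And>z. cmod (u z) \<le> M"
    and h: "integrable lborel (\<lambda>z. (cmod (h z))\<^sup>2)" and w: "integrable lborel (\<lambda>z. (cmod (w z))\<^sup>2)"
    and s: "integrable lborel (\<lambda>z. (cmod (s z))\<^sup>2)" and t: "integrable lborel (\<lambda>z. (cmod (t z))\<^sup>2)"
  shows "(LINT z|lborel. h z * t z) = (LINT z|lborel. w z * s z)"
proof -
  note G = weak_derivsD[OF g] and U = weak_derivsD[OF u]
  have [measurable]: "h \<in> borel_measurable borel" "w \<in> borel_measurable borel"
    "s \<in> borel_measurable borel" "t \<in> borel_measurable borel" using G U by (auto simp: loc_L2_def)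
  have uL: "loc_L2 u" by (rule loc_L2_continuous[OF U(1)])
  have M0: "M \<ge> 0" using order_trans[OF norm_ge_zero M] .
  obtain \<eta> C where \<eta>: "\<And>n. (\<lambda>z. complex_of_real (\<eta> n z)) \<in> test_functions UNIV"
    "\<And>n z. 0 \<le> \<eta> n z" "\<And>n z. \<eta> n z \<le> 1" "\<And>n z. cmod z \<le> real (Suc n) \<Longrightarrow> \<eta> n z = 1"
    "\<And>n z. cmod z < real (Suc n) \<Longrightarrow> d_z (\<lambda>z. of_real (\<eta> n z)) z = 0 \<and> d_zbar (\<lambda>z. of_real (\<eta> n z)) z = 0"
    and \<eta>I: "\<And>n. integrable lborel (\<lambda>z. (cmod (d_z (\<lambda>z. of_real (\<eta> n z)) z))\<^sup>2)"
    "\<And>n. integrable lborel (\<lambda>z. (cmod (d_zbar (\<lambda>z. of_real (\<eta> n z)) z))\<^sup>2)"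
    "\<And>n. (LINT z|lborel. (cmod (d_z (\<lambda>z. of_real (\<eta> n z)) z))\<^sup>2) \<le> C"
    "\<And>n. (LINT z|lborel. (cmod (d_zbar (\<lambda>z. of_real (\<eta> n z)) z))\<^sup>2) \<le> C"
    by (rule cutoff_sequence) blast
  let ?e = "\<lambda>n z. complex_of_real (\<eta> n z)"
  have nI: "integrable lborel (\<lambda>z. a z * b z)"
    if "integrable lborel (\<lambda>z. (cmod (a z))\<^sup>2)" "integrable lborel (\<lambda>z. (cmod (b z))\<^sup>2)"
      and [measurable]: "a \<in> borel_measurable borel" "b \<in> borel_measurable borel" for a b :: "complex \<Rightarrow> complex"
  proof -
    have "integrable lborel (\<lambda>z. cmod (a z) * cmod (b z))"
      by (rule integrable_mult_L2(1)) (use that in auto)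
    then show ?thesis by (rule Bochner_Integration.integrable_bound) (auto simp: norm_mult)
  qed
  have em: "?e n \<in> borel_measurable borel" for n
    by (intro borel_measurable_continuous_onI test_function_continuous[OF \<eta>(1)])
  have lim: "(\<lambda>n. LINT z|lborel. a z * ?e n z * b z) \<longlonglongrightarrow> (LINT z|lborel. a z * b z)"
    if a: "integrable lborel (\<lambda>z. (cmod (a z))\<^sup>2)" "integrable lborel (\<lambda>z. (cmod (b z))\<^sup>2)"
      "a \<in> borel_measurable borel" "b \<in> borel_measurable borel" for a b :: "complex \<Rightarrow> complex"
  proof (rule integral_dominated_convergence[where w = "\<lambda>z. cmod (a z * b z)"])
    note [measurable] = a(3,4) em
    show "integrable lborel (\<lambda>z. cmod (a z * b z))" using nI[OF a] by (rule integrable_norm)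
    show "(\<lambda>z. a z * b z) \<in> borel_measurable lborel" by measurable
    show "(\<lambda>z. a z * ?e n z * b z) \<in> borel_measurable lborel" for n by measurable
    show "AE z in lborel. (\<lambda>n. a z * ?e n z * b z) \<longlonglongrightarrow> a z * b z"
    proof (rule AE_I2)
      fix z
      obtain N where N: "cmod z \<le> real N" using real_arch_simple by blast
      show "(\<lambda>n. a z * ?e n z * b z) \<longlonglongrightarrow> a z * b z"
        by (rule tendsto_eventually, rule eventually_sequentiallyI[of N])
          (use N \<eta>(4) in auto)
    qed
    show "AE z in lborel. norm (a z * ?e n z * b z) \<le> cmod (a z * b z)" for n
    proof (rule AE_I2)
      fix z
      have "cmod (a z * b z) * \<eta> n z \<le> cmod (a z * b z) * 1" by (intro mult_left_mono \<eta>) auto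
      then show "norm (a z * ?e n z * b z) \<le> cmod (a z * b z)"
        using \<eta>(2)[of n z] by (simp add: norm_mult mult.commute mult.left_commute)
    qed
  qed
  have tail: "(\<lambda>n. LINT z|lborel. a z * D n z * u z) \<longlonglongrightarrow> 0"
    if a: "integrable lborel (\<lambda>z. (cmod (a z))\<^sup>2)" "loc_L2 a"
      and D: "\<And>n. D n \<in> test_functions UNIV" "\<And>n z. cmod z < real (Suc n) \<Longrightarrow> D n z = 0"
      "\<And>n. integrable lborel (\<lambda>z. (cmod (D n z))\<^sup>2)" "\<And>n. (LINT z|lborel. (cmod (D n z))\<^sup>2) \<le> C"
    for a and D :: "nat \<Rightarrow> complex \<Rightarrow> complex"
  proof -
    have [measurable]: "a \<in> borel_measurable borel" using a(2) by (simp add: loc_L2_def)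
    have [measurable]: "D n \<in> borel_measurable borel" for n
      by (intro borel_measurable_continuous_onI test_function_continuous[OF D(1)])
    let ?T = "\<lambda>n z. indicator (- ball 0 (real (Suc n))) z * (cmod (a z))\<^sup>2 :: real"
    have [measurable]: "- ball (0::complex) r \<in> sets borel" for r by simp
    have TI: "integrable lborel (?T n)" for n
      by (rule Bochner_Integration.integrable_bound[OF a(1)]) (auto simp: indicator_def)
    have T0: "(\<lambda>n. integral\<^sup>L lborel (?T n)) \<longlonglongrightarrow> (LINT z|(lborel :: complex measure). (0::real))"
    proof (rule integral_dominated_convergence[where w = "\<lambda>z. (cmod (a z))\<^sup>2"])
      show "AE z in lborel. (\<lambda>n. ?T n z) \<longlonglongrightarrow> 0"
      proof (rule AE_I2)
        fix z :: complex
        obtain N where N: "cmod z \<le> real N" using real_arch_simple by blast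
        show "(\<lambda>n. ?T n z) \<longlonglongrightarrow> 0"
          by (rule tendsto_eventually, rule eventually_sequentiallyI[of N])
            (use N in \<open>auto simp: indicator_def\<close>)
      qed
      show "AE z in lborel. norm (?T n z) \<le> (cmod (a z))\<^sup>2" for n by (auto simp: indicator_def)
    qed (use a(1) in measurable)
    show ?thesis
    proof (rule Lim_null_comparison)
      have "(\<lambda>n. M * (sqrt (integral\<^sup>L lborel (?T n)) * sqrt C)) \<longlonglongrightarrow> M * (sqrt 0 * sqrt C)"
        using T0 by (intro tendsto_intros) simp
      then show "(\<lambda>n. M * (sqrt (integral\<^sup>L lborel (?T n)) * sqrt C)) \<longlonglongrightarrow> 0" by simp
      show "\<forall>\<^sub>F n in sequentially. norm (LINT z|lborel. a z * D n z * u z) \<le> M * (sqrt (integral\<^sup>L lborel (?T n)) * sqrt C)"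
      proof (intro always_eventually allI)
        fix n
        let ?f = "\<lambda>z. indicator (- ball 0 (real (Suc n))) z * cmod (a z) :: real"
        have f2: "(?f z)\<^sup>2 = ?T n z" for z by (simp add: indicator_def)
        have CS: "integrable lborel (\<lambda>z. ?f z * cmod (D n z))"
          "(LINT z|lborel. \<bar>?f z * cmod (D n z)\<bar>) \<le> sqrt (LINT z|lborel. (?f z)\<^sup>2) * sqrt (LINT z|lborel. (cmod (D n z))\<^sup>2)"
          by (rule integrable_mult_L2; (unfold f2)?; (use TI D(3) in measurable)?)+
        have "norm (LINT z|lborel. a z * D n z * u z) \<le> (LINT z|lborel. M * \<bar>?f z * cmod (D n z)\<bar>)"
        proof (rule Bochner_Integration.integral_norm_bound_integral)
          show "integrable lborel (\<lambda>z. a z * D n z * u z)" by (rule integrable_test_L2[OF a(2) uL D(1)])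
          show "integrable lborel (\<lambda>z. M * \<bar>?f z * cmod (D n z)\<bar>)" using CS(1) by (intro integrable_mult_right integrable_abs)
          fix z
          show "norm (a z * D n z * u z) \<le> M * \<bar>?f z * cmod (D n z)\<bar>"
          proof (cases "cmod z < real (Suc n)")
            case True
            then show ?thesis using D(2) M0 by simp
          next
            case False
            have "cmod (a z) * cmod (D n z) * cmod (u z) \<le> cmod (a z) * cmod (D n z) * M"
              by (intro mult_left_mono M) auto
            then show ?thesis using False by (simp add: norm_mult abs_mult mult.commute del: of_nat_Suc)
          qed
        qed
        also have "\<dots> = M * (LINT z|lborel. \<bar>?f z * cmod (D n z)\<bar>)" by (rule integral_mult_right_zero)
        also have "\<dots> \<le> M * (sqrt (integral\<^sup>L lborel (?T n)) * sqrt C)"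
        proof (rule mult_left_mono[OF order_trans[OF CS(2)] M0])
          show "sqrt (LINT z|lborel. (?f z)\<^sup>2) * sqrt (LINT z|lborel. (cmod (D n z))\<^sup>2) \<le> sqrt (integral\<^sup>L lborel (?T n)) * sqrt C"
            unfolding f2 by (intro mult_left_mono real_sqrt_le_mono D(4) real_sqrt_ge_zero integral_nonneg_AE) auto
        qed
        finally show "norm (LINT z|lborel. a z * D n z * u z) \<le> M * (sqrt (integral\<^sup>L lborel (?T n)) * sqrt C)" .
      qed
    qed
  qed
  have "(\<lambda>n. (LINT z|lborel. h z * ?e n z * t z) + (LINT z|lborel. h z * d_zbar (?e n) z * u z))
     \<longlonglongrightarrow> (LINT z|lborel. h z * t z) + 0"
    by (intro tendsto_add lim tail) (use h t G \<eta> \<eta>I test_functions_d_z(2)[OF \<eta>(1)] in auto)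
  moreover have "(\<lambda>n. (LINT z|lborel. w z * ?e n z * s z) + (LINT z|lborel. w z * d_z (?e n) z * u z))
     \<longlonglongrightarrow> (LINT z|lborel. w z * s z) + 0"
    by (intro tendsto_add lim tail) (use w s G \<eta> \<eta>I test_functions_d_z(1)[OF \<eta>(1)] in auto)
  ultimately show ?thesis
    unfolding local_pairing[OF g u \<eta>(1)] using LIMSEQ_unique by fastforce
qed

text \<open>For smooth \<open>g\<close> this says that the integral of the Jacobian vanishes.  It is the pairing of \<open>g\<close> with its conjugate, whose
weak derivatives are \<open>cnj w\<close> and \<open>cnj h\<close>.\<close>

theorem energy_identity:
  assumes g: "weak_derivs g h w" and M: "\<And>z. cmod (g z) \<le> M"
    and h: "integrable lborel (\<lambda>z. (cmod (h z))\<^sup>2)" and w: "integrable lborel (\<lambda>z. (cmod (w z))\<^sup>2)"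
  shows "(LINT z|lborel. (cmod (h z))\<^sup>2) = (LINT z|lborel. (cmod (w z))\<^sup>2)"
proof -
  have "(LINT z|lborel. h z * cnj (h z)) = (LINT z|lborel. w z * cnj (w z))"
    by (rule global_pairing[OF g weak_derivs_cnj[OF g]]) (use M h w in auto)
  then have "(LINT z|lborel. complex_of_real ((cmod (h z))\<^sup>2)) = (LINT z|lborel. complex_of_real ((cmod (w z))\<^sup>2))"
    by (simp only: complex_norm_square)
  then show ?thesis unfolding integral_complex_of_real by simp
qed

section \<open>Integration by parts for piecewise differentiable functions\<close>

text \<open>The exceptional set \<open>S\<close> meets each coordinate line in finitely many points, and \<open>e\<close> is continuous across it, so no boundary
term appears.\<close>

lemma integral_by_parts_piecewise:
  assumes V: "open V" and \<phi>: "\<phi> \<in> test_functions V" and e: "continuous_on V e"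
    and S: "\<And>y. finite {x. Complex x y \<in> S}" "\<And>x. finite {y. Complex x y \<in> S}"
    and D: "\<And>z. z \<in> V - S \<Longrightarrow> (e has_derivative D z) (at z)"
    and I: "integrable lborel (\<lambda>z. D z 1 * \<phi> z)" "integrable lborel (\<lambda>z. D z \<i> * \<phi> z)"
  shows "(LINT z|lborel. (D z 1 - \<i> * D z \<i>) / 2 * \<phi> z) = - (LINT z|lborel. e z * d_z \<phi> z)"
    "(LINT z|lborel. (D z 1 + \<i> * D z \<i>) / 2 * \<phi> z) = - (LINT z|lborel. e z * d_zbar \<phi> z)"
proof -
  note T = test_functionsD[OF \<phi>]
  from T(2) obtain K where K: "compact K" "K \<subseteq> V" "\<And>z. z \<notin> K \<Longrightarrow> \<phi> z = 0" by metis
  obtain R where R: "\<forall>x\<in>K. cmod x \<le> R"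
    using compact_imp_bounded[OF K(1)] by (auto simp: bounded_iff)
  have Kc: "closed K" using K(1) by (rule compact_imp_closed)
  have out: "frechet_derivative \<phi> (at z) = (\<lambda>_. 0)" if "z \<notin> K" for z
    by (rule frechet_zero_outside[OF Kc _ that]) (rule K(3))
  note out' = fun_cong[OF out]
  let ?u = "\<lambda>z. e z * \<phi> z"
  have Iu: "integrable lborel (\<lambda>z. e z * \<psi> z)" if "continuous_on UNIV \<psi>" "\<And>z. z \<notin> K \<Longrightarrow> \<psi> z = 0" for \<psi>
  proof -
    have "continuous_on K (\<lambda>z. e z * \<psi> z)"
      using continuous_on_subset[OF e K(2)] continuous_on_subset[OF that(1)] by (intro continuous_intros) auto
    from borel_integrable_compact[OF K(1) this]
    have "integrable lborel (\<lambda>z. indicator K z *\<^sub>R (e z * \<psi> z))" .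
    also have "(\<lambda>z. indicator K z *\<^sub>R (e z * \<psi> z)) = (\<lambda>z. e z * \<psi> z)"
      using that(2) by (auto simp: fun_eq_iff indicator_def)
    finally show ?thesis .
  qed
  have Ix: "integrable lborel (\<lambda>z. e z * d_x \<phi> z)" "integrable lborel (\<lambda>z. e z * d_y \<phi> z)"
    by (rule Iu; use smooth_continuous[OF smooth_d(1)[OF T(1)]] smooth_continuous[OF smooth_d(2)[OF T(1)]] out' in auto)+
  have uc: "continuous_on UNIV ?u"
  proof -
    have "continuous (at z) ?u" for z
    proof (cases "z \<in> V")
      case True
      then have "continuous (at z) e" using e V by (simp add: continuous_on_eq_continuous_at)
      moreover have "continuous (at z) \<phi>"
        using smooth_continuous[OF T(1), of UNIV] by (simp add: continuous_on_eq_continuous_at)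
      ultimately show ?thesis by (rule continuous_mult)
    next
      case False
      then have z: "z \<in> - K" using K(2) by auto
      have "continuous_on (- K) ?u"
        using K(3) by (subst continuous_on_cong[OF refl, of _ _ "\<lambda>_. 0"]) auto
      then show ?thesis using Kc z by (simp add: continuous_on_eq_continuous_at open_Compl)
    qed
    then show ?thesis by (simp add: continuous_on_eq_continuous_at)
  qed
  have uD: "(?u has_derivative (\<lambda>d. D z d * \<phi> z + e z * frechet_derivative \<phi> (at z) d)) (at z)" if "z \<notin> S" for z
  proof (cases "z \<in> V")
    case True
    have "(?u has_derivative (\<lambda>d. e z * frechet_derivative \<phi> (at z) d + D z d * \<phi> z)) (at z)"
      by (rule has_derivative_mult[OF D smooth_differentiable[OF T(1)]]) (use True that in auto)
    then show ?thesis by (simp add: add.commute)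
  next
    case False
    then have z: "z \<notin> K" using K(2) by auto
    have "((\<lambda>_. 0) has_derivative (\<lambda>_. 0)) (at z)" by simp
    then have "(?u has_derivative (\<lambda>_. 0)) (at z)"
      by (rule has_derivative_transform_within_open[where s = "- K"]) (use Kc z K(3) in auto)
    then show ?thesis using K(3)[OF z] out'[OF z] by simp
  qed
  have zx: "(LINT z|lborel. D z 1 * \<phi> z + e z * d_x \<phi> z) = 0"
  proof (rule integral_partial_derivative_zero[where u = ?u and R = R])
    show "integrable lborel (\<lambda>z. D z 1 * \<phi> z + e z * d_x \<phi> z)" by (intro Bochner_Integration.integrable_add I Ix)
    show "continuous_on UNIV ?u" by (rule uc)
    fix z assume "R < cmod z"
    then have "z \<notin> K" using R by auto
    then show "?u z = 0 \<and> D z 1 * \<phi> z + e z * d_x \<phi> z = 0" using K(3) out' by simp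
  next
    have "((\<lambda>x. ?u (Complex x y)) has_vector_derivative D (Complex x y) 1 * \<phi> (Complex x y) + e (Complex x y) * d_x \<phi> (Complex x y)) (at x)"
      if "Complex x y \<notin> S" for x y
    proof -
      have eq: "Complex 0 y + x *\<^sub>R 1 = Complex x y" for x by (simp add: complex_eq_iff)
      have "(?u has_derivative (\<lambda>d. D (Complex x y) d * \<phi> (Complex x y) + e (Complex x y) * frechet_derivative \<phi> (at (Complex x y)) d)) (at (Complex 0 y + x *\<^sub>R 1))"
        using uD[OF that] unfolding eq .
      from has_vector_derivative_along[OF this] show ?thesis unfolding eq .
    qed
    then have "{x. \<not> ((\<lambda>x. ?u (Complex x y)) has_vector_derivative D (Complex x y) 1 * \<phi> (Complex x y) + e (Complex x y) * d_x \<phi> (Complex x y)) (at x)}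
        \<subseteq> {x. Complex x y \<in> S}" for y by blast
    then show "(\<forall>y. finite {x. \<not> ((\<lambda>x. ?u (Complex x y)) has_vector_derivative D (Complex x y) 1 * \<phi> (Complex x y) + e (Complex x y) * d_x \<phi> (Complex x y)) (at x)}) \<or>
        (\<forall>x. finite {y. \<not> ((\<lambda>y. ?u (Complex x y)) has_vector_derivative D (Complex x y) 1 * \<phi> (Complex x y) + e (Complex x y) * d_x \<phi> (Complex x y)) (at y)})"
      using S(1) finite_subset by blast
  qed
  have zy: "(LINT z|lborel. D z \<i> * \<phi> z + e z * d_y \<phi> z) = 0"
  proof (rule integral_partial_derivative_zero[where u = ?u and R = R])
    show "integrable lborel (\<lambda>z. D z \<i> * \<phi> z + e z * d_y \<phi> z)" by (intro Bochner_Integration.integrable_add I Ix)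
    show "continuous_on UNIV ?u" by (rule uc)
    fix z assume "R < cmod z"
    then have "z \<notin> K" using R by auto
    then show "?u z = 0 \<and> D z \<i> * \<phi> z + e z * d_y \<phi> z = 0" using K(3) out' by simp
  next
    have "((\<lambda>y. ?u (Complex x y)) has_vector_derivative D (Complex x y) \<i> * \<phi> (Complex x y) + e (Complex x y) * d_y \<phi> (Complex x y)) (at y)"
      if "Complex x y \<notin> S" for x y
    proof -
      have eq: "Complex x 0 + y *\<^sub>R \<i> = Complex x y" for y by (simp add: complex_eq_iff)
      have "(?u has_derivative (\<lambda>d. D (Complex x y) d * \<phi> (Complex x y) + e (Complex x y) * frechet_derivative \<phi> (at (Complex x y)) d)) (at (Complex x 0 + y *\<^sub>R \<i>))"
        using uD[OF that] unfolding eq .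
      from has_vector_derivative_along[OF this] show ?thesis unfolding eq .
    qed
    then have "{y. \<not> ((\<lambda>y. ?u (Complex x y)) has_vector_derivative D (Complex x y) \<i> * \<phi> (Complex x y) + e (Complex x y) * d_y \<phi> (Complex x y)) (at y)}
        \<subseteq> {y. Complex x y \<in> S}" for x by blast
    then show "(\<forall>y. finite {x. \<not> ((\<lambda>x. ?u (Complex x y)) has_vector_derivative D (Complex x y) \<i> * \<phi> (Complex x y) + e (Complex x y) * d_y \<phi> (Complex x y)) (at x)}) \<or>
        (\<forall>x. finite {y. \<not> ((\<lambda>y. ?u (Complex x y)) has_vector_derivative D (Complex x y) \<i> * \<phi> (Complex x y) + e (Complex x y) * d_y \<phi> (Complex x y)) (at y)})"
      using S(2) finite_subset by blast
  qed
  define A B A' B' where "A = (LINT z|lborel. D z 1 * \<phi> z)" and "B = (LINT z|lborel. D z \<i> * \<phi> z)"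
    and "A' = (LINT z|lborel. e z * d_x \<phi> z)" and "B' = (LINT z|lborel. e z * d_y \<phi> z)"
  have AB: "A + A' = 0" "B + B' = 0" using zx zy I Ix by (simp_all add: A_def A'_def B_def B'_def)
  have "(LINT z|lborel. (D z 1 - \<i> * D z \<i>) / 2 * \<phi> z) = (LINT z|lborel. (D z 1 * \<phi> z - \<i> * (D z \<i> * \<phi> z)) / 2)"
    by (rule Bochner_Integration.integral_cong) (simp_all add: algebra_simps)
  also have "\<dots> = (A - \<i> * B) / 2" using I by (simp add: A_def B_def)
  finally have 1: "(LINT z|lborel. (D z 1 - \<i> * D z \<i>) / 2 * \<phi> z) = (A - \<i> * B) / 2" .
  have "(LINT z|lborel. e z * d_z \<phi> z) = (LINT z|lborel. (e z * d_x \<phi> z - \<i> * (e z * d_y \<phi> z)) / 2)"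
    by (rule Bochner_Integration.integral_cong) (simp_all add: d_z_def algebra_simps)
  also have "\<dots> = (A' - \<i> * B') / 2" using Ix by (simp add: A'_def B'_def)
  finally have 2: "(LINT z|lborel. e z * d_z \<phi> z) = (A' - \<i> * B') / 2" .
  have "(LINT z|lborel. (D z 1 + \<i> * D z \<i>) / 2 * \<phi> z) = (LINT z|lborel. (D z 1 * \<phi> z + \<i> * (D z \<i> * \<phi> z)) / 2)"
    by (rule Bochner_Integration.integral_cong) (simp_all add: algebra_simps)
  also have "\<dots> = (A + \<i> * B) / 2" using I by (simp add: A_def B_def)
  finally have 3: "(LINT z|lborel. (D z 1 + \<i> * D z \<i>) / 2 * \<phi> z) = (A + \<i> * B) / 2" .
  have "(LINT z|lborel. e z * d_zbar \<phi> z) = (LINT z|lborel. (e z * d_x \<phi> z + \<i> * (e z * d_y \<phi> z)) / 2)"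
    by (rule Bochner_Integration.integral_cong) (simp_all add: d_zbar_def algebra_simps)
  also have "\<dots> = (A' + \<i> * B') / 2" using Ix by (simp add: A'_def B'_def)
  finally have 4: "(LINT z|lborel. e z * d_zbar \<phi> z) = (A' + \<i> * B') / 2" .
  have A': "A' = - A" "B' = - B" using AB by (auto simp: eq_neg_iff_add_eq_0 add.commute)
  show "(LINT z|lborel. (D z 1 - \<i> * D z \<i>) / 2 * \<phi> z) = - (LINT z|lborel. e z * d_z \<phi> z)"
    unfolding 1 2 A' by (simp add: field_simps)
  show "(LINT z|lborel. (D z 1 + \<i> * D z \<i>) / 2 * \<phi> z) = - (LINT z|lborel. e z * d_zbar \<phi> z)"
    unfolding 3 4 A' by (simp add: field_simps)
qed

lemma holomorphic_by_parts:
  assumes V: "open V" and \<phi>: "\<phi> \<in> test_functions V" and e: "\<And>z. z \<in> V \<Longrightarrow> (e has_field_derivative e' z) (at z)"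
    and c: "continuous_on V e'"
  shows "(LINT z|lborel. e' z * \<phi> z) = - (LINT z|lborel. e z * d_z \<phi> z)"
    "(LINT z|lborel. e z * d_zbar \<phi> z) = 0"
    "integrable lborel (\<lambda>z. e' z * \<phi> z)" 
proof -
  note T = test_functionsD[OF \<phi>]
  from T(2) obtain K where K: "compact K" "K \<subseteq> V" "\<And>z. z \<notin> K \<Longrightarrow> \<phi> z = 0" by metis
  have "continuous_on K (\<lambda>z. e' z * \<phi> z)"
    using continuous_on_subset[OF c K(2)] smooth_continuous[OF T(1)] by (intro continuous_intros) auto
  from borel_integrable_compact[OF K(1) this]
  have "integrable lborel (\<lambda>z. indicator K z *\<^sub>R (e' z * \<phi> z))" .
  also have "(\<lambda>z. indicator K z *\<^sub>R (e' z * \<phi> z)) = (\<lambda>z. e' z * \<phi> z)"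
    using K(3) by (auto simp: fun_eq_iff indicator_def)
  finally show I: "integrable lborel (\<lambda>z. e' z * \<phi> z)" .
  then have I2: "integrable lborel (\<lambda>z. e' z * \<i> * \<phi> z)" using integrable_mult_right[of \<i> lborel "\<lambda>z. e' z * \<phi> z"] by (simp add: algebra_simps)
  have ec: "continuous_on V e"
    using e DERIV_isCont by (intro continuous_at_imp_continuous_on) blast
  have d: "(e has_derivative (\<lambda>d. e' z * d)) (at z)" if "z \<in> V - {}" for z
    using e that by (auto simp: has_field_derivative_def)
  note P = integral_by_parts_piecewise[OF V \<phi> ec _ _ d, where S = "{}"]
  have "(LINT z|lborel. (e' z * 1 - \<i> * (e' z * \<i>)) / 2 * \<phi> z) = - (LINT z|lborel. e z * d_z \<phi> z)"
    by (rule P(1)) (use I I2 in auto)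
  then show "(LINT z|lborel. e' z * \<phi> z) = - (LINT z|lborel. e z * d_z \<phi> z)" by (simp add: field_simps)
  have "(LINT z|lborel. (e' z * 1 + \<i> * (e' z * \<i>)) / 2 * \<phi> z) = - (LINT z|lborel. e z * d_zbar \<phi> z)"
    by (rule P(2)) (use I I2 in auto)
  then show "(LINT z|lborel. e z * d_zbar \<phi> z) = 0" by (simp add: field_simps)
qed

section \<open>The reflected pole\<close>

text \<open>The function of the extremal case.  The outer formula is the inner one with \<open>z\<close> replaced by its reflection \<open>1 / cnj z\<close> in the unit circle;
so the two agree on the circle, and the function is holomorphic inside and antiholomorphic outside.\<close>

definition reflected_pole :: "real \<Rightarrow> complex \<Rightarrow> complex" where
  "reflected_pole p z = (if cmod z < 1 then z / (1 - of_real p * z) else 1 / (cnj z - of_real p))"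

definition reflected_pole_dz :: "real \<Rightarrow> complex \<Rightarrow> complex" where
  "reflected_pole_dz p z = (if cmod z < 1 then 1 / (1 - of_real p * z)\<^sup>2 else 0)"

definition reflected_pole_dzbar :: "real \<Rightarrow> complex \<Rightarrow> complex" where
  "reflected_pole_dzbar p z = (if cmod z < 1 then 0 else - 1 / (cnj z - of_real p)\<^sup>2)"

lemma denominator_bounds:
  assumes "0 \<le> p" "p < 1"
  shows "cmod z \<le> 1 \<Longrightarrow> 1 - p \<le> cmod (1 - of_real p * z)"
    "1 \<le> cmod z \<Longrightarrow> 1 - p \<le> cmod (z - of_real p)" "1 \<le> cmod z \<Longrightarrow> 1 - p \<le> cmod (cnj z - of_real p)"
proof -
  show "1 - p \<le> cmod (1 - of_real p * z)" if "cmod z \<le> 1"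
  proof -
    have "cmod (of_real p * z) \<le> p" using that assms by (simp add: norm_mult mult_left_le)
    then show ?thesis using norm_triangle_ineq2[of 1 "of_real p * z"] by simp
  qed
  show 1: "1 - p \<le> cmod (z - of_real p)" if "1 \<le> cmod z" for z
    using that assms norm_triangle_ineq2[of z "of_real p"] by simp
  show "1 - p \<le> cmod (cnj z - of_real p)" if "1 \<le> cmod z"
    using 1[of "cnj z"] that by simp
qed

lemma denominator_nonzero:
  assumes "0 \<le> p" "p < 1"
  shows "cmod z \<le> 1 \<Longrightarrow> 1 - of_real p * z \<noteq> 0" "1 \<le> cmod z \<Longrightarrow> z - of_real p \<noteq> 0" "1 \<le> cmod z \<Longrightarrow> cnj z - of_real p \<noteq> 0"
  using denominator_bounds[OF assms, of z] assms by auto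

lemma reflected_pole_on_circle:
  assumes "0 \<le> p" "p < 1" "cmod z = 1"
  shows "z / (1 - of_real p * z) = 1 / (cnj z - of_real p)"
proof -
  have z: "z * cnj z = 1" using assms(3) by (simp add: complex_mult_cnj cmod_power2[symmetric])
  then have "1 - of_real p * z = z * (cnj z - of_real p)" by (simp add: algebra_simps)
  moreover have "z \<noteq> 0" using assms(3) by auto
  ultimately show ?thesis by simp
qed

lemma reflected_pole_continuous:
  assumes p: "0 \<le> p" "p < 1" shows "continuous_on UNIV (reflected_pole p)"
proof -
  have "continuous_on (cball 0 1 \<union> {z. 1 \<le> cmod z})
     (\<lambda>z. if cmod z < 1 then z / (1 - of_real p * z) else 1 / (cnj z - of_real p))"
  proof (rule continuous_on_cases)
    show "closed (cball (0::complex) 1)" by simp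
    show "closed {z::complex. 1 \<le> cmod z}" by (intro closed_Collect_le continuous_intros)
    show "continuous_on (cball 0 1) (\<lambda>z::complex. z / (1 - of_real p * z))"
      by (intro continuous_intros) (use denominator_nonzero[OF p] in auto)
    show "continuous_on {z. 1 \<le> cmod z} (\<lambda>z::complex. 1 / (cnj z - of_real p))"
      by (intro continuous_intros) (use denominator_nonzero[OF p] in auto)
    show "\<forall>x. x \<in> cball 0 1 \<and> \<not> cmod x < 1 \<or> x \<in> {z. 1 \<le> cmod z} \<and> cmod x < 1 \<longrightarrow>
        x / (1 - of_real p * x) = 1 / (cnj x - of_real p)"
      using reflected_pole_on_circle[OF p] by auto
  qed
  moreover have "cball 0 1 \<union> {z::complex. 1 \<le> cmod z} = UNIV" by auto
  ultimately show ?thesis by (simp add: reflected_pole_def[abs_def])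
qed

lemma reflected_pole_bounded:
  assumes p: "0 \<le> p" "p < 1"
  shows "cmod (reflected_pole p z) \<le> 1 / (1 - p)"
    "cmod (reflected_pole_dz p z) \<le> 1 / (1 - p)\<^sup>2" "cmod (reflected_pole_dzbar p z) \<le> 1 / (1 - p)\<^sup>2"
proof -
  note b = denominator_bounds[OF p, of z]
  have b2: "(1 - p)\<^sup>2 \<le> (cmod (1 - of_real p * z))\<^sup>2" if "cmod z \<le> 1" using b(1)[OF that] p by (intro power_mono) auto
  have b3: "(1 - p)\<^sup>2 \<le> (cmod (cnj z - of_real p))\<^sup>2" if "1 \<le> cmod z" using b(3)[OF that] p by (intro power_mono) auto
  show "cmod (reflected_pole p z) \<le> 1 / (1 - p)"
    unfolding reflected_pole_def using b p by (auto simp: norm_divide intro!: frac_le)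
  show "cmod (reflected_pole_dz p z) \<le> 1 / (1 - p)\<^sup>2"
    unfolding reflected_pole_dz_def using b2 p by (auto simp: norm_divide norm_power intro!: frac_le)
  show "cmod (reflected_pole_dzbar p z) \<le> 1 / (1 - p)\<^sup>2"
    unfolding reflected_pole_dzbar_def using b3 p by (auto simp: norm_divide norm_power intro!: frac_le)
qed

lemma norm_less_measurable [measurable]: "Measurable.pred borel (\<lambda>z::complex. cmod z < 1)"
  by simp

lemma reflected_pole_measurable [measurable]:
  "reflected_pole_dz p \<in> borel_measurable borel" "reflected_pole_dzbar p \<in> borel_measurable borel"
proof -
  have [measurable]: "cnj \<in> borel_measurable borel"
    by (intro borel_measurable_continuous_onI continuous_intros)
  show "reflected_pole_dz p \<in> borel_measurable borel" "reflected_pole_dzbar p \<in> borel_measurable borel"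
    unfolding reflected_pole_dz_def[abs_def] reflected_pole_dzbar_def[abs_def] by measurable
qed

lemma loc_L2_bounded:
  assumes [measurable]: "b \<in> borel_measurable borel" and B: "\<And>z. cmod (b z) \<le> B"
  shows "loc_L2 b"
  using loc_L2_bounded_mult[OF loc_L2_continuous[of "\<lambda>_. 1"] assms] by simp

lemma circle_sections_finite:
  "finite {x. Complex x y \<in> sphere 0 r}" "finite {y. Complex x y \<in> sphere 0 r}"
proof -
  have f: "finite {t::real. t\<^sup>2 = c}" for c
    by (rule finite_subset[of _ "{sqrt c, - sqrt c}"]) (auto simp: real_sqrt_abs power2_eq_iff dest: sym)
  have "{x. Complex x y \<in> sphere 0 r} \<subseteq> {x. x\<^sup>2 = r\<^sup>2 - y\<^sup>2}"
    by (auto simp: cmod_def)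
  then show "finite {x. Complex x y \<in> sphere 0 r}" using f finite_subset by blast
  have "{y. Complex x y \<in> sphere 0 r} \<subseteq> {y. y\<^sup>2 = r\<^sup>2 - x\<^sup>2}"
    by (auto simp: cmod_def)
  then show "finite {y. Complex x y \<in> sphere 0 r}" using f finite_subset by blast
qed

theorem reflected_pole_weak_derivs:
  assumes p: "0 \<le> p" "p < 1"
  shows "weak_derivs (reflected_pole p) (reflected_pole_dz p) (reflected_pole_dzbar p)"
  unfolding weak_derivs_def
proof (intro conjI ballI)
  show c: "continuous_on UNIV (reflected_pole p)" by (rule reflected_pole_continuous[OF p])
  show L: "loc_L2 (reflected_pole_dz p)" "loc_L2 (reflected_pole_dzbar p)"
    by (rule loc_L2_bounded, simp, rule reflected_pole_bounded[OF p])+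
  fix \<phi> assume \<phi>: "\<phi> \<in> test_functions UNIV"
  define D where "D z d = reflected_pole_dz p z * d + reflected_pole_dzbar p z * cnj d" for z d
  have dD: "(reflected_pole p has_derivative D z) (at z)" if "z \<in> UNIV - sphere 0 1" for z
  proof (cases "cmod z < 1")
    case True
    have nz: "1 - of_real p * z \<noteq> 0" using denominator_nonzero[OF p, of z] True by simp
    have "((\<lambda>z. z / (1 - of_real p * z)) has_field_derivative reflected_pole_dz p z) (at z)"
      using nz True by (auto intro!: derivative_eq_intros simp: reflected_pole_dz_def power2_eq_square field_simps)
    then have "((\<lambda>z. z / (1 - of_real p * z)) has_derivative D z) (at z)"
      using True by (simp add: has_field_derivative_def D_def[abs_def] reflected_pole_dzbar_def)
    then show ?thesis
      by (rule has_derivative_transform_within_open[where s = "ball 0 1"]) (use True in \<open>auto simp: reflected_pole_def\<close>)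
  next
    case False
    then have z: "cmod z > 1" using that by simp
    have nz: "cnj z - of_real p \<noteq> 0" using denominator_nonzero[OF p, of z] z by simp
    have o: "((\<lambda>w. 1 / (w - of_real p)) has_field_derivative - 1 / (cnj z - of_real p)\<^sup>2) (at (cnj z))"
      using nz by (auto intro!: derivative_eq_intros simp: power2_eq_square field_simps)
    have "((\<lambda>z. 1 / (cnj z - of_real p)) has_derivative (\<lambda>d. - 1 / (cnj z - of_real p)\<^sup>2 * cnj d)) (at z)"
      by (rule has_derivative_compose[OF bounded_linear_imp_has_derivative[OF bounded_linear_cnj] o[unfolded has_field_derivative_def]])
    then have "((\<lambda>z. 1 / (cnj z - of_real p)) has_derivative D z) (at z)"
      using z by (simp add: D_def[abs_def] reflected_pole_dz_def reflected_pole_dzbar_def)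
    then show ?thesis
      by (rule has_derivative_transform_within_open[where s = "- cball 0 1"]) (use z in \<open>auto simp: reflected_pole_def\<close>)
  qed
  have I: "integrable lborel (\<lambda>z. reflected_pole_dz p z * \<phi> z)" "integrable lborel (\<lambda>z. reflected_pole_dzbar p z * \<phi> z)"
    using L loc_L2_imp_loc_int integrable_test[OF _ \<phi>] by blast+
  have I1: "integrable lborel (\<lambda>z. D z 1 * \<phi> z)"
    using Bochner_Integration.integrable_add[OF I] by (simp add: D_def algebra_simps)
  have I2: "integrable lborel (\<lambda>z. D z \<i> * \<phi> z)"
    using integrable_mult_right[of \<i>, OF Bochner_Integration.integrable_diff[OF I]] by (simp add: D_def algebra_simps)
  have e: "(D z 1 - \<i> * D z \<i>) / 2 = reflected_pole_dz p z" "(D z 1 + \<i> * D z \<i>) / 2 = reflected_pole_dzbar p z" for z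
    by (simp_all add: D_def algebra_simps)
  note P = integral_by_parts_piecewise[OF open_UNIV \<phi> c circle_sections_finite[where r = 1] dD I1 I2, unfolded e]
  show "(LINT z|lborel. reflected_pole_dz p z * \<phi> z) = - (LINT z|lborel. reflected_pole p z * d_z \<phi> z)" by (rule P(1))
  show "(LINT z|lborel. reflected_pole_dzbar p z * \<phi> z) = - (LINT z|lborel. reflected_pole p z * d_zbar \<phi> z)" by (rule P(2))
qed

section \<open>The area formula for power series\<close>

lemma d_z_holomorphic:
  assumes "(f has_field_derivative f') (at z)" shows "d_z f z = f'" "d_zbar f z = 0"
proof -
  from frechet_derivative_at[OF assms[unfolded has_field_derivative_def], symmetric]
  show "d_z f z = f'" "d_zbar f z = 0" by (simp_all add: d_z_def d_zbar_def field_simps)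
qed

lemma smooth_power: "smooth (\<lambda>z. z ^ n)"
proof (induction n)
  case (Suc n)
  have "smooth (\<lambda>z::complex. z)" using C_k_linear[OF bounded_linear_ident] by (simp add: smooth_def)
  from smooth_mult[OF this Suc] show ?case by simp
qed (simp add: smooth_const)

lemma d_z_monomial:
  "d_z (\<lambda>z. z ^ m * cnj z ^ n) z = of_nat m * z ^ (m - 1) * cnj z ^ n"
  "d_zbar (\<lambda>z. z ^ m * cnj z ^ n) z = of_nat n * z ^ m * cnj z ^ (n - 1)"
proof -
  have p: "((\<lambda>z. z ^ k) has_field_derivative of_nat k * z ^ (k - 1)) (at z)" for k and z :: complex
    by (auto intro!: derivative_eq_intros)
  have c: "(\<lambda>z. cnj z ^ n) = (\<lambda>z. cnj (z ^ n))" by simp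
  have dc: "d_z (\<lambda>z. cnj z ^ n) z = 0" "d_zbar (\<lambda>z. cnj z ^ n) z = of_nat n * cnj z ^ (n - 1)"
    unfolding c d_z_cnj[OF smooth_power] using d_z_holomorphic[OF p[of n z]] by simp_all
  have s: "smooth (\<lambda>z. cnj z ^ n)" unfolding c by (rule smooth_cnj[OF smooth_power])
  show "d_z (\<lambda>z. z ^ m * cnj z ^ n) z = of_nat m * z ^ (m - 1) * cnj z ^ n"
    "d_zbar (\<lambda>z. z ^ m * cnj z ^ n) z = of_nat n * z ^ m * cnj z ^ (n - 1)"
    using d_z_mult[OF smooth_power s, of m z] d_z_holomorphic[OF p[of m z]] dc by simp_all
qed

lemma smooth_monomial: "smooth (\<lambda>z. z ^ m * cnj z ^ n)"
  using smooth_mult[OF smooth_power smooth_cnj[OF smooth_power], of m n] by simp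

text \<open>The moments of a disc are computed without polar coordinates, by integration by parts against the tent \<open>r\<^sup>2 - (cmod z)\<^sup>2\<close>, whose derivatives
with respect to \<open>z\<close> and \<open>cnj z\<close> are \<open>- cnj z\<close> and \<open>- z\<close> in the disc.\<close>

definition disc_moment :: "real \<Rightarrow> nat \<Rightarrow> nat \<Rightarrow> complex" where
  "disc_moment r m n = (LINT z|lborel. indicator (ball 0 r) z * (z ^ m * cnj z ^ n))"

definition tent_moment :: "real \<Rightarrow> nat \<Rightarrow> nat \<Rightarrow> complex" where
  "tent_moment r m n = (LINT z|lborel. of_real (max 0 (r\<^sup>2 - (cmod z)\<^sup>2)) * (z ^ m * cnj z ^ n))"

lemma integrable_indicator_ball_mult:
  assumes "continuous_on UNIV f"
  shows "integrable lborel (\<lambda>z. indicator (ball 0 r) z * (f z :: complex))"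
proof -
  have [measurable]: "f \<in> borel_measurable borel" "ball (0::complex) r \<in> sets borel"
    using assms by (auto intro: borel_measurable_continuous_onI)
  from borel_integrable_compact[OF compact_cball continuous_on_subset[OF assms subset_UNIV]]
  have "integrable lborel (\<lambda>z. indicator (cball 0 r) z *\<^sub>R f z)" .
  then show ?thesis by (rule Bochner_Integration.integrable_bound) (auto simp: indicator_def)
qed

text \<open>Integration by parts of the tent function, which is continuous and has a jump of the derivative on the circle.\<close>

lemma moment_recursion:
  assumes r: "r > 0"
  shows "disc_moment r m (Suc n) = of_nat m * tent_moment r (m - 1) n"
    "disc_moment r (Suc m) n = of_nat n * tent_moment r m (n - 1)"
proof -
  have "0 < r + 1" "r + 1 < r + 2" using r by auto
  from smooth_plateau[OF this, of 0]
  obtain \<eta> :: "complex \<Rightarrow> real" where \<eta>: "smooth (\<lambda>z. complex_of_real (\<eta> z))"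
    "\<And>z. 0 \<le> \<eta> z" "\<And>z. \<eta> z \<le> 1" "\<And>z. cmod z \<le> r + 1 \<Longrightarrow> \<eta> z = 1" "\<And>z. r + 2 \<le> cmod z \<Longrightarrow> \<eta> z = 0" by auto
  let ?\<eta> = "\<lambda>z. complex_of_real (\<eta> z)"
  let ?q = "\<lambda>z. z ^ m * cnj z ^ n"
  let ?\<phi> = "\<lambda>z. ?q z * ?\<eta> z"
  have \<eta>T: "?\<eta> \<in> test_functions UNIV"
    unfolding test_functions_UNIV_iff using \<eta>(1,5) by (auto intro!: exI[of _ "r + 2"])
  have \<phi>: "?\<phi> \<in> test_functions UNIV" by (rule test_functions_mult[OF \<eta>T smooth_monomial])
  let ?e = "\<lambda>z. complex_of_real (max 0 (r\<^sup>2 - (cmod z)\<^sup>2))"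
  have ec: "continuous_on UNIV ?e" by (intro continuous_intros)
  define D :: "complex \<Rightarrow> complex \<Rightarrow> complex" where "D z d = indicator (ball 0 r) z * of_real (- 2 * (z \<bullet> d))" for z d
  have ball: "cmod z < r \<longleftrightarrow> (cmod z)\<^sup>2 < r\<^sup>2" for z
    using r by (auto intro: power_strict_mono power2_less_imp_less)
  have dD: "(?e has_derivative D z) (at z)" if "z \<in> UNIV - sphere 0 r" for z
  proof (cases "cmod z < r")
    case True
    have "((\<lambda>z. complex_of_real (r\<^sup>2 - (cmod z)\<^sup>2)) has_derivative (\<lambda>d. of_real (- 2 * (z \<bullet> d)))) (at z)"
      unfolding power2_norm_eq_inner
      by (rule has_derivative_of_real) (auto intro!: derivative_eq_intros simp: inner_commute)
    then have "((\<lambda>z. complex_of_real (r\<^sup>2 - (cmod z)\<^sup>2)) has_derivative D z) (at z)"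
      using True by (simp add: D_def[abs_def])
    then show ?thesis
      by (rule has_derivative_transform_within_open[where s = "ball 0 r"])
        (use True in \<open>auto simp: ball max_def\<close>)
  next
    case False
    then have z: "cmod z > r" using that by simp
    have "((\<lambda>_. 0) has_derivative D z) (at z)" using z by (simp add: D_def[abs_def])
    then show ?thesis
    proof (rule has_derivative_transform_within_open[where s = "- cball 0 r"])
      fix w :: complex assume "w \<in> - cball 0 r"
      then have "r\<^sup>2 \<le> (cmod w)\<^sup>2" using r by (intro power_mono) auto
      then show "0 = ?e w" by simp
    qed (use z in auto)
  qed
  have D12: "D z 1 * \<psi> = indicator (ball 0 r) z * (of_real (- 2 * Re z) * \<psi>)"
    "D z \<i> * \<psi> = indicator (ball 0 r) z * (of_real (- 2 * Im z) * \<psi>)" for z \<psi>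
    by (simp_all add: D_def inner_complex_def)
  have \<phi>c: "continuous_on UNIV ?\<phi>" by (rule test_function_continuous[OF \<phi>])
  have I: "integrable lborel (\<lambda>z. D z 1 * ?\<phi> z)" "integrable lborel (\<lambda>z. D z \<i> * ?\<phi> z)"
    unfolding D12 by (rule integrable_indicator_ball_mult; intro continuous_intros \<phi>c)+
  have zz: "complex_of_real (Re z) - \<i> * complex_of_real (Im z) = cnj z" "complex_of_real (Re z) + \<i> * complex_of_real (Im z) = z" for z
    by (simp_all add: complex_eq_iff)
  have Dz: "(D z 1 - \<i> * D z \<i>) / 2 = - (indicator (ball 0 r) z * cnj z)"
    "(D z 1 + \<i> * D z \<i>) / 2 = - (indicator (ball 0 r) z * z)" for z
    using zz[of z] by (auto simp: D_def inner_complex_def indicator_def complex_eq_iff)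
  note P = integral_by_parts_piecewise[OF open_UNIV \<phi> ec circle_sections_finite dD I, unfolded Dz]
  have \<eta>d: "d_z ?\<eta> z = 0 \<and> d_zbar ?\<eta> z = 0 \<and> ?\<eta> z = 1" if "cmod z \<le> r" for z
  proof -
    have "((\<lambda>_. 1) has_derivative (\<lambda>_. 0)) (at z)" by simp
    then have "(?\<eta> has_derivative (\<lambda>_. 0)) (at z)"
      by (rule has_derivative_transform_within_open[where s = "ball 0 (r + 1)"])
        (use that \<eta>(4) in \<open>auto simp: less_imp_le\<close>)
    from frechet_derivative_at[OF this, symmetric] show ?thesis using that \<eta>(4)[of z] by (simp add: d_z_def d_zbar_def)
  qed
  have e0: "?e z = 0" if "\<not> cmod z \<le> r" for z
  proof -
    have "r\<^sup>2 \<le> (cmod z)\<^sup>2" using r that by (intro power_mono) auto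
    then show ?thesis by simp
  qed
  have dq: "?e z * d_z ?\<phi> z = of_nat m * (?e z * (z ^ (m - 1) * cnj z ^ n))"
    "?e z * d_zbar ?\<phi> z = of_nat n * (?e z * (z ^ m * cnj z ^ (n - 1)))" for z
    using d_z_mult[OF smooth_monomial \<eta>(1), of m n z] d_z_monomial[of m n z] \<eta>d[of z] e0[of z]
    by (cases "cmod z \<le> r"; simp)+
  have L: "indicator (ball 0 r) z * cnj z * ?\<phi> z = indicator (ball 0 r) z * (z ^ m * cnj z ^ Suc n)"
    "indicator (ball 0 r) z * z * ?\<phi> z = indicator (ball 0 r) z * (z ^ Suc m * cnj z ^ n)" for z
    using \<eta>d[of z] by (auto simp: indicator_def)
  show "disc_moment r m (Suc n) = of_nat m * tent_moment r (m - 1) n"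
    using P(1) unfolding disc_moment_def tent_moment_def dq minus_mult_left[symmetric] L by simp
  show "disc_moment r (Suc m) n = of_nat n * tent_moment r m (n - 1)"
    using P(2) unfolding disc_moment_def tent_moment_def dq minus_mult_left[symmetric] L by simp
qed

text \<open>The two forms of the recursion express the same tent moment with different factors.\<close>

lemma disc_moment_orthogonal:
  assumes r: "r > 0" and "m \<noteq> n" shows "disc_moment r m n = 0"
proof -
  consider "m = 0" | "n = 0" | m' n' where "m = Suc m'" "n = Suc n'" by (metis not0_implies_Suc)
  then show ?thesis
  proof cases
    case 1
    then obtain n' where "n = Suc n'" using assms(2) by (metis not0_implies_Suc)
    then show ?thesis using moment_recursion(1)[OF r, of 0 n'] 1 by simp
  next
    case 2
    then obtain m' where "m = Suc m'" using assms(2) by (metis not0_implies_Suc)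
    then show ?thesis using moment_recursion(2)[OF r, of m' 0] 2 by simp
  next
    case 3
    have "of_nat m * tent_moment r m' n' = of_nat n * tent_moment r m' n'"
      using moment_recursion(1)[OF r, of m n'] moment_recursion(2)[OF r, of m' n] 3 by simp
    then have "tent_moment r m' n' = 0" using assms(2) by (simp add: mult_right_cancel)
    then show ?thesis using moment_recursion(1)[OF r, of m n'] 3 by simp
  qed
qed

text \<open>Expanding the tent expresses its moment through two disc moments, and \<open>moment_recursion\<close> gives a second relation; together they determine each diagonal
moment from the previous one.\<close>

lemma disc_moment_diagonal:
  assumes r: "r > 0" shows "disc_moment r n n = of_real (pi * r ^ (2 * n + 2) / (n + 1))"
proof (induction n)
  case 0
  have "disc_moment r 0 0 = (LINT z|lborel. complex_of_real (indicator (ball (0::complex) r) z))"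
    unfolding disc_moment_def by (rule Bochner_Integration.integral_cong) (auto simp: indicator_def)
  also have "\<dots> = of_real (measure lborel (ball (0::complex) r))" by (simp add: integral_complex_of_real)
  also have "measure lborel (ball (0::complex) r) = pi * r\<^sup>2"
    using content_ball[of r "0::complex"] r by (simp add: unit_ball_vol_2)
  finally show ?case by (simp add: power2_eq_square)
next
  case (Suc n)
  have t: "tent_moment r n n = of_real (r\<^sup>2) * disc_moment r n n - disc_moment r (Suc n) (Suc n)"
  proof -
    have c: "continuous_on UNIV (\<lambda>z. complex_of_real (r\<^sup>2) * (z ^ n * cnj z ^ n))" "continuous_on UNIV (\<lambda>z::complex. z ^ Suc n * cnj z ^ Suc n)"
      by (intro continuous_intros)+
    have "tent_moment r n n = (LINT z|lborel. indicator (ball 0 r) z * (complex_of_real (r\<^sup>2) * (z ^ n * cnj z ^ n)) - indicator (ball 0 r) z * (z ^ Suc n * cnj z ^ Suc n))"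
      unfolding tent_moment_def
    proof (rule Bochner_Integration.integral_cong)
      fix z :: complex
      have zz: "complex_of_real ((cmod z)\<^sup>2) = z * cnj z" by (simp only: complex_norm_square)
      show "of_real (max 0 (r\<^sup>2 - (cmod z)\<^sup>2)) * (z ^ n * cnj z ^ n) = indicator (ball 0 r) z * (complex_of_real (r\<^sup>2) * (z ^ n * cnj z ^ n)) - indicator (ball 0 r) z * (z ^ Suc n * cnj z ^ Suc n)"
      proof (cases "cmod z < r")
        case True
        then have "(cmod z)\<^sup>2 \<le> r\<^sup>2" by (intro power_mono) auto
        then have "of_real (max 0 (r\<^sup>2 - (cmod z)\<^sup>2)) = complex_of_real (r\<^sup>2) - z * cnj z"
          using zz by (simp only: max_absorb2 diff_ge_0_iff_ge of_real_diff)
        then have E: "of_real (max 0 (r\<^sup>2 - (cmod z)\<^sup>2)) * (z ^ n * cnj z ^ n) = (complex_of_real (r\<^sup>2) - z * cnj z) * (z ^ n * cnj z ^ n)"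
          by (simp only:)
        show ?thesis unfolding E using True by (simp add: algebra_simps)
      next
        case False
        then have "r\<^sup>2 \<le> (cmod z)\<^sup>2" using r by (intro power_mono) auto
        then show ?thesis using False by simp
      qed
    qed simp
    also have "\<dots> = (LINT z|lborel. indicator (ball 0 r) z * (complex_of_real (r\<^sup>2) * (z ^ n * cnj z ^ n))) - disc_moment r (Suc n) (Suc n)"
      unfolding disc_moment_def by (rule Bochner_Integration.integral_diff; rule integrable_indicator_ball_mult[OF c(1)] integrable_indicator_ball_mult[OF c(2)])
    also have "(LINT z|lborel. indicator (ball 0 r) z * (complex_of_real (r\<^sup>2) * (z ^ n * cnj z ^ n))) = of_real (r\<^sup>2) * disc_moment r n n"
      unfolding disc_moment_def by (subst integral_mult_right_zero[symmetric]) (rule Bochner_Integration.integral_cong, auto)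
    finally show ?thesis .
  qed
  have "disc_moment r (Suc n) (Suc n) = of_nat (Suc n) * tent_moment r n n"
    using moment_recursion(1)[OF r, of "Suc n" n] by simp
  then have "of_nat (Suc (Suc n)) * disc_moment r (Suc n) (Suc n) = of_nat (Suc n) * (of_real (r\<^sup>2) * disc_moment r n n)"
    unfolding t by (simp add: algebra_simps)
  also have "\<dots> = of_real (real (Suc n) * (r\<^sup>2 * (pi * r ^ (2 * n + 2) / (n + 1))))"
    unfolding Suc.IH by (simp only: of_real_mult of_real_of_nat_eq)
  also have "real (Suc n) * (r\<^sup>2 * (pi * r ^ (2 * n + 2) / (n + 1))) = pi * r ^ (2 * Suc n + 2)"
    by (simp add: power2_eq_square)
  finally have "of_nat (Suc (Suc n)) * disc_moment r (Suc n) (Suc n) = of_real (pi * r ^ (2 * Suc n + 2))" .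
  then have "disc_moment r (Suc n) (Suc n) = of_real (pi * r ^ (2 * Suc n + 2)) / of_nat (Suc (Suc n))"
    by (metis nonzero_mult_div_cancel_left of_nat_eq_0_iff nat.distinct(1))
  then show ?case by simp
qed

lemma area_partial_sum:
  assumes r: "r > 0"
  shows "(LINT z|lborel. indicator (ball 0 r) z * (cmod (\<Sum>n<N. b n * z ^ n))\<^sup>2) = (\<Sum>n<N. pi * (cmod (b n))\<^sup>2 * r ^ (2 * n + 2) / (n + 1))"
proof -
  have I: "integrable lborel (\<lambda>z. indicator (ball 0 r) z * (z ^ m * cnj z ^ n))" for m n
    by (intro integrable_indicator_ball_mult continuous_intros)
  have "complex_of_real (LINT z|lborel. indicator (ball 0 r) z * (cmod (\<Sum>n<N. b n * z ^ n))\<^sup>2)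
     = (LINT z|lborel. complex_of_real (indicator (ball 0 r) z * (cmod (\<Sum>n<N. b n * z ^ n))\<^sup>2))"
    by (rule integral_complex_of_real[symmetric])
  also have "\<dots> = (LINT z|lborel. (\<Sum>m<N. \<Sum>n<N. b m * cnj (b n) * (indicator (ball 0 r) z * (z ^ m * cnj z ^ n))))"
  proof (rule Bochner_Integration.integral_cong)
    fix z :: complex
    have "complex_of_real ((cmod (\<Sum>n<N. b n * z ^ n))\<^sup>2) = (\<Sum>m<N. b m * z ^ m) * (\<Sum>n<N. cnj (b n) * cnj z ^ n)"
      unfolding complex_norm_square by simp
    also have "\<dots> = (\<Sum>m<N. \<Sum>n<N. b m * cnj (b n) * (z ^ m * cnj z ^ n))"
      unfolding sum_product by (intro sum.cong refl) (simp add: algebra_simps)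
    finally show "complex_of_real (indicator (ball 0 r) z * (cmod (\<Sum>n<N. b n * z ^ n))\<^sup>2) = (\<Sum>m<N. \<Sum>n<N. b m * cnj (b n) * (indicator (ball 0 r) z * (z ^ m * cnj z ^ n)))"
      by (cases "z \<in> ball 0 r") simp_all
  qed simp
  also have "\<dots> = (\<Sum>m<N. \<Sum>n<N. b m * cnj (b n) * disc_moment r m n)"
    unfolding disc_moment_def using I by (simp add: Bochner_Integration.integral_sum)
  also have "\<dots> = (\<Sum>m<N. b m * cnj (b m) * disc_moment r m m)"
  proof (rule sum.cong[OF refl])
    fix m assume m: "m \<in> {..<N}"
    have "(\<Sum>n<N. b m * cnj (b n) * disc_moment r m n) = (\<Sum>n<N. if n = m then b m * cnj (b m) * disc_moment r m m else 0)"
      by (intro sum.cong refl) (auto simp: disc_moment_orthogonal[OF r])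
    then show "(\<Sum>n<N. b m * cnj (b n) * disc_moment r m n) = b m * cnj (b m) * disc_moment r m m"
      using m by simp
  qed
  also have "\<dots> = of_real (\<Sum>n<N. pi * (cmod (b n))\<^sup>2 * r ^ (2 * n + 2) / (n + 1))"
    unfolding of_real_sum
  proof (rule sum.cong[OF refl])
    fix m
    have "b m * cnj (b m) * disc_moment r m m = complex_of_real ((cmod (b m))\<^sup>2) * complex_of_real (pi * r ^ (2 * m + 2) / (m + 1))"
      unfolding disc_moment_diagonal[OF r] complex_norm_square ..
    also have "\<dots> = of_real (pi * (cmod (b m))\<^sup>2 * r ^ (2 * m + 2) / (m + 1))"
      unfolding of_real_mult[symmetric] by (simp only: times_divide_eq_right mult.assoc mult.left_commute)
    finally show "b m * cnj (b m) * disc_moment r m m = of_real (pi * (cmod (b m))\<^sup>2 * r ^ (2 * m + 2) / (m + 1))" .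
  qed
  finally show ?thesis using of_real_eq_iff by blast
qed

text \<open>On a smaller disc the power series converges uniformly, so the formula for polynomials passes to the limit.\<close>

lemma area_smaller_disc:
  assumes r: "0 < r" "r < 1" and b: "\<And>z. cmod z < 1 \<Longrightarrow> summable (\<lambda>n. b n * z ^ n)"
  shows "(\<lambda>n. pi * (cmod (b n))\<^sup>2 * r ^ (2 * n + 2) / (n + 1)) sums
    (LINT z|lborel. indicator (ball 0 r) z * (cmod (\<Sum>n. b n * z ^ n))\<^sup>2)"
proof -
  obtain s where s: "r < s" "s < 1" using r dense by blast
  have sm: "summable (\<lambda>n. norm (b n * of_real r ^ n))"
    by (rule powser_insidea[OF b[of "of_real s"]]) (use s r in auto)
  define M where "M = (\<Sum>n. norm (b n * complex_of_real r ^ n))"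
  define S where "S N z = (\<Sum>n<N. b n * z ^ n)" for N z
  define f where "f z = (if cmod z < r then (\<Sum>n. b n * z ^ n) else 0)" for z
  have lim: "(\<lambda>N. S N z) \<longlonglongrightarrow> (\<Sum>n. b n * z ^ n)" if "cmod z < r" for z
    unfolding S_def using b[of z] that r by (intro summable_LIMSEQ) auto
  have SM: "cmod (S N z) \<le> M" if "cmod z < r" for N z
  proof -
    have "cmod (S N z) \<le> (\<Sum>n<N. norm (b n * of_real r ^ n))"
      unfolding S_def
    proof (rule order_trans[OF norm_sum sum_mono])
      fix n
      have "cmod z ^ n \<le> r ^ n" using that by (intro power_mono) auto
      then show "norm (b n * z ^ n) \<le> norm (b n * complex_of_real r ^ n)"
        using r by (simp add: norm_mult norm_power mult_left_mono)
    qed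
    also have "\<dots> \<le> M" unfolding M_def by (rule sum_le_suminf[OF sm]) auto
    finally show ?thesis .
  qed
  have [measurable]: "ball (0::complex) r \<in> sets borel" "(\<lambda>z. cmod (S N z)) \<in> borel_measurable borel" for N
    unfolding S_def by (auto intro!: borel_measurable_continuous_onI continuous_intros)
  have lim': "(\<lambda>N. indicator (ball 0 r) z * (cmod (S N z))\<^sup>2) \<longlonglongrightarrow> indicator (ball 0 r) z * (cmod (\<Sum>n. b n * z ^ n))\<^sup>2" for z
    using lim[of z] by (cases "cmod z < r") (auto intro!: tendsto_intros)
  have "(\<lambda>N. LINT z|lborel. indicator (ball 0 r) z * (cmod (S N z))\<^sup>2) \<longlonglongrightarrow> (LINT z|lborel. indicator (ball 0 r) z * (cmod (\<Sum>n. b n * z ^ n))\<^sup>2)"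
  proof (rule integral_dominated_convergence[where w = "\<lambda>z. M\<^sup>2 * indicator (cball 0 r) z"])
    show "integrable lborel (\<lambda>z. M\<^sup>2 * indicator (cball (0::complex) r) z)"
      by (intro integrable_mult_right integrable_indicator_cball)
    show "(\<lambda>z. indicator (ball 0 r) z * (cmod (S N z))\<^sup>2) \<in> borel_measurable lborel" for N by measurable
    show "(\<lambda>z. indicator (ball 0 r) z * (cmod (\<Sum>n. b n * z ^ n))\<^sup>2) \<in> borel_measurable lborel"
      by (rule borel_measurable_LIMSEQ_real[OF lim']) measurable
    show "AE z in lborel. (\<lambda>N. indicator (ball 0 r) z * (cmod (S N z))\<^sup>2) \<longlonglongrightarrow> indicator (ball 0 r) z * (cmod (\<Sum>n. b n * z ^ n))\<^sup>2"
      using lim' by simp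
    show "AE z in lborel. norm (indicator (ball 0 r) z * (cmod (S N z))\<^sup>2) \<le> M\<^sup>2 * indicator (cball 0 r) z" for N
      using SM[of _ N] by (intro AE_I2) (auto simp: indicator_def intro!: power_mono)
  qed
  then show ?thesis unfolding S_def area_partial_sum[OF r(1)] sums_def .
qed

text \<open>Let the radius tend to \<open>1\<close>: the integrals converge by dominated convergence, and the series because its terms are nonnegative and increase with
the radius.\<close>

theorem disc_area_formula:
  assumes b: "\<And>z. cmod z < 1 \<Longrightarrow> summable (\<lambda>n. b n * z ^ n)"
    and A: "integrable lborel (\<lambda>z. indicator (ball 0 1) z * (cmod (\<Sum>n. b n * z ^ n))\<^sup>2)"
  shows "(\<lambda>n. pi * (cmod (b n))\<^sup>2 / (n + 1)) sums (LINT z|lborel. indicator (ball 0 1) z * (cmod (\<Sum>n. b n * z ^ n))\<^sup>2)"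
proof -
  let ?f = "\<lambda>z. (cmod (\<Sum>n. b n * z ^ n))\<^sup>2"
  define A where "A = (LINT z|lborel. indicator (ball 0 1) z * ?f z)"
  define r where "r j = 1 - 1 / real (j + 2)" for j :: nat
  have r: "0 < r j" "r j < 1" for j by (auto simp: r_def field_simps)
  have r1: "r \<longlonglongrightarrow> 1"
  proof -
    have "(\<lambda>j. 1 / real (j + 2)) \<longlonglongrightarrow> 0" using LIMSEQ_ignore_initial_segment[OF lim_1_over_n, of 2] by simp
    from tendsto_diff[OF tendsto_const[of 1] this] show ?thesis unfolding r_def by simp
  qed
  define c where "c n = pi * (cmod (b n))\<^sup>2 / (n + 1)" for n :: nat
  have c0: "c n \<ge> 0" for n by (simp add: c_def)
  define F where "F j = (LINT z|lborel. indicator (ball 0 (r j)) z * ?f z)" for j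
  have m: "(\<lambda>z. indicator (ball 0 1) z * ?f z) \<in> borel_measurable borel" using A by auto
  have [measurable]: "ball (0::complex) s \<in> sets borel" for s by simp
  have eq: "indicator (ball 0 (r j)) z * ?f z = indicator (ball 0 (r j)) z * (indicator (ball 0 1) z * ?f z)" for j z
    using r(2)[of j] by (auto simp: indicator_def)
  have Im: "(\<lambda>z. indicator (ball 0 (r j)) z * ?f z) \<in> borel_measurable borel" for j
    unfolding eq by (intro borel_measurable_times borel_measurable_indicator m) simp
  have le: "indicator (ball 0 (r j)) z * ?f z \<le> indicator (ball 0 1) z * ?f z" for j z
    using r(2)[of j] by (auto simp: indicator_def)
  have FA: "F j \<le> A" for j
    unfolding F_def A_def by (rule integral_mono_AE'[OF A]) (use le in auto)
  have Fl: "F \<longlonglongrightarrow> A"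
    unfolding F_def A_def
  proof (rule integral_dominated_convergence[where w = "\<lambda>z. indicator (ball 0 1) z * ?f z"])
    show "AE z in lborel. (\<lambda>j. indicator (ball 0 (r j)) z * ?f z) \<longlonglongrightarrow> indicator (ball 0 1) z * ?f z"
    proof (rule AE_I2)
      fix z :: complex
      show "(\<lambda>j. indicator (ball 0 (r j)) z * ?f z) \<longlonglongrightarrow> indicator (ball 0 1) z * ?f z"
      proof (cases "cmod z < 1")
        case True
        then have "\<forall>\<^sub>F j in sequentially. cmod z < r j" using r1 by (intro order_tendstoD(1))
        then have "\<forall>\<^sub>F j in sequentially. indicator (ball 0 (r j)) z * ?f z = indicator (ball 0 1) z * ?f z"
          by eventually_elim (use True in simp)
        then show ?thesis by (rule tendsto_eventually)
      next
        case False
        then have "z \<notin> ball 0 (r j)" for j using r(2)[of j] by auto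
        then show ?thesis using False by simp
      qed
    qed
    show "AE z in lborel. norm (indicator (ball 0 (r j)) z * ?f z) \<le> indicator (ball 0 1) z * ?f z" for j
      using le by (intro AE_I2) simp
  qed (use A m Im in auto)
  have S: "(\<lambda>n. c n * r j ^ (2 * n + 2)) sums F j" for j
    using area_smaller_disc[OF r b, of j] by (simp add: c_def F_def field_simps)
  have part: "(\<Sum>n<N. c n) \<le> A" for N
  proof (rule LIMSEQ_le_const2)
    have "(\<lambda>j. \<Sum>n<N. c n * r j ^ (2 * n + 2)) \<longlonglongrightarrow> (\<Sum>n<N. c n * 1 ^ (2 * n + 2))"
      by (intro tendsto_intros r1)
    then show "(\<lambda>j. \<Sum>n<N. c n * r j ^ (2 * n + 2)) \<longlonglongrightarrow> (\<Sum>n<N. c n)" by simp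
    have "(\<Sum>n<N. c n * r j ^ (2 * n + 2)) \<le> F j" for j
      using sum_le_suminf[OF sums_summable[OF S[of j]], of "{..<N}"] sums_unique[OF S[of j]] c0 r[of j]
      by (auto simp: less_imp_le)
    then show "\<exists>M. \<forall>j\<ge>M. (\<Sum>n<N. c n * r j ^ (2 * n + 2)) \<le> A" using FA order_trans by blast
  qed
  have sc: "summable c"
    by (rule bounded_imp_summable[where B = A]) (use c0 part[of "Suc _"] in \<open>auto simp: lessThan_Suc_atMost\<close>)
  have "suminf c \<le> A" by (rule suminf_le_const[OF sc part])
  moreover have "A \<le> suminf c"
  proof (rule LIMSEQ_le_const2[OF Fl])
    have "F j \<le> suminf c" for j
      unfolding sums_unique[OF S[of j]]
    proof (rule suminf_le[OF _ sums_summable[OF S[of j]] sc])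
      fix n show "c n * r j ^ (2 * n + 2) \<le> c n"
        using c0[of n] r[of j] by (intro mult_left_le power_le_one) (auto simp: less_imp_le)
    qed
    then show "\<exists>N. \<forall>n\<ge>N. F n \<le> suminf c" by blast
  qed
  ultimately have "suminf c = A" by simp
  then have "c sums A" using sc by (simp add: sums_iff)
  then show ?thesis by (simp add: c_def[abs_def] A_def)
qed

section \<open>From quasiconformal extensions to weak derivatives\<close>

text \<open>Quasiconformality speaks of Lebesgue measurable derivatives on an open set, the analysis above of Borel functions on the
plane.  This and the next two lemmas mediate between them.\<close>

lemma borel_representative:
  fixes h :: "complex \<Rightarrow> complex"
  assumes "set_borel_measurable lebesgue U h"
  obtains h' where "h' \<in> borel_measurable borel" "AE z in lborel. indicator U z *\<^sub>R h z = h' z"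
proof -
  have m: "(\<lambda>z. indicator U z *\<^sub>R h z) \<in> borel_measurable lebesgue"
    using assms by (simp add: set_borel_measurable_def)
  have re: "(\<lambda>z. Re (indicator U z *\<^sub>R h z)) \<in> borel_measurable lebesgue"
    and im: "(\<lambda>z. Im (indicator U z *\<^sub>R h z)) \<in> borel_measurable lebesgue"
    using borel_measurable_complex_iff[THEN iffD1, OF m] by auto
  obtain a where a: "a \<in> borel_measurable lborel" "AE z in lborel. Re (indicator U z *\<^sub>R h z) = a z"
    using completion_ex_borel_measurable_real[OF re] by blast
  obtain b where b: "b \<in> borel_measurable lborel" "AE z in lborel. Im (indicator U z *\<^sub>R h z) = b z"
    using completion_ex_borel_measurable_real[OF im] by blast
  have [measurable]: "a \<in> borel_measurable borel" "b \<in> borel_measurable borel" using a b by auto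
  show ?thesis
  proof (rule that[of "\<lambda>z. Complex (a z) (b z)"])
    have "(\<lambda>z. complex_of_real (a z) + \<i> * complex_of_real (b z)) \<in> borel_measurable borel" by measurable
    then show "(\<lambda>z. Complex (a z) (b z)) \<in> borel_measurable borel" by (simp add: complex_eq_iff Complex_eq)
    show "AE z in lborel. indicator U z *\<^sub>R h z = Complex (a z) (b z)"
      using a(2) b(2) by eventually_elim (simp add: complex_eq_iff)
  qed
qed

lemma set_integral_borel_representative:
  fixes h :: "complex \<Rightarrow> complex"
  assumes h: "set_borel_measurable lebesgue U h" and h': "h' \<in> borel_measurable borel" "AE z in lborel. indicator U z *\<^sub>R h z = h' z"
    and \<psi>: "\<psi> \<in> test_functions UNIV"
  shows "(LINT z:U|lebesgue. h z * \<psi> z) = (LINT z|lborel. h' z * \<psi> z)"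
proof -
  have [measurable]: "\<psi> \<in> borel_measurable borel" "h' \<in> borel_measurable borel"
    using h' by (auto intro: borel_measurable_continuous_onI test_function_continuous[OF \<psi>])
  have m: "(\<lambda>z. indicator U z *\<^sub>R h z) \<in> borel_measurable lebesgue"
    using h by (simp add: set_borel_measurable_def)
  have \<psi>m: "\<psi> \<in> borel_measurable lebesgue" by (rule measurable_completion) simp
  have m2: "(\<lambda>z. h' z * \<psi> z) \<in> borel_measurable lborel" by measurable
  have "(LINT z:U|lebesgue. h z * \<psi> z) = (LINT z|lebesgue. (indicator U z *\<^sub>R h z) * \<psi> z)"
    unfolding set_lebesgue_integral_def by (rule Bochner_Integration.integral_cong) auto
  also have "\<dots> = (LINT z|lebesgue. h' z * \<psi> z)"
  proof (rule integral_cong_AE)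
    show "(\<lambda>z. (indicator U z *\<^sub>R h z) * \<psi> z) \<in> borel_measurable lebesgue" by (rule borel_measurable_times[OF m \<psi>m])
    show "(\<lambda>z. h' z * \<psi> z) \<in> borel_measurable lebesgue" by (rule measurable_completion[OF m2])
    have "AE z in lebesgue. indicator U z *\<^sub>R h z = h' z" using h'(2) by (rule AE_completion)
    then show "AE z in lebesgue. (indicator U z *\<^sub>R h z) * \<psi> z = h' z * \<psi> z" by eventually_elim simp
  qed
  also have "\<dots> = (LINT z|lborel. h' z * \<psi> z)" by (rule integral_completion[OF m2])
  finally show ?thesis .
qed

lemma set_integral_continuous_test:
  assumes U: "open U" and G: "continuous_on U G" and \<psi>: "\<psi> \<in> test_functions U"
  shows "(LINT z:U|lebesgue. G z * \<psi> z) = (LINT z|lborel. G z * \<psi> z)"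
    "integrable lborel (\<lambda>z. G z * \<psi> z)"
proof -
  note T = test_functionsD[OF \<psi>]
  from T(2) obtain K where K: "compact K" "K \<subseteq> U" "\<And>z. z \<notin> K \<Longrightarrow> \<psi> z = 0" by metis
  have "continuous_on K (\<lambda>z. G z * \<psi> z)"
    using continuous_on_subset[OF G K(2)] smooth_continuous[OF T(1)] by (intro continuous_intros) auto
  from borel_integrable_compact[OF K(1) this]
  have "integrable lborel (\<lambda>z. indicator K z *\<^sub>R (G z * \<psi> z))" .
  also have "(\<lambda>z. indicator K z *\<^sub>R (G z * \<psi> z)) = (\<lambda>z. G z * \<psi> z)"
    using K(3) by (auto simp: fun_eq_iff indicator_def)
  finally show I: "integrable lborel (\<lambda>z. G z * \<psi> z)" .
  have "indicator U z *\<^sub>R (G z * \<psi> z) = G z * \<psi> z" for z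
    using K by (cases "z \<in> K") (auto simp: indicator_def)
  then show "(LINT z:U|lebesgue. G z * \<psi> z) = (LINT z|lborel. G z * \<psi> z)"
    unfolding set_lebesgue_integral_def using integral_completion[of "\<lambda>z. G z * \<psi> z" lborel] I by simp
qed

lemma test_functions_mono: "U \<subseteq> V \<Longrightarrow> test_functions U \<subseteq> test_functions V"
  by (auto simp: test_functions_def)

text \<open>The function \<open>c\<close> may be unbounded near the boundary of \<open>V\<close>, so \<open>fundamental_lemma\<close> is applied on discs whose closure lies in \<open>V\<close>, with \<open>c\<close>
truncated outside the disc.  Countably many such discs cover \<open>V\<close>.\<close>

theorem weak_equals_continuous:
  assumes v: "loc_L2 v" and V: "open V" and c: "continuous_on V c"
    and eq: "\<And>\<phi>. \<phi> \<in> test_functions V \<Longrightarrow> (LINT z|lborel. v z * \<phi> z) = (LINT z|lborel. c z * \<phi> z)"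
  shows "AE z in lborel. z \<in> V \<longrightarrow> v z = c z"
proof -
  have loc: "AE z in lborel. z \<in> ball x r \<longrightarrow> v z = c z" if xr: "cball x r \<subseteq> V" for x r
  proof -
    have [measurable]: "ball x r \<in> sets borel" by simp
    have bV: "ball x r \<subseteq> V" using xr ball_subset_cball by blast
    have cc: "continuous_on (cball x r) c" by (rule continuous_on_subset[OF c xr])
    then have "compact (c ` cball x r)" by (intro compact_continuous_image) auto
    then obtain B where B: "\<And>z. z \<in> cball x r \<Longrightarrow> cmod (c z) \<le> B"
      using compact_imp_bounded by (fastforce simp: bounded_iff)
    let ?s = "\<lambda>z. indicator (ball x r) z *\<^sub>R c z"
    have "?s \<in> borel_measurable borel"
      by (rule borel_measurable_continuous_on_indicator[OF _ continuous_on_subset[OF c bV]]) simp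
    moreover have "cmod (?s z) \<le> max 0 B" for z
      using B[of z] by (auto simp: indicator_def)
    ultimately have sL: "loc_L2 ?s" by (rule loc_L2_bounded)
    have "AE z in lborel. z \<in> ball x r \<longrightarrow> v z - ?s z = 0"
    proof (rule fundamental_lemma[OF loc_L2_diff[OF v sL] open_ball])
      fix \<phi> assume \<phi>: "\<phi> \<in> test_functions (ball x r)"
      have \<phi>': "\<phi> \<in> test_functions UNIV" "\<phi> \<in> test_functions V"
        by (rule subsetD[OF test_functions_mono[OF subset_UNIV] \<phi>], rule subsetD[OF test_functions_mono[OF bV] \<phi>])
      obtain K where K: "K \<subseteq> ball x r" "\<And>z. z \<notin> K \<Longrightarrow> \<phi> z = 0" using test_functionsD(2)[OF \<phi>] by metis
      have e: "?s z * \<phi> z = c z * \<phi> z" for z using K by (cases "z \<in> K") auto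
      have "(LINT z|lborel. (v z - ?s z) * \<phi> z) = (LINT z|lborel. v z * \<phi> z) - (LINT z|lborel. ?s z * \<phi> z)"
        using integrable_test[OF loc_L2_imp_loc_int[OF v] \<phi>'(1)] integrable_test[OF loc_L2_imp_loc_int[OF sL] \<phi>'(1)]
        by (simp add: left_diff_distrib)
      then show "(LINT z|lborel. (v z - ?s z) * \<phi> z) = 0" unfolding e eq[OF \<phi>'(2)] by simp
    qed
    then show ?thesis by eventually_elim (auto simp: indicator_def)
  qed
  obtain F where F: "F \<subseteq> {(x, r). cball x r \<subseteq> V}" "countable F" "(\<Union>(x, r)\<in>F. ball x r) = V"
  proof -
    let ?C = "(\<lambda>(x, r). ball x r) ` {(x, r). cball x r \<subseteq> V}"
    have U: "\<Union>?C = V"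
    proof
      show "\<Union>?C \<subseteq> V" using ball_subset_cball by fastforce
      show "V \<subseteq> \<Union>?C"
      proof
        fix x assume "x \<in> V"
        then obtain r where "r > 0" "cball x r \<subseteq> V" using V open_contains_cball by blast
        then show "x \<in> \<Union>?C" by (intro UnionI[of "ball x r"] image_eqI[of _ _ "(x, r)"]) auto
      qed
    qed
    obtain F' where F': "F' \<subseteq> ?C" "countable F'" "\<Union>F' = \<Union>?C" by (rule Lindelof[of ?C]) auto
    obtain F where "countable F" "F \<subseteq> {(x, r). cball x r \<subseteq> V}" "F' = (\<lambda>(x, r). ball x r) ` F"
      using F'(1,2) by (meson countable_subset_image)
    then show ?thesis using F'(3) U by (intro that[of F]) auto
  qed
  have "AE z in lborel. \<forall>q\<in>F. z \<in> ball (fst q) (snd q) \<longrightarrow> v z = c z"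
  proof (rule AE_ball_countable'[OF _ F(2)])
    fix q assume "q \<in> F"
    then have "q \<in> {(x, r). cball x r \<subseteq> V}" using F(1) by blast
    then have "cball (fst q) (snd q) \<subseteq> V" by (simp add: case_prod_beta)
    then show "AE z in lborel. z \<in> ball (fst q) (snd q) \<longrightarrow> v z = c z" by (rule loc)
  qed
  then show ?thesis
  proof eventually_elim
    case (elim z)
    show ?case
    proof
      assume "z \<in> V"
      then obtain q where "q \<in> F" "z \<in> ball (fst q) (snd q)" using F(3) by force
      then show "v z = c z" using elim by blast
    qed
  qed
qed

text \<open>A homeomorphism of the sphere enters the analysis as a function on the punctured plane: continuous, and bounded near infinity because
infinity is mapped to a finite point.\<close>

lemma continuous_finite_part:
  assumes F: "homeomorphic_map ext_plane ext_plane F" and p: "F (Some p) = None"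
  shows "continuous_on (- {p}) (\<lambda>z. the (F (Some z)))" "\<And>z. F (Some z) = None \<longleftrightarrow> z = p" "F None \<noteq> None"
    "\<exists>R M. \<forall>z. R < cmod z \<longrightarrow> cmod (the (F (Some z))) \<le> M"
proof -
  have inj: "inj_on F UNIV"
    using homeomorphic_imp_injective_map[OF F] by (simp add: UNIV_option_conv)
  have FN: "F (Some z) = None \<longleftrightarrow> z = p" for z
    using inj p by (metis UNIV_I inj_onD option.inject)
  then show "F (Some z) = None \<longleftrightarrow> z = p" for z .
  show FN': "F None \<noteq> None" using inj p by (metis UNIV_I inj_onD option.distinct(1))
  have cm: "continuous_map ext_plane ext_plane F" by (rule homeomorphic_imp_continuous_map[OF F])
  have pre: "openin ext_plane {x. F x \<in> Some ` W}" if "open W" for W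
  proof -
    have "openin ext_plane (Some ` W)" using that by simp
    from openin_continuous_map_preimage[OF cm this]
    have "openin ext_plane {x \<in> topspace ext_plane. F x \<in> Some ` W}" .
    moreover have "topspace ext_plane = UNIV" by (simp add: UNIV_option_conv)
    ultimately show ?thesis by (simp only: UNIV_I simp_thms)
  qed
  show "continuous_on (- {p}) (\<lambda>z. the (F (Some z)))"
    unfolding continuous_on_open_vimage[OF open_Compl[OF closed_singleton]]
  proof (intro allI impI)
    fix W :: "complex set" assume W: "open W"
    have cS: "continuous_map euclidean ext_plane Some" by (rule continuous_map_Some)
    have "openin euclidean {z \<in> topspace euclidean. Some z \<in> {x. F x \<in> Some ` W}}"
      by (rule openin_continuous_map_preimage[OF cS pre[OF W]])
    then have "open {z. F (Some z) \<in> Some ` W}" by simp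
    also have "{z. F (Some z) \<in> Some ` W} = (\<lambda>z. the (F (Some z))) -` W \<inter> - {p}"
    proof (intro set_eqI iffI)
      fix z assume "z \<in> (\<lambda>z. the (F (Some z))) -` W \<inter> - {p}"
      then have "the (F (Some z)) \<in> W" "F (Some z) \<noteq> None" using FN by auto
      then show "z \<in> {z. F (Some z) \<in> Some ` W}" by (metis imageI mem_Collect_eq option.collapse)
    qed (use p in auto)
    finally show "open ((\<lambda>z. the (F (Some z))) -` W \<inter> - {p})" .
  qed
  obtain c where c: "F None = Some c" using FN' by auto
  have o: "openin ext_plane {x. F x \<in> Some ` ball c 1}" by (rule pre) simp
  have "None \<in> {x. F x \<in> Some ` ball c 1}" using c by simp
  then obtain C where C: "compact C" "{x. F x \<in> Some ` ball c 1} = insert None (Some ` (UNIV - C))"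
    using o unfolding openin_Alexandroff_compactification by auto
  obtain R where R: "\<forall>x\<in>C. cmod x \<le> R" using compact_imp_bounded[OF C(1)] by (auto simp: bounded_iff)
  show "\<exists>R M. \<forall>z. R < cmod z \<longrightarrow> cmod (the (F (Some z))) \<le> M"
  proof (intro exI allI impI)
    fix z assume "R < cmod z"
    then have "z \<notin> C" using R by auto
    then have "Some z \<in> {x. F x \<in> Some ` ball c 1}" unfolding C(2) by simp
    then obtain v where v: "F (Some z) = Some v" "v \<in> ball c 1" by auto
    then have "cmod v \<le> cmod c + 1" using norm_triangle_ineq2[of v c] by (simp add: dist_norm norm_minus_commute)
    then show "cmod (the (F (Some z))) \<le> cmod c + 1" using v by simp
  qed
qed

text \<open>Off the pole, the derivatives of \<open>g\<close> are those of \<open>F\<close> minus those of the pole term; near the pole \<open>g\<close> is a power series.  A smooth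
partition into a neighbourhood of the pole inside the disc and its complement glues the two descriptions to weak derivatives on the whole plane.\<close>

theorem qc_reduction:
  assumes p: "0 \<le> p" "p < 1" and qc: "quasiconformal k F"
    and ex: "has_Sigma_expansion f p a" and ext: "\<And>z. z \<in> unit_disc \<Longrightarrow> F (Some z) = f z"
  obtains g h w M where "weak_derivs g h w" "\<And>z. cmod (g z) \<le> M"
    "\<And>z. cmod z < 1 \<Longrightarrow> g z = (\<Sum>n. a n * z ^ n)"
    "AE z in lborel. cmod z < 1 \<longrightarrow> w z = 0 \<and> h z = (\<Sum>n. diffs a n * z ^ n)"
    "AE z in lborel. 1 \<le> cmod z \<longrightarrow> cmod (w z) \<le> k * cmod (h z - 1 / (z - of_real p)\<^sup>2)"
proof -
  let ?p = "complex_of_real p"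
  have pD: "?p \<in> unit_disc" using p by simp
  have Fp: "F (Some ?p) = None" using ex ext[OF pD] pD by (auto simp: has_Sigma_expansion_def)
  have hom: "homeomorphic_map ext_plane ext_plane F" using qc by (simp add: quasiconformal_def)
  note CF = continuous_finite_part[OF hom Fp]
  define G where "G z = the (F (Some z))" for z
  define U where "U = - {?p}"
  have U: "open U" "{z. F (Some z) \<noteq> None} = U" using CF(2) by (auto simp: U_def)
  have Gc: "continuous_on U G" unfolding G_def[abs_def] U_def by (rule CF(1))
  obtain h1 h2 where h12: "locally_L2_on U h1" "locally_L2_on U h2" "distr_d_z_on U G h1" "distr_d_zbar_on U G h2"
    "AE z in lebesgue. z \<in> U \<longrightarrow> cmod (h2 z) \<le> k * cmod (h1 z)"
    using qc unfolding quasiconformal_def Let_def U(2) G_def[abs_def, symmetric] by blast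
  define S where "S z = (\<Sum>n. a n * z ^ n)" for z
  define S' where "S' z = (\<Sum>n. diffs a n * z ^ n)" for z
  have sm: "summable (\<lambda>n. a n * z ^ n)" if "cmod z < 1" for z
    using ex that by (auto simp: has_Sigma_expansion_def)
  have Sd: "(S has_field_derivative S' z) (at z)" if "cmod z < 1" for z
    unfolding S_def[abs_def] S'_def by (rule termdiffs_strong'[OF sm that])
  have Sc: "continuous_on unit_disc S"
    by (intro continuous_at_imp_continuous_on ballI DERIV_isCont[OF Sd]) auto
  have S'c: "continuous_on unit_disc S'"
  proof (intro continuous_at_imp_continuous_on ballI)
    fix z :: complex assume "z \<in> unit_disc"
    then have "(S' has_field_derivative (\<Sum>n. diffs (diffs a) n * z ^ n)) (at z)"
      unfolding S'_def[abs_def] by (intro termdiffs_strong'[where K = 1] termdiff_converges[OF _ sm]) auto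
    then show "isCont S' z" by (rule DERIV_isCont)
  qed
  have GS: "G z = 1 / (z - ?p) + S z" if "cmod z < 1" "z \<noteq> ?p" for z
    using ex ext[of z] that by (auto simp: has_Sigma_expansion_def G_def S_def)
  define g where "g z = (if cmod z < 1 then S z else G z - 1 / (z - ?p))" for z
  have gU: "g z = G z - 1 / (z - ?p)" if "z \<in> U" for z
    using GS[of z] that by (auto simp: g_def U_def)
  have gD: "g z = S z" if "cmod z < 1" for z using that by (simp add: g_def)
  have gc: "continuous_on UNIV g"
  proof -
    have "continuous_on unit_disc g" using Sc by (rule continuous_on_eq) (simp add: gD)
    moreover have "continuous_on U g"
    proof (rule continuous_on_eq)
      show "continuous_on U (\<lambda>z. G z - 1 / (z - ?p))" by (intro continuous_intros Gc) (auto simp: U_def)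
    qed (simp add: gU)
    ultimately have "continuous_on (unit_disc \<union> U) g" using U(1) by (intro continuous_on_open_Un) auto
    moreover have "unit_disc \<union> U = UNIV" using pD by (auto simp: U_def)
    ultimately show ?thesis by simp
  qed
  have "\<exists>M. \<forall>z. cmod (g z) \<le> M"
  proof -
    obtain R M where RM: "\<And>z. R < cmod z \<Longrightarrow> cmod (G z) \<le> M" using CF(4) by (auto simp: G_def)
    have "compact (g ` cball 0 (max R 1))" using gc by (intro compact_continuous_image) (auto intro: continuous_on_subset)
    then obtain B where B: "\<And>z. z \<in> cball 0 (max R 1) \<Longrightarrow> cmod (g z) \<le> B"
      using compact_imp_bounded by (fastforce simp: bounded_iff)
    have "cmod (g z) \<le> max B (M + 1 / (1 - p))" for z
    proof (cases "cmod z \<le> max R 1")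
      case False
      then have z: "R < cmod z" "1 \<le> cmod z" "\<not> cmod z < 1" by auto
      have "cmod (1 / (z - ?p)) \<le> 1 / (1 - p)"
        using denominator_bounds(2)[OF p z(2)] p by (auto simp: norm_divide intro!: frac_le)
      then have "cmod (g z) \<le> M + 1 / (1 - p)"
        unfolding g_def using z RM[OF z(1)] by (auto intro: order_trans[OF norm_triangle_ineq4] add_mono)
      then show ?thesis by simp
    qed (use B[of z] in simp)
    then show ?thesis by blast
  qed
  then obtain M where M: "\<And>z. cmod (g z) \<le> M" by blast
  have h1m: "set_borel_measurable lebesgue U h1" and h2m: "set_borel_measurable lebesgue U h2"
    using h12 by (auto simp: locally_L2_on_def)
  obtain k1 where k1: "k1 \<in> borel_measurable borel" "AE z in lborel. indicator U z *\<^sub>R h1 z = k1 z"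
    by (rule borel_representative[OF h1m])
  obtain k2 where k2: "k2 \<in> borel_measurable borel" "AE z in lborel. indicator U z *\<^sub>R h2 z = k2 z"
    by (rule borel_representative[OF h2m])
  note [measurable] = k1(1) k2(1)
  \<comment> \<open>The disc of radius \<open>2 * \<rho>\<close> around the pole is still inside the unit disc.\<close>
  define \<rho> where "\<rho> = (1 - p) / 3"
  have \<rho>: "0 < \<rho>" "\<rho> < 2 * \<rho>" using p by (auto simp: \<rho>_def)
  from smooth_plateau[OF \<rho>, of ?p]
  obtain \<theta> :: "complex \<Rightarrow> real" where \<theta>: "smooth (\<lambda>z. complex_of_real (\<theta> z))" "\<And>z. 0 \<le> \<theta> z" "\<And>z. \<theta> z \<le> 1"
    "\<And>z. dist ?p z \<le> \<rho> \<Longrightarrow> \<theta> z = 1" "\<And>z. 2 * \<rho> \<le> dist ?p z \<Longrightarrow> \<theta> z = 0" by auto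
  have sub: "cball ?p (2 * \<rho>) \<subseteq> unit_disc"
  proof
    fix z assume "z \<in> cball ?p (2 * \<rho>)"
    then have "cmod z \<le> p + 2 * \<rho>" using norm_triangle_ineq2[of z ?p] p by (simp add: dist_norm norm_minus_commute)
    also have "\<dots> < 1" using p by (simp add: \<rho>_def field_simps)
    finally show "z \<in> unit_disc" by simp
  qed
  have \<theta>E: "\<theta> z = 0" if "\<not> cmod z < 1" for z
  proof (rule \<theta>(5))
    have "z \<notin> cball ?p (2 * \<rho>)" using sub that by (meson mem_ball_0 subsetD)
    then show "2 * \<rho> \<le> dist ?p z" by simp
  qed
  let ?X = "\<lambda>z. complex_of_real (\<theta> z)"
  have \<theta>T: "?X \<in> test_functions unit_disc"
    by (rule test_functionsI[OF \<theta>(1) compact_cball sub]) (use \<theta>(5) in auto)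
  define Y where "Y z = 1 - ?X z" for z
  have Ysm: "smooth Y"
    using smooth_add[OF smooth_const[of 1] smooth_mult[OF smooth_const[of "-1"] \<theta>(1)]] by (simp add: Y_def[abs_def])
  have Yb: "cmod (Y z) \<le> 1" for z
  proof -
    have "Y z = of_real (1 - \<theta> z)" by (simp add: Y_def)
    then show ?thesis using \<theta>(2,3)[of z] by (simp only: norm_of_real)
  qed
  have Y0: "Y z = 0" if "dist ?p z \<le> \<rho>" for z using \<theta>(4)[OF that] by (simp add: Y_def)
  have YT: "(\<lambda>z. Y z * \<phi> z) \<in> test_functions U" if \<phi>: "\<phi> \<in> test_functions UNIV" for \<phi>
  proof -
    note T = test_functionsD[OF \<phi>]
    from T(2) obtain K where K: "compact K" "\<And>z. z \<notin> K \<Longrightarrow> \<phi> z = 0" by metis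
    show ?thesis
    proof (rule test_functionsI[where K = "K - ball ?p \<rho>"])
      show "smooth (\<lambda>z. Y z * \<phi> z)" by (rule smooth_mult[OF Ysm T(1)])
      show "compact (K - ball ?p \<rho>)" using K(1) by (simp add: compact_diff)
      show "K - ball ?p \<rho> \<subseteq> U" using \<rho> by (auto simp: U_def)
      show "Y z * \<phi> z = 0" if "z \<notin> K - ball ?p \<rho>" for z
        using that K(2) Y0 by (cases "z \<in> K") auto
    qed
  qed
  have XT: "(\<lambda>z. \<phi> z * ?X z) \<in> test_functions unit_disc" if "\<phi> \<in> test_functions UNIV" for \<phi>
    by (rule test_functions_mult[OF \<theta>T test_functionsD(1)[OF that]])
  define q where "q z = 1 / (z - ?p)\<^sup>2" for z
  define h where "h z = ?X z * S' z + (Y z * k1 z + Y z * q z)" for z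
  define w where "w z = Y z * k2 z" for z
  have Ym [measurable]: "Y \<in> borel_measurable borel" by (intro borel_measurable_continuous_onI smooth_continuous Ysm)
  have YkL: "loc_L2 (\<lambda>z. Y z * \<kappa> z)"
    if l: "locally_L2_on U H" and \<kappa>: "\<kappa> \<in> borel_measurable borel" "AE z in lborel. indicator U z *\<^sub>R H z = \<kappa> z" for H \<kappa>
    unfolding loc_L2_def
  proof (intro conjI allI)
    note [measurable] = \<kappa>(1)
    show "(\<lambda>z. Y z * \<kappa> z) \<in> borel_measurable borel" by measurable
    fix R :: real
    let ?K = "cball 0 R - ball ?p \<rho>"
    have [measurable]: "?K \<in> sets borel" by simp
    have K: "compact ?K" "?K \<subseteq> U" using \<rho> by (auto simp: compact_diff U_def)
    then have "integrable lebesgue (\<lambda>z. indicator ?K z *\<^sub>R (cmod (H z))\<^sup>2)"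
      using l by (auto simp: locally_L2_on_def set_integrable_def)
    moreover have "integrable lebesgue (\<lambda>z. indicator ?K z *\<^sub>R (cmod (H z))\<^sup>2) \<longleftrightarrow> integrable lebesgue (\<lambda>z. indicator ?K z * (cmod (\<kappa> z))\<^sup>2)"
    proof (rule integrable_cong_AE)
      show "(\<lambda>z. indicator ?K z *\<^sub>R (cmod (H z))\<^sup>2) \<in> borel_measurable lebesgue" using calculation by auto
      show "(\<lambda>z. indicator ?K z * (cmod (\<kappa> z))\<^sup>2) \<in> borel_measurable lebesgue" by (rule measurable_completion) measurable
      show "AE z in lebesgue. indicator ?K z *\<^sub>R (cmod (H z))\<^sup>2 = indicator ?K z * (cmod (\<kappa> z))\<^sup>2"
        using AE_completion[OF \<kappa>(2)] by eventually_elim (use K(2) in \<open>auto simp: indicator_def split: if_splits\<close>)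
    qed
    ultimately have "integrable lborel (\<lambda>z. indicator ?K z * (cmod (\<kappa> z))\<^sup>2)"
      using integrable_completion[of "\<lambda>z. indicator ?K z * (cmod (\<kappa> z))\<^sup>2" lborel] by simp
    then show "integrable lborel (\<lambda>z. indicator (cball 0 R) z * (cmod (Y z * \<kappa> z))\<^sup>2)"
    proof (rule Bochner_Integration.integrable_bound)
      show "AE z in lborel. norm (indicator (cball 0 R) z * (cmod (Y z * \<kappa> z))\<^sup>2) \<le> norm (indicator ?K z * (cmod (\<kappa> z))\<^sup>2)"
      proof (rule AE_I2)
        fix z
        have "(cmod (Y z * \<kappa> z))\<^sup>2 \<le> (cmod (\<kappa> z))\<^sup>2"
          using mult_right_mono[OF Yb[of z] norm_ge_zero[of "\<kappa> z"]] by (intro power_mono) (auto simp: norm_mult)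
        then show "norm (indicator (cball 0 R) z * (cmod (Y z * \<kappa> z))\<^sup>2) \<le> norm (indicator ?K z * (cmod (\<kappa> z))\<^sup>2)"
          using Y0[of z] by (auto simp: indicator_def)
      qed
    qed measurable
  qed
  have YqL: "loc_L2 (\<lambda>z. Y z * q z)"
  proof (rule loc_L2_bounded[where B = "1 / \<rho>\<^sup>2"])
    show "(\<lambda>z. Y z * q z) \<in> borel_measurable borel" unfolding q_def by measurable
    fix z
    show "cmod (Y z * q z) \<le> 1 / \<rho>\<^sup>2"
    proof (cases "dist ?p z \<le> \<rho>")
      case False
      then have "\<rho>\<^sup>2 \<le> (cmod (z - ?p))\<^sup>2" using \<rho> by (intro power_mono) (auto simp: dist_norm norm_minus_commute)
      then have "cmod (q z) \<le> 1 / \<rho>\<^sup>2" using \<rho> by (auto simp: q_def norm_divide norm_power intro!: frac_le)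
      then show ?thesis using mult_mono[OF Yb[of z], of "cmod (q z)" "1 / \<rho>\<^sup>2"] by (simp add: norm_mult)
    qed (simp add: Y0)
  qed
  have XS: "loc_L2 (\<lambda>z. ?X z * S' z)"
  proof (rule loc_L2_continuous)
    have "continuous (at z) (\<lambda>z. ?X z * S' z)" for z
    proof (cases "z \<in> unit_disc")
      case True
      then show ?thesis using S'c smooth_continuous[OF \<theta>(1), of UNIV]
        by (intro continuous_mult) (auto simp: continuous_on_eq_continuous_at)
    next
      case False
      then have z: "z \<in> - cball ?p (2 * \<rho>)" using sub by auto
      have "continuous_on (- cball ?p (2 * \<rho>)) (\<lambda>z. ?X z * S' z)"
        using \<theta>(5) by (subst continuous_on_cong[OF refl, of _ _ "\<lambda>_. 0"]) auto
      then show ?thesis using z by (simp add: continuous_on_eq_continuous_at open_Compl)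
    qed
    then show "continuous_on UNIV (\<lambda>z. ?X z * S' z)" by (simp add: continuous_on_eq_continuous_at)
  qed
  have hL: "loc_L2 h" unfolding h_def[abs_def] by (intro loc_L2_add XS YqL YkL[OF h12(1) k1])
  have wL: "loc_L2 w" unfolding w_def[abs_def] by (rule YkL[OF h12(2) k2])
  have wd: "weak_derivs g h w"
    unfolding weak_derivs_def
  proof (intro conjI ballI gc hL wL)
    fix \<phi> assume \<phi>: "\<phi> \<in> test_functions UNIV"
    let ?P = "\<lambda>z. \<phi> z * ?X z" and ?Q = "\<lambda>z. Y z * \<phi> z"
    note PT = XT[OF \<phi>] and QT = YT[OF \<phi>]
    have QT': "?Q \<in> test_functions UNIV" using QT test_functions_mono by blast
    have \<phi>PQ: "\<phi> = (\<lambda>z. ?P z + ?Q z)" by (auto simp: Y_def algebra_simps)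
    have dPQ: "frechet_derivative \<phi> (at z) = (\<lambda>d. frechet_derivative ?P (at z) d + frechet_derivative ?Q (at z) d)" for z
    proof -
      have "((\<lambda>z. ?P z + ?Q z) has_derivative (\<lambda>d. frechet_derivative ?P (at z) d + frechet_derivative ?Q (at z) d)) (at z)"
        by (intro has_derivative_add smooth_differentiable test_functionsD(1)[OF PT] test_functionsD(1)[OF QT])
      from frechet_derivative_at[OF this, symmetric] show ?thesis using \<phi>PQ by simp
    qed
    have dz: "d_z \<phi> z = d_z ?P z + d_z ?Q z" "d_zbar \<phi> z = d_zbar ?P z + d_zbar ?Q z" for z
      unfolding d_z_def d_zbar_def dPQ by (simp_all add: field_simps)
    note PT' = test_functions_d_z[OF PT] and QTd = test_functions_d_z[OF QT]
    have zP: "D z = 0" if DT: "D \<in> test_functions unit_disc" and Dz: "\<not> cmod z < 1" for D z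
    proof -
      obtain K where "K \<subseteq> unit_disc" "\<And>z. z \<notin> K \<Longrightarrow> D z = 0" using test_functionsD(2)[OF DT] by metis
      then show ?thesis using Dz by (meson mem_ball_0 subsetD)
    qed
    have zQ: "D z = 0" if DT: "D \<in> test_functions U" and Dz: "z \<notin> U" for D z
    proof -
      obtain K where "K \<subseteq> U" "\<And>z. z \<notin> K \<Longrightarrow> D z = 0" using test_functionsD(2)[OF DT] by metis
      then show ?thesis using Dz by blast
    qed
    have gP: "g z * D z = S z * D z" if "D \<in> test_functions unit_disc" for D z
      using zP[OF that, of z] by (cases "cmod z < 1") (simp_all add: gD)
    have gQ: "g z * D z = G z * D z + (- 1 / (z - ?p)) * D z" if "D \<in> test_functions U" for D z
      using zQ[OF that, of z] by (cases "z \<in> U") (simp_all add: gU algebra_simps)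
    have Sdd: "\<And>z. z \<in> unit_disc \<Longrightarrow> (S has_field_derivative S' z) (at z)" using Sd by simp
    have qd: "\<And>z. z \<in> U \<Longrightarrow> ((\<lambda>z. - 1 / (z - ?p)) has_field_derivative q z) (at z)"
      by (auto intro!: derivative_eq_intros simp: U_def q_def power2_eq_square)
    have qc': "continuous_on U q" unfolding q_def by (intro continuous_intros) (auto simp: U_def)
    have ic: "continuous_on U (\<lambda>z. - 1 / (z - ?p))" by (intro continuous_intros) (auto simp: U_def)
    have HS: "(LINT z|lborel. S' z * ?P z) = - (LINT z|lborel. S z * d_z ?P z)"
      "(LINT z|lborel. S z * d_zbar ?P z) = 0" "integrable lborel (\<lambda>z. S' z * ?P z)"
      by (rule holomorphic_by_parts[OF open_ball PT _ S'c], erule Sdd)+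
    have HQ: "(LINT z|lborel. q z * ?Q z) = - (LINT z|lborel. (- 1 / (z - ?p)) * d_z ?Q z)"
      "(LINT z|lborel. (- 1 / (z - ?p)) * d_zbar ?Q z) = 0" "integrable lborel (\<lambda>z. q z * ?Q z)"
      by (rule holomorphic_by_parts[OF U(1) QT _ qc'], erule qd)+
    have I: "integrable lborel (\<lambda>z. S' z * ?P z)" "integrable lborel (\<lambda>z. q z * ?Q z)" "integrable lborel (\<lambda>z. k1 z * ?Q z)"
      using HS(3) HQ(3) by auto (use integrable_test[OF loc_L2_imp_loc_int[OF YkL[OF h12(1) k1]] \<phi>] in \<open>simp add: algebra_simps\<close>)
    have dPQ: "(LINT z|lborel. g z * (D1 z + D2 z)) = (LINT z|lborel. S z * D1 z) + ((LINT z|lborel. G z * D2 z) + (LINT z|lborel. (- 1 / (z - ?p)) * D2 z))"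
      if "D1 \<in> test_functions unit_disc" "D2 \<in> test_functions U" for D1 D2
    proof -
      have "g z * (D1 z + D2 z) = S z * D1 z + (G z * D2 z + (- 1 / (z - ?p)) * D2 z)" for z
        unfolding distrib_left gP[OF that(1)] gQ[OF that(2)] ..
      then show ?thesis
        using set_integral_continuous_test(2)[OF open_ball Sc that(1)] set_integral_continuous_test(2)[OF U(1) Gc that(2)]
          set_integral_continuous_test(2)[OF U(1) ic that(2)] by simp
    qed
    have L1: "(LINT z|lborel. k1 z * ?Q z) = - (LINT z|lborel. G z * d_z ?Q z)"
      using bspec[OF h12(3)[unfolded distr_d_z_on_def] QT] unfolding set_integral_borel_representative[OF h1m k1 QT', symmetric]
        set_integral_continuous_test(1)[OF U(1) Gc QTd(1), symmetric] .
    have L2: "(LINT z|lborel. k2 z * ?Q z) = - (LINT z|lborel. G z * d_zbar ?Q z)"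
      using bspec[OF h12(4)[unfolded distr_d_zbar_on_def] QT] unfolding set_integral_borel_representative[OF h2m k2 QT', symmetric]
        set_integral_continuous_test(1)[OF U(1) Gc QTd(2), symmetric] .
    have "(LINT z|lborel. h z * \<phi> z) = (LINT z|lborel. S' z * ?P z + (k1 z * ?Q z + q z * ?Q z))"
      by (rule Bochner_Integration.integral_cong) (simp_all add: h_def algebra_simps)
    also have "\<dots> = (LINT z|lborel. S' z * ?P z) + ((LINT z|lborel. k1 z * ?Q z) + (LINT z|lborel. q z * ?Q z))"
      using I by simp
    also have "\<dots> = - (LINT z|lborel. g z * (d_z ?P z + d_z ?Q z))"
      unfolding dPQ[OF PT'(1) QTd(1)] HS(1) HQ(1) L1 by simp
    finally show "(LINT z|lborel. h z * \<phi> z) = - (LINT z|lborel. g z * d_z \<phi> z)" unfolding dz .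
    have "(LINT z|lborel. w z * \<phi> z) = (LINT z|lborel. k2 z * ?Q z)"
      by (rule Bochner_Integration.integral_cong) (simp_all add: w_def algebra_simps)
    also have "\<dots> = - (LINT z|lborel. g z * (d_zbar ?P z + d_zbar ?Q z))"
      unfolding dPQ[OF PT'(2) QTd(2)] HS(2) HQ(2) L2 by simp
    finally show "(LINT z|lborel. w z * \<phi> z) = - (LINT z|lborel. g z * d_zbar \<phi> z)" unfolding dz .
  qed
  have a1: "AE z in lborel. z \<in> unit_disc \<longrightarrow> w z = 0"
  proof (rule fundamental_lemma[OF wL open_ball])
    fix \<phi> assume \<phi>: "\<phi> \<in> test_functions unit_disc"
    then have \<phi>': "\<phi> \<in> test_functions UNIV" using test_functions_mono by blast
    obtain K where K: "K \<subseteq> unit_disc" "\<And>z. z \<notin> K \<Longrightarrow> d_zbar \<phi> z = 0"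
      using test_functionsD(2)[OF test_functions_d_z(2)[OF \<phi>]] by metis
    have e: "g z * d_zbar \<phi> z = S z * d_zbar \<phi> z" for z using K gD[of z] by (cases "z \<in> K") auto
    have "(LINT z|lborel. S z * d_zbar \<phi> z) = 0"
      by (rule holomorphic_by_parts(2)[OF open_ball \<phi> _ S'c]) (use Sd in simp)
    then show "(LINT z|lborel. w z * \<phi> z) = 0"
      unfolding weak_derivsD(5)[OF wd \<phi>'] by (simp only: e minus_zero)
  qed
  have a2: "AE z in lborel. z \<in> unit_disc \<longrightarrow> h z = S' z"
  proof (rule weak_equals_continuous[OF hL open_ball S'c])
    fix \<phi> assume \<phi>: "\<phi> \<in> test_functions unit_disc"
    then have \<phi>': "\<phi> \<in> test_functions UNIV" using test_functions_mono by blast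
    obtain K where K: "K \<subseteq> unit_disc" "\<And>z. z \<notin> K \<Longrightarrow> d_z \<phi> z = 0"
      using test_functionsD(2)[OF test_functions_d_z(1)[OF \<phi>]] by metis
    have e: "g z * d_z \<phi> z = S z * d_z \<phi> z" for z using K gD[of z] by (cases "z \<in> K") auto
    have "(LINT z|lborel. S' z * \<phi> z) = - (LINT z|lborel. S z * d_z \<phi> z)"
      by (rule holomorphic_by_parts(1)[OF open_ball \<phi> _ S'c]) (use Sd in simp)
    then show "(LINT z|lborel. h z * \<phi> z) = (LINT z|lborel. S' z * \<phi> z)"
      using weak_derivsD(4)[OF wd \<phi>'] by (simp only: e)
  qed
  have A: "AE z in lborel. cmod z < 1 \<longrightarrow> w z = 0 \<and> h z = S' z"
    using a1 a2 by eventually_elim simp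
  have "AE z in lborel. z \<in> U \<longrightarrow> cmod (h2 z) \<le> k * cmod (h1 z)" using h12(5) by (simp add: AE_completion_iff)
  then have E: "AE z in lborel. 1 \<le> cmod z \<longrightarrow> cmod (w z) \<le> k * cmod (h z - q z)"
    using k1(2) k2(2)
  proof eventually_elim
    case (elim z)
    show ?case
    proof
      assume z: "1 \<le> cmod z"
      then have "z \<in> U" using pD by (auto simp: U_def)
      moreover have "\<theta> z = 0" using z by (intro \<theta>E) simp
      ultimately show "cmod (w z) \<le> k * cmod (h z - q z)" using elim by (simp add: w_def h_def Y_def)
    qed
  qed
  show ?thesis
    by (rule that[OF wd M]) (use gD A E in \<open>simp_all add: S_def S'_def q_def\<close>)
qed

section \<open>The energy inequality\<close>

lemma reflected_pole_L2:
  assumes p: "0 \<le> p" "p < 1"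
  shows "integrable lborel (\<lambda>z. (cmod (reflected_pole_dz p z))\<^sup>2)"
    "integrable lborel (\<lambda>z. (cmod (reflected_pole_dzbar p z))\<^sup>2)"
proof -
  let ?b = "\<lambda>z::complex. (1 / (1 - p)\<^sup>2)\<^sup>2 * indicator (cball 0 1) z :: real"
  have b: "integrable lborel ?b" by (intro integrable_mult_right integrable_indicator_cball)
  have wd: "weak_derivs (\<lambda>z. cnj (reflected_pole p z)) (\<lambda>z. cnj (reflected_pole_dzbar p z)) (\<lambda>z. cnj (reflected_pole_dz p z))"
    by (rule weak_derivs_cnj[OF reflected_pole_weak_derivs[OF p]])
  have dom: "AE z in lborel. (cmod (cnj (reflected_pole_dz p z)))\<^sup>2 \<le> 0 * (cmod (cnj (reflected_pole_dzbar p z)))\<^sup>2 + ?b z"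
  proof (rule AE_I2)
    fix z
    show "(cmod (cnj (reflected_pole_dz p z)))\<^sup>2 \<le> 0 * (cmod (cnj (reflected_pole_dzbar p z)))\<^sup>2 + ?b z"
    proof (cases "cmod z < 1")
      case True
      have "(cmod (reflected_pole_dz p z))\<^sup>2 \<le> (1 / (1 - p)\<^sup>2)\<^sup>2"
        by (rule power_mono[OF reflected_pole_bounded(2)[OF p]]) simp
      then show ?thesis using True by simp
    qed (simp add: reflected_pole_dz_def)
  qed
  have bd: "cmod (cnj (reflected_pole p z)) \<le> 1 / (1 - p)" for z
    using reflected_pole_bounded(1)[OF p] by simp
  have "?b z \<ge> 0" for z by simp
  note E = energy_finite[OF wd bd order_refl zero_less_one b this dom]
  show "integrable lborel (\<lambda>z. (cmod (reflected_pole_dz p z))\<^sup>2)"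
    "integrable lborel (\<lambda>z. (cmod (reflected_pole_dzbar p z))\<^sup>2)" using E by simp_all
qed

lemma derivative_geometric_series:
  assumes "cmod x < 1"
  shows "(\<lambda>n. of_nat (Suc n) * x ^ n) sums (1 / (1 - x)\<^sup>2)"
  using geometric_deriv_sums[OF assms] by simp

text \<open>Inside the disc this is the area formula for the series \<open>\<Sum>n. (n + 1) * p^n * z^n\<close>; the outer integral is equal to it by the
energy identity.\<close>

lemma reflected_pole_energy:
  assumes p: "0 \<le> p" "p < 1"
  shows "(LINT z|lborel. (cmod (reflected_pole_dz p z))\<^sup>2) = pi / (1 - p\<^sup>2)\<^sup>2"
    "(LINT z|lborel. (cmod (reflected_pole_dzbar p z))\<^sup>2) = pi / (1 - p\<^sup>2)\<^sup>2"
proof -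
  define b where "b n = of_nat (Suc n) * complex_of_real p ^ n" for n
  have small: "cmod (of_real p * z) < 1" if "cmod z < 1" for z
  proof -
    have "p * cmod z \<le> 1 * cmod z" using p by (intro mult_right_mono) auto
    then show ?thesis using that p by (simp add: norm_mult)
  qed
  have bs: "(\<lambda>n. b n * z ^ n) sums (1 / (1 - of_real p * z)\<^sup>2)" if "cmod z < 1" for z
    using derivative_geometric_series[OF small[OF that]] by (simp add: b_def power_mult_distrib mult.assoc)
  have eq: "indicator (ball 0 1) z * (cmod (\<Sum>n. b n * z ^ n))\<^sup>2 = (cmod (reflected_pole_dz p z))\<^sup>2" for z
    using sums_unique[OF bs[of z], symmetric] by (simp add: reflected_pole_dz_def indicator_def)
  have "(\<lambda>n. pi * (cmod (b n))\<^sup>2 / (n + 1)) sums (LINT z|lborel. (cmod (reflected_pole_dz p z))\<^sup>2)"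
    using disc_area_formula[of b, unfolded eq, OF sums_summable[OF bs] reflected_pole_L2(1)[OF p]] by simp
  moreover have "(\<lambda>n. pi * (cmod (b n))\<^sup>2 / (n + 1)) = (\<lambda>n. pi * (real (Suc n) * (p\<^sup>2) ^ n))"
  proof
    fix n :: nat
    have "cmod (b n) = real (Suc n) * p ^ n" unfolding b_def norm_mult norm_power norm_of_nat using p by simp
    then have "(cmod (b n))\<^sup>2 = (real (Suc n))\<^sup>2 * (p\<^sup>2) ^ n"
      by (simp only: power_mult_distrib power_mult[symmetric] mult.commute)
    then show "pi * (cmod (b n))\<^sup>2 / (n + 1) = pi * (real (Suc n) * (p\<^sup>2) ^ n)"
      by (simp add: power2_eq_square)
  qed
  moreover have "(\<lambda>n. pi * (real (Suc n) * (p\<^sup>2) ^ n)) sums (pi * (1 / (1 - p\<^sup>2)\<^sup>2))"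
  proof (rule sums_mult)
    have "norm (p\<^sup>2) < 1" using p by (simp add: power_less_one_iff abs_square_less_1)
    from geometric_deriv_sums[OF this] show "(\<lambda>n. real (Suc n) * (p\<^sup>2) ^ n) sums (1 / (1 - p\<^sup>2)\<^sup>2)" by simp
  qed
  ultimately show 1: "(LINT z|lborel. (cmod (reflected_pole_dz p z))\<^sup>2) = pi / (1 - p\<^sup>2)\<^sup>2"
    using sums_unique2 by fastforce
  show "(LINT z|lborel. (cmod (reflected_pole_dzbar p z))\<^sup>2) = pi / (1 - p\<^sup>2)\<^sup>2"
    using energy_identity[OF reflected_pole_weak_derivs[OF p] reflected_pole_bounded(1)[OF p] reflected_pole_L2[OF p]] 1 by simp
qed

lemma integral_split_circle:
  fixes f :: "complex \<Rightarrow> real"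
  assumes f: "integrable lborel f"
  shows "integrable lborel (\<lambda>z. indicator (ball 0 1) z * f z)" "integrable lborel (\<lambda>z. indicator (- ball 0 1) z * f z)"
    "(LINT z|lborel. f z) = (LINT z|lborel. indicator (ball 0 1) z * f z) + (LINT z|lborel. indicator (- ball 0 1) z * f z)"
proof -
  have [measurable]: "ball (0::complex) 1 \<in> sets borel" "- ball (0::complex) 1 \<in> sets borel" "f \<in> borel_measurable borel"
    using f by auto
  show I: "integrable lborel (\<lambda>z. indicator (ball 0 1) z * f z)" "integrable lborel (\<lambda>z. indicator (- ball 0 1) z * f z)"
    by (rule Bochner_Integration.integrable_bound[OF f]; auto simp: indicator_def)+
  have "(LINT z|lborel. f z) = (LINT z|lborel. indicator (ball 0 1) z * f z + indicator (- ball 0 1) z * f z)"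
    by (rule Bochner_Integration.integral_cong) (auto simp: indicator_def)
  then show "(LINT z|lborel. f z) = (LINT z|lborel. indicator (ball 0 1) z * f z) + (LINT z|lborel. indicator (- ball 0 1) z * f z)"
    using I by simp
qed

lemma exterior_pole_conj:
  assumes "1 \<le> cmod z"
  shows "reflected_pole_dzbar p z = - cnj (1 / (z - of_real p)\<^sup>2)"
  using assms by (simp add: reflected_pole_dzbar_def)

text \<open>The pairing of \<open>g\<close> with the reflected pole makes the cross term in \<open>\<integral> (cmod (h - q))\<^sup>2\<close> vanish.  Finiteness of the energy has to come first, since
both the energy identity and the pairing presuppose it.\<close>

theorem exterior_energy:
  assumes p: "0 \<le> p" "p < 1" and k: "0 \<le> k" "k < 1"
    and wd: "weak_derivs g h w" and M: "\<And>z. cmod (g z) \<le> M"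
    and D: "AE z in lborel. cmod z < 1 \<longrightarrow> w z = 0 \<and> h z = S z"
    and E: "AE z in lborel. 1 \<le> cmod z \<longrightarrow> cmod (w z) \<le> k * cmod (h z - 1 / (z - of_real p)\<^sup>2)"
  defines "A \<equiv> (LINT z|lborel. indicator (ball 0 1) z * (cmod (h z))\<^sup>2)"
    and "B \<equiv> (LINT z|lborel. indicator (- ball 0 1) z * (cmod (h z))\<^sup>2)"
  shows "integrable lborel (\<lambda>z. (cmod (h z))\<^sup>2)" "integrable lborel (\<lambda>z. (cmod (w z))\<^sup>2)"
    "A + B = (LINT z|lborel. (cmod (w z))\<^sup>2)" "0 \<le> A" "0 \<le> B"
    "A + B \<le> k\<^sup>2 * (B + pi / (1 - p\<^sup>2)\<^sup>2)"
proof -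
  let ?R = "reflected_pole_dzbar p"
  note R2 = reflected_pole_L2[OF p]
  note G = weak_derivsD[OF wd]
  have [measurable]: "h \<in> borel_measurable borel" "w \<in> borel_measurable borel" using G by (auto simp: loc_L2_def)
  have k2: "k\<^sup>2 < 1" using k by (simp add: power_less_one_iff abs_square_less_1)
  \<comment> \<open>With this weight in \<open>(x + y)\<^sup>2 \<le> (1 + \<delta>) * x\<^sup>2 + (1 + 1 / \<delta>) * y\<^sup>2\<close>, the factor \<open>k\<^sup>2 * (1 + \<delta>) = 1 - \<delta>\<^sup>2\<close> stays below \<open>1\<close>.\<close>
  define \<delta> where "\<delta> = 1 - k\<^sup>2"
  have \<delta>: "\<delta> > 0" using k2 by (simp add: \<delta>_def)
  define b where "b z = k\<^sup>2 * (1 + 1 / \<delta>) * (cmod (?R z))\<^sup>2" for z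
  have b: "integrable lborel b" "\<And>z. 0 \<le> b z" using R2(2) \<delta> by (auto simp: b_def[abs_def])
  have q: "cmod (1 / (z - of_real p)\<^sup>2) = cmod (?R z)" if "1 \<le> cmod z" for z
    unfolding exterior_pole_conj[OF that] by (simp only: norm_minus_cancel complex_mod_cnj)
  have dom: "AE z in lborel. (cmod (w z))\<^sup>2 \<le> (k\<^sup>2 * (1 + \<delta>)) * (cmod (h z))\<^sup>2 + b z"
    using D E
  proof eventually_elim
    case (elim z)
    show ?case
    proof (cases "cmod z < 1")
      case True
      then show ?thesis using elim b(2)[of z] \<delta> by simp
    next
      case False
      then have z: "1 \<le> cmod z" by simp
      have am: "(x + y)\<^sup>2 \<le> (1 + \<delta>) * x\<^sup>2 + (1 + 1 / \<delta>) * y\<^sup>2" for x y :: real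
      proof -
        have "0 \<le> (\<delta> * x - y)\<^sup>2 / \<delta>" using \<delta> by simp
        also have "\<dots> = \<delta> * x\<^sup>2 + 1 / \<delta> * y\<^sup>2 - 2 * x * y" using \<delta> by (simp add: power2_eq_square field_simps)
        finally show ?thesis by (simp add: power2_eq_square algebra_simps)
      qed
      have "cmod (h z - 1 / (z - of_real p)\<^sup>2) \<le> cmod (h z) + cmod (?R z)"
        using norm_triangle_ineq4[of "h z" "1 / (z - of_real p)\<^sup>2"] q[OF z] by simp
      then have "(cmod (h z - 1 / (z - of_real p)\<^sup>2))\<^sup>2 \<le> (1 + \<delta>) * (cmod (h z))\<^sup>2 + (1 + 1 / \<delta>) * (cmod (?R z))\<^sup>2"
        using order_trans[OF power_mono am] by auto
      then have 2: "k\<^sup>2 * (cmod (h z - 1 / (z - of_real p)\<^sup>2))\<^sup>2 \<le> k\<^sup>2 * ((1 + \<delta>) * (cmod (h z))\<^sup>2 + (1 + 1 / \<delta>) * (cmod (?R z))\<^sup>2)"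
        by (rule mult_left_mono) simp
      have "(cmod (w z))\<^sup>2 \<le> (k * cmod (h z - 1 / (z - of_real p)\<^sup>2))\<^sup>2"
        using elim(2) z by (intro power_mono) auto
      then have 1: "(cmod (w z))\<^sup>2 \<le> k\<^sup>2 * (cmod (h z - 1 / (z - of_real p)\<^sup>2))\<^sup>2" by (simp only: power_mult_distrib)
      have "k\<^sup>2 * ((1 + \<delta>) * (cmod (h z))\<^sup>2 + (1 + 1 / \<delta>) * (cmod (?R z))\<^sup>2) = (k\<^sup>2 * (1 + \<delta>)) * (cmod (h z))\<^sup>2 + b z"
        by (simp add: b_def algebra_simps)
      then show ?thesis using order_trans[OF 1 2] by (simp only:)
    qed
  qed
  have kk: "0 \<le> k\<^sup>2 * (1 + \<delta>)" "k\<^sup>2 * (1 + \<delta>) < 1"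
  proof -
    show "0 \<le> k\<^sup>2 * (1 + \<delta>)" using \<delta> by simp
    have "k\<^sup>2 * (1 + \<delta>) = 1 - \<delta>\<^sup>2" by (simp add: \<delta>_def power2_eq_square algebra_simps)
    then show "k\<^sup>2 * (1 + \<delta>) < 1" using \<delta> by simp
  qed
  show hI: "integrable lborel (\<lambda>z. (cmod (h z))\<^sup>2)" and wI: "integrable lborel (\<lambda>z. (cmod (w z))\<^sup>2)"
    by (rule energy_finite[OF wd M kk b dom])+
  note sp = integral_split_circle[OF hI]
  show AB: "A + B = (LINT z|lborel. (cmod (w z))\<^sup>2)"
    using energy_identity[OF wd M hI wI] sp(3) by (simp add: A_def B_def)
  show A0: "0 \<le> A" "0 \<le> B" unfolding A_def B_def by (auto intro!: integral_nonneg_AE)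
  \<comment> \<open>Inside the disc \<open>w\<close> vanishes, outside the \<open>z\<close>-derivative of the reflected pole does.\<close>
  have cross: "(LINT z|lborel. h z * ?R z) = 0"
  proof -
    have "(LINT z|lborel. h z * ?R z) = (LINT z|lborel. w z * reflected_pole_dz p z)"
      by (rule global_pairing[OF wd reflected_pole_weak_derivs[OF p] reflected_pole_bounded(1)[OF p] hI wI R2])
    also have "\<dots> = 0"
    proof (rule integral_eq_zero_AE)
      show "AE z in lborel. w z * reflected_pole_dz p z = 0"
        using D by eventually_elim (auto simp: reflected_pole_dz_def)
    qed
    finally show ?thesis .
  qed
  have hR: "integrable lborel (\<lambda>z. h z * ?R z)"
  proof -
    have "integrable lborel (\<lambda>z. cmod (h z) * cmod (?R z))" by (rule integrable_mult_L2(1)) (use hI R2 in auto)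
    then show ?thesis by (rule Bochner_Integration.integrable_bound) (auto simp: norm_mult)
  qed
  have "(LINT z|lborel. (cmod (w z))\<^sup>2) \<le> (LINT z|lborel. k\<^sup>2 * (indicator (- ball 0 1) z * (cmod (h z))\<^sup>2 + (cmod (?R z))\<^sup>2 + 2 * Re (h z * ?R z)))"
  proof (rule integral_mono_AE[OF wI])
    show "integrable lborel (\<lambda>z. k\<^sup>2 * (indicator (- ball 0 1) z * (cmod (h z))\<^sup>2 + (cmod (?R z))\<^sup>2 + 2 * Re (h z * ?R z)))"
      using sp(2) R2(2) hR by (intro integrable_mult_right Bochner_Integration.integrable_add integrable_Re)
    show "AE z in lborel. (cmod (w z))\<^sup>2 \<le> k\<^sup>2 * (indicator (- ball 0 1) z * (cmod (h z))\<^sup>2 + (cmod (?R z))\<^sup>2 + 2 * Re (h z * ?R z))"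
      using D E
    proof eventually_elim
      case (elim z)
      show ?case
      proof (cases "cmod z < 1")
        case True
        then show ?thesis using elim by (simp add: reflected_pole_dzbar_def)
      next
        case False
        then have z: "1 \<le> cmod z" by simp
        define q where "q = 1 / (z - of_real p)\<^sup>2"
        have R: "?R z = - cnj q" unfolding q_def by (rule exterior_pole_conj[OF z])
        have "(cmod (w z))\<^sup>2 \<le> (k * cmod (h z - q))\<^sup>2"
          using elim(2) z by (intro power_mono) (auto simp: q_def)
        also have "\<dots> = k\<^sup>2 * (cmod (h z - q))\<^sup>2" by (rule power_mult_distrib)
        also have "(cmod (h z - q))\<^sup>2 = (cmod (h z))\<^sup>2 + (cmod (?R z))\<^sup>2 + 2 * Re (h z * ?R z)"
          unfolding R cmod_power2 by (simp add: power2_eq_square algebra_simps)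
        finally show ?thesis using False by simp
      qed
    qed
  qed
  also have "\<dots> = k\<^sup>2 * (B + pi / (1 - p\<^sup>2)\<^sup>2 + 2 * Re (LINT z|lborel. h z * ?R z))"
  proof -
    have gen: "(LINT z|lborel. k\<^sup>2 * (a z + b z + 2 * c z)) = k\<^sup>2 * ((LINT z|lborel. a z) + (LINT z|lborel. b z) + 2 * (LINT z|lborel. c z))"
      if "integrable lborel a" "integrable lborel b" "integrable lborel c" for a b c :: "complex \<Rightarrow> real"
      using that by simp
    show ?thesis
      unfolding gen[OF sp(2) R2(2) integrable_Re[OF hR]] integral_Re[OF hR] reflected_pole_energy(2)[OF p] B_def ..
  qed
  finally show "A + B \<le> k\<^sup>2 * (B + pi / (1 - p\<^sup>2)\<^sup>2)" unfolding AB cross by simp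
qed

section \<open>The case of equality\<close>

lemma has_field_derivative_if_d_zbar_zero:
  assumes sm: "smooth f" and z: "d_zbar f z = 0"
  shows "(f has_field_derivative d_x f z) (at z)"
proof -
  let ?D = "frechet_derivative f (at z)"
  have i: "?D \<i> = \<i> * ?D 1"
  proof -
    have "?D 1 + \<i> * ?D \<i> = 0" using z by (simp add: d_zbar_def)
    then have "\<i> * (?D 1 + \<i> * ?D \<i>) = 0" by simp
    then show ?thesis by (simp add: distrib_left flip: mult.assoc)
  qed
  have "?D d = ?D 1 * d" for d
  proof -
    have "?D d = Re d *\<^sub>R ?D 1 + Im d *\<^sub>R (\<i> * ?D 1)"
      using frechet_split[OF smooth_differentiable[OF sm], of z d] i by simp
    also have "\<dots> = ?D 1 * (of_real (Re d) + \<i> * of_real (Im d))"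
      by (simp add: scaleR_conv_of_real algebra_simps)
    also have "of_real (Re d) + \<i> * of_real (Im d) = d" by (rule complex_eq[symmetric])
    finally show ?thesis .
  qed
  then have D: "?D = (\<lambda>d. ?D 1 * d)" by (rule ext)
  show ?thesis
    unfolding has_field_derivative_def by (rule has_derivative_eq_rhs[OF smooth_differentiable[OF sm] D])
qed

text \<open>The mollifications of \<open>u\<close> are smooth with vanishing \<open>cnj z\<close>-derivative, hence holomorphic, and they converge locally uniformly.\<close>

theorem weyl_holomorphic:
  assumes u: "weak_derivs u s t" and V: "open V" and zero: "AE z in lborel. z \<in> V \<longrightarrow> t z = 0"
  shows "u holomorphic_on V"
proof -
  have "u field_differentiable at x" if x: "x \<in> V" for x
  proof -
    obtain d where d: "d > 0" "ball x d \<subseteq> V" using V x open_contains_ball by blast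
    obtain N where N: "1 / real (Suc N) < d / 2"
      using reals_Archimedean[of "d / 2"] d(1) by (auto simp: inverse_eq_divide)
    have uL: "loc_int u" by (intro loc_L2_imp_loc_int loc_L2_continuous weak_derivsD(1)[OF u])
    have sm: "smooth (conv u (moll n))" for n by (rule smooth_conv[OF uL moll_smooth moll_outside])
    have hol: "conv u (moll (n + N)) holomorphic_on ball x (d / 2)" for n
    proof (rule holomorphic_onI)
      fix z assume z: "z \<in> ball x (d / 2)"
      have "1 / real (Suc (n + N)) \<le> 1 / real (Suc N)" by (intro divide_left_mono) auto
      then have n: "1 / real (Suc (n + N)) < d / 2" using N by linarith
      have "conv t (moll (n + N)) z = 0"
        unfolding conv_def
      proof (rule integral_eq_zero_AE)
        show "AE w in lborel. t w * moll (n + N) (z - w) = 0"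
          using zero
        proof eventually_elim
          case (elim w)
          show ?case
          proof (cases "dist z w < d / 2")
            case True
            then have "w \<in> ball x d" using z dist_triangle[of x w z] by simp
            then show ?thesis using elim d(2) by auto
          next
            case False
            then have "moll (n + N) (z - w) = 0" using n by (intro moll_outside) (simp only: dist_norm)
            then show ?thesis by simp
          qed
        qed
      qed
      then have "d_zbar (conv u (moll (n + N))) z = 0" using d_z_conv(2)[OF u] by simp
      from has_field_derivative_if_d_zbar_zero[OF sm this]
      show "conv u (moll (n + N)) field_differentiable at z within ball x (d / 2)"
        using field_differentiable_at_within field_differentiable_def by blast
    qed
    have "u holomorphic_on ball x (d / 2)"
    proof (rule holomorphic_uniform_sequence[OF open_ball hol])
      fix y assume "y \<in> ball x (d / 2)"
      then obtain r where r: "r > 0" "cball y r \<subseteq> ball x (d / 2)" using open_contains_cball open_ball by blast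
      have "uniform_limit (cball y r) (\<lambda>n. conv u (moll (n + N))) u sequentially"
        unfolding uniform_limit_iff
      proof (intro allI impI)
        fix e :: real assume e: "e > 0"
        have "\<forall>\<^sub>F n in sequentially. \<forall>z\<in>cball 0 (cmod y + r). cmod (conv u (moll n) z - u z) \<le> e / 2"
          using e by (intro continuous_conv_moll_uniform weak_derivsD(1)[OF u]) simp
        then have "\<forall>\<^sub>F n in sequentially. \<forall>z\<in>cball 0 (cmod y + r). cmod (conv u (moll (n + N)) z - u z) \<le> e / 2"
          by (rule sequentially_offset)
        then show "\<forall>\<^sub>F n in sequentially. \<forall>z\<in>cball y r. dist (conv u (moll (n + N)) z) (u z) < e"
        proof eventually_elim
          case (elim n)
          show ?case
          proof
            fix z assume "z \<in> cball y r"
            then have "cmod z \<le> cmod y + r" using norm_triangle_ineq2[of z y] by (simp add: dist_norm norm_minus_commute)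
            then have "cmod (conv u (moll (n + N)) z - u z) \<le> e / 2" using elim by auto
            then show "dist (conv u (moll (n + N)) z) (u z) < e" using e by (simp add: dist_norm)
          qed
        qed
      qed
      then show "\<exists>d'>0. cball y d' \<subseteq> ball x (d / 2) \<and> uniform_limit (cball y d') (\<lambda>n. conv u (moll (n + N))) u sequentially"
        using r by blast
    qed
    then show ?thesis using d(1) holomorphic_on_imp_differentiable_at[OF _ open_ball, of u x "d / 2" x] by simp
  qed
  then show ?thesis by (meson holomorphic_onI field_differentiable_at_within)
qed

lemma continuous_AE_zero_everywhere:
  fixes d :: "complex \<Rightarrow> real"
  assumes V: "open V" and d: "continuous_on V d" and zero: "AE z in lborel. z \<in> V \<longrightarrow> d z = 0" and z: "z \<in> V"
  shows "d z = 0"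
proof (rule ccontr)
  assume nz: "d z \<noteq> 0"
  define W where "W = V \<inter> d -` (- {0})"
  have "open (d -` (- {0}) \<inter> V)"
    using d V continuous_on_open_vimage[OF V] by blast
  then have W: "open W" "z \<in> W" using nz z by (auto simp: W_def Int_commute)
  have "AE z in lborel. z \<notin> W" using zero by eventually_elim (auto simp: W_def)
  then have "W \<in> null_sets lborel" using W(1) by (simp add: AE_iff_null_sets)
  then have "negligible W" by (simp add: negligible_iff_null_sets null_sets_completionI)
  then show False using open_not_negligible[OF W(1)] W(2) by auto
qed

text \<open>Equality forces \<open>h = 0\<close> and \<open>cmod w = k * cmod q\<close> almost everywhere outside the disc.  So \<open>H = cnj g\<close> is holomorphic there, and \<open>H' * (z - p)\<^sup>2\<close> is
holomorphic with constant modulus, hence constant.\<close>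

theorem equality_case:
  assumes p: "0 \<le> p" "p < 1" and k: "0 \<le> k" "k < 1"
    and wd: "weak_derivs g h w" and M: "\<And>z. cmod (g z) \<le> M"
    and gS: "\<And>z. cmod z < 1 \<Longrightarrow> (g has_field_derivative S z) (at z)"
    and D: "AE z in lborel. cmod z < 1 \<longrightarrow> w z = 0 \<and> h z = S z"
    and E: "AE z in lborel. 1 \<le> cmod z \<longrightarrow> cmod (w z) \<le> k * cmod (h z - 1 / (z - of_real p)\<^sup>2)"
    and eq: "(LINT z|lborel. indicator (ball 0 1) z * (cmod (h z))\<^sup>2) = k\<^sup>2 * (pi / (1 - p\<^sup>2)\<^sup>2)"
  obtains c0 c1 where "cmod c1 = k" "\<And>z. cmod z < 1 \<Longrightarrow> g z = c0 + c1 * reflected_pole p z"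
proof -
  let ?R = "reflected_pole_dzbar p"
  note R2 = reflected_pole_L2[OF p] and RE = reflected_pole_energy[OF p]
  note X = exterior_energy[OF p k wd M D E]
  note G = weak_derivsD[OF wd]
  have [measurable]: "h \<in> borel_measurable borel" "w \<in> borel_measurable borel" using G by (auto simp: loc_L2_def)
  have k2: "k\<^sup>2 < 1" using k by (simp add: power_less_one_iff abs_square_less_1)
  define B where "B = (LINT z|lborel. indicator (- ball 0 1) z * (cmod (h z))\<^sup>2)"
  have B0: "B \<ge> 0" using X(5) by (simp add: B_def)
  have "B \<le> k\<^sup>2 * B" using X(6) unfolding eq B_def[symmetric] by (simp add: distrib_left)
  then have "(1 - k\<^sup>2) * B \<le> 0" by (simp add: algebra_simps)
  then have "B \<le> 0" using k2 by (simp add: mult_le_0_iff)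
  then have B: "B = 0" using B0 by simp
  have "AE z in lborel. indicator (- ball 0 1) z * (cmod (h z))\<^sup>2 = 0"
    using B integral_nonneg_eq_0_iff_AE[OF integral_split_circle(2)[OF X(1)]] by (simp add: B_def)
  then have h0: "AE z in lborel. 1 \<le> cmod z \<longrightarrow> h z = 0"
    by eventually_elim (auto simp: indicator_def)
  have le: "AE z in lborel. (cmod (w z))\<^sup>2 \<le> k\<^sup>2 * (cmod (?R z))\<^sup>2"
    using D E h0
  proof eventually_elim
    case (elim z)
    show ?case
    proof (cases "cmod z < 1")
      case False
      then have "cmod (w z) \<le> k * cmod (?R z)"
        using elim by (simp add: reflected_pole_dzbar_def norm_divide norm_power)
          (metis complex_cnj_complex_of_real complex_cnj_diff complex_mod_cnj)
      then have "(cmod (w z))\<^sup>2 \<le> (k * cmod (?R z))\<^sup>2" by (intro power_mono) auto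
      then show ?thesis by (simp add: power_mult_distrib)
    qed (use elim in simp)
  qed
  have "(LINT z|lborel. k\<^sup>2 * (cmod (?R z))\<^sup>2 - (cmod (w z))\<^sup>2) = k\<^sup>2 * (pi / (1 - p\<^sup>2)\<^sup>2) - (LINT z|lborel. (cmod (w z))\<^sup>2)"
    using R2 X(2) RE by simp
  also have "\<dots> = 0" using X(3) B unfolding eq B_def[symmetric] by simp
  finally have z0: "(LINT z|lborel. k\<^sup>2 * (cmod (?R z))\<^sup>2 - (cmod (w z))\<^sup>2) = 0" .
  have Id: "integrable lborel (\<lambda>z. k\<^sup>2 * (cmod (?R z))\<^sup>2 - (cmod (w z))\<^sup>2)" using R2 X(2) by simp
  have "AE z in lborel. k\<^sup>2 * (cmod (?R z))\<^sup>2 - (cmod (w z))\<^sup>2 = 0"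
    using z0 le by (subst (asm) integral_nonneg_eq_0_iff_AE[OF Id]) auto
  then have weq: "AE z in lborel. cmod (w z) = k * cmod (?R z)"
  proof eventually_elim
    case (elim z)
    then have "(cmod (w z))\<^sup>2 = (k * cmod (?R z))\<^sup>2" by (simp add: power_mult_distrib)
    then show ?case using k(1) by (simp add: power2_eq_iff_nonneg)
  qed
  define \<Omega> where "\<Omega> = - cball (0::complex) 1"
  have \<Omega>: "open \<Omega>" "connected \<Omega>"
    using connected_complement_bounded_convex[of "cball (0::complex) 1"] by (auto simp: \<Omega>_def)
  have \<Omega>1: "z \<in> \<Omega> \<longleftrightarrow> 1 < cmod z" for z by (auto simp: \<Omega>_def)
  have \<Omega>p: "z - of_real p \<noteq> 0" if "z \<in> \<Omega>" for z using denominator_nonzero(2)[OF p, of z] that \<Omega>1 by simp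
  define H where "H z = cnj (g z)" for z
  have wH: "weak_derivs H (\<lambda>z. cnj (w z)) (\<lambda>z. cnj (h z))" unfolding H_def[abs_def] by (rule weak_derivs_cnj[OF wd])
  have Hh: "H holomorphic_on \<Omega>"
    by (rule weyl_holomorphic[OF wH \<Omega>(1)]) (use h0 in \<open>eventually_elim, auto simp: \<Omega>1\<close>)
  have Hd: "(H has_field_derivative deriv H z) (at z)" if "z \<in> \<Omega>" for z
    by (rule holomorphic_derivI[OF Hh \<Omega>(1) that])
  have dHh: "deriv H holomorphic_on \<Omega>" by (rule holomorphic_deriv[OF Hh \<Omega>(1)])
  have dHc: "continuous_on \<Omega> (deriv H)" by (rule holomorphic_on_imp_continuous_on[OF dHh])
  have "AE z in lborel. z \<in> \<Omega> \<longrightarrow> cnj (w z) = deriv H z"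
  proof (rule weak_equals_continuous[OF weak_derivsD(2)[OF wH] \<Omega>(1) dHc])
    fix \<phi> assume \<phi>: "\<phi> \<in> test_functions \<Omega>"
    then have \<phi>': "\<phi> \<in> test_functions UNIV" using test_functions_mono by blast
    have "(LINT z|lborel. deriv H z * \<phi> z) = - (LINT z|lborel. H z * d_z \<phi> z)"
      by (rule holomorphic_by_parts(1)[OF \<Omega>(1) \<phi> _ dHc]) (erule Hd)
    then show "(LINT z|lborel. cnj (w z) * \<phi> z) = (LINT z|lborel. deriv H z * \<phi> z)"
      using weak_derivsD(4)[OF wH \<phi>'] by simp
  qed
  then have AEk: "AE z in lborel. z \<in> \<Omega> \<longrightarrow> cmod (deriv H z * (z - of_real p)\<^sup>2) - k = 0"
    using weq
  proof eventually_elim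
    case (elim z)
    show ?case
    proof
      assume z: "z \<in> \<Omega>"
      then have "cmod (deriv H z) = k * cmod (?R z)" using elim by (metis complex_mod_cnj)
      also have "cmod (?R z) = 1 / cmod ((z - of_real p)\<^sup>2)"
        unfolding exterior_pole_conj[of z p, OF less_imp_le[OF \<Omega>1[THEN iffD1, OF z]]]
          by (simp only: norm_minus_cancel complex_mod_cnj norm_divide norm_one)
      finally show "cmod (deriv H z * (z - of_real p)\<^sup>2) - k = 0" using \<Omega>p[OF z] by (simp add: norm_mult)
    qed
  qed
  have "continuous_on \<Omega> (\<lambda>z. cmod (deriv H z * (z - of_real p)\<^sup>2) - k)"
    by (intro continuous_intros dHc)
  note mod0 = continuous_AE_zero_everywhere[OF \<Omega>(1) this AEk]
  have mod: "cmod (deriv H z * (z - of_real p)\<^sup>2) = k" if "z \<in> \<Omega>" for z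
    using mod0[OF that] by simp
  have "(\<lambda>z. deriv H z * (z - of_real p)\<^sup>2) constant_on \<Omega>"
  proof (rule maximum_modulus_principle[OF _ \<Omega> \<Omega>(1) order_refl])
    show "(\<lambda>z. deriv H z * (z - of_real p)\<^sup>2) holomorphic_on \<Omega>" by (intro holomorphic_intros dHh)
    show "2 \<in> \<Omega>" by (simp add: \<Omega>1)
    then show "cmod (deriv H z * (z - of_real p)\<^sup>2) \<le> cmod (deriv H 2 * (2 - of_real p)\<^sup>2)" if "z \<in> \<Omega>" for z
      using mod that by simp
  qed
  then obtain c where c: "\<And>z. z \<in> \<Omega> \<Longrightarrow> deriv H z * (z - of_real p)\<^sup>2 = c" by (auto simp: constant_on_def)
  have ck: "cmod c = k" using mod[of 2] c[of 2] by (simp add: \<Omega>1)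
  have "\<exists>c'. \<forall>z\<in>\<Omega>. H z + c / (z - of_real p) = c'"
  proof -
    have d0: "((\<lambda>z. H z + c / (z - of_real p)) has_field_derivative 0) (at z)" if z: "z \<in> \<Omega>" for z
    proof -
      have "((\<lambda>z. H z + c / (z - of_real p)) has_field_derivative (deriv H z - c / (z - of_real p)\<^sup>2)) (at z)"
        using \<Omega>p[OF z] by (auto intro!: derivative_eq_intros Hd[OF z] simp: power2_eq_square field_simps)
      moreover have "deriv H z - c / (z - of_real p)\<^sup>2 = 0" using c[OF z] \<Omega>p[OF z] by (simp add: field_simps)
      ultimately show ?thesis by simp
    qed
    then have "continuous_on \<Omega> (\<lambda>z. H z + c / (z - of_real p))"
      by (intro continuous_at_imp_continuous_on ballI DERIV_isCont) auto
    from DERIV_zero_connected_constant[OF \<Omega>(2,1) finite.emptyI this] d0 show ?thesis by (metis DiffD1)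
  qed
  then obtain c' where c': "\<And>z. z \<in> \<Omega> \<Longrightarrow> H z + c / (z - of_real p) = c'" by blast
  define c0 c1 where "c0 = cnj c'" and "c1 = - cnj c"
  define d where "d z = g z - (c0 + c1 * reflected_pole p z)" for z
  have d0: "d z = 0" if "z \<in> \<Omega>" for z
  proof -
    have "H z = c' - c / (z - of_real p)" using c'[OF that] by (simp add: eq_diff_eq)
    then have "cnj (H z) = cnj (c' - c / (z - of_real p))" by simp
    then have "g z = cnj c' - cnj c / (cnj z - of_real p)" by (simp add: H_def)
    then show ?thesis using that \<Omega>1[of z] by (simp add: d_def c0_def c1_def reflected_pole_def)
  qed
  have dc: "continuous_on UNIV d"
    unfolding d_def[abs_def] by (intro continuous_intros G(1) reflected_pole_continuous[OF p])
  have clo: "closure \<Omega> = - ball 0 1" unfolding \<Omega>_def closure_complement by simp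
  have dcl: "continuous_on (closure \<Omega>) d" using dc continuous_on_subset by blast
  have d1: "d z = 0" if "1 \<le> cmod z" for z
  proof -
    have zc: "z \<in> closure \<Omega>" unfolding clo using that by simp
    show ?thesis by (rule continuous_constant_on_closure[OF dcl _ zc]) (erule d0)
  qed
  have dD: "d z = 0" if z: "cmod z < 1" for z
  proof -
    have "d holomorphic_on ball 0 1"
    proof (rule holomorphic_transform[where f = "\<lambda>z. g z - (c0 + c1 * (z / (1 - of_real p * z)))"])
      have "g holomorphic_on ball 0 1"
      proof (rule holomorphic_onI)
        fix x :: complex assume "x \<in> ball 0 1"
        then have "(g has_field_derivative S x) (at x)" using gS by simp
        then have "g field_differentiable at x" unfolding field_differentiable_def by blast
        then show "g field_differentiable at x within ball 0 1" by (rule field_differentiable_at_within)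
      qed
      moreover have "1 - of_real p * z \<noteq> 0" if "z \<in> ball 0 1" for z :: complex
        using denominator_nonzero(1)[OF p, of z] that by simp
      ultimately show "(\<lambda>z. g z - (c0 + c1 * (z / (1 - of_real p * z)))) holomorphic_on ball 0 1"
        by (intro holomorphic_intros)
      show "g x - (c0 + c1 * (x / (1 - of_real p * x))) = d x" if "x \<in> ball 0 1" for x
        using that by (simp add: d_def reflected_pole_def)
    qed
    then have hol: "d holomorphic_on interior (ball 0 1)" by simp
    have "norm (d z) \<le> 0"
    proof (rule maximum_modulus_frontier[OF hol])
      show "continuous_on (closure (ball 0 1)) d" by (rule continuous_on_subset[OF dc subset_UNIV])
      show "norm (d x) \<le> 0" if "x \<in> frontier (ball 0 1)" for x using that d1[of x] by simp
    qed (use z in auto)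
    then show ?thesis by simp
  qed
  show ?thesis
  proof (rule that[of c1 c0])
    show "cmod c1 = k" using ck by (simp add: c1_def)
    show "g z = c0 + c1 * reflected_pole p z" if "cmod z < 1" for z using dD[OF that] by (simp add: d_def)
  qed
qed

section \<open>The extremal extension\<close>

text \<open>The open sets of the sphere are the open sets of the plane and the complements of compact sets together with the point at infinity; preimages of
both kinds have to be checked.\<close>

lemma continuous_map_ext_planeI:
  assumes W: "\<And>W. open W \<Longrightarrow> openin ext_plane {x. F x \<in> Some ` W}"
    and C: "\<And>C. compact C \<Longrightarrow> openin ext_plane {x. F x \<in> insert None (Some ` (- C))}"
  shows "continuous_map ext_plane ext_plane F"
  unfolding continuous_map_def
proof (intro conjI allI impI)
  have top: "topspace ext_plane = UNIV" by (simp add: UNIV_option_conv)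
  show "F \<in> topspace ext_plane \<rightarrow> topspace ext_plane" unfolding top by simp
  fix V assume "openin ext_plane V"
  then consider W where "open W" "V = Some ` W" | C where "compact C" "V = insert None (Some ` (- C))"
    unfolding openin_Alexandroff_compactification by (auto simp: Compl_eq_Diff_UNIV)
  then show "openin ext_plane {x \<in> topspace ext_plane. F x \<in> V}"
    unfolding top using W C by cases auto
qed

lemma openin_ext_plane_Some: "open W \<Longrightarrow> openin ext_plane (Some ` W)"
  by simp

lemma openin_ext_plane_None: "compact C \<Longrightarrow> openin ext_plane (insert None (Some ` (- C)))"
  unfolding openin_Alexandroff_compactification by (auto simp: Compl_eq_Diff_UNIV compact_imp_closed)

lemma homeomorphic_map_ext_planeI:
  assumes "continuous_map ext_plane ext_plane F" "inj F" "surj F"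
  shows "homeomorphic_map ext_plane ext_plane F"
proof (rule continuous_imp_homeomorphic_map[OF assms(1)])
  have top: "topspace ext_plane = UNIV" by (simp add: UNIV_option_conv)
  show "compact_space ext_plane" by simp
  show "Hausdorff_space ext_plane"
    by (simp add: Hausdorff_space_Alexandroff_compactification locally_compact_space_euclidean)
  show "F ` topspace ext_plane = topspace ext_plane" "inj_on F (topspace ext_plane)"
    unfolding top using assms by auto
qed

text \<open>The lower bound for distances makes the map injective and proper, so it extends to infinity.\<close>

lemma expanding_map_ext_homeomorphism:
  fixes \<phi> :: "complex \<Rightarrow> complex"
  assumes c: "continuous_on UNIV \<phi>" and s: "surj \<phi>" and m: "m > 0" "\<And>x y. m * dist x y \<le> dist (\<phi> x) (\<phi> y)"
  shows "homeomorphic_map ext_plane ext_plane (map_option \<phi>)"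
proof (rule homeomorphic_map_ext_planeI)
  show "continuous_map ext_plane ext_plane (map_option \<phi>)"
  proof (rule continuous_map_ext_planeI)
    fix W :: "complex set" assume "open W"
    then have "open (\<phi> -` W)" using c by (simp add: continuous_on_open_vimage[OF open_UNIV])
    moreover have "{x. map_option \<phi> x \<in> Some ` W} = Some ` (\<phi> -` W)" by (auto simp: map_option_case image_iff split: option.splits)
    ultimately show "openin ext_plane {x. map_option \<phi> x \<in> Some ` W}" by (simp only: openin_ext_plane_Some)
  next
    fix C :: "complex set" assume C: "compact C"
    have "closed (\<phi> -` C)" using c compact_imp_closed[OF C] by (simp add: continuous_on_closed_vimage[OF closed_UNIV])
    moreover have "bounded (\<phi> -` C)"
    proof -
      obtain R where R: "\<forall>x\<in>C. dist (\<phi> 0) x \<le> R" using compact_imp_bounded[OF C] bounded_any_center by blast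
      have "dist 0 z \<le> R / m" if "z \<in> \<phi> -` C" for z
        using m(2)[of 0 z] R that m(1) by (force simp: field_simps)
      then show ?thesis unfolding bounded_def by blast
    qed
    ultimately have "compact (\<phi> -` C)" by (simp add: compact_eq_bounded_closed)
    moreover have "{x. map_option \<phi> x \<in> insert None (Some ` (- C))} = insert None (Some ` (- (\<phi> -` C)))"
    proof (rule set_eqI)
      fix x
      show "x \<in> {x. map_option \<phi> x \<in> insert None (Some ` (- C))} \<longleftrightarrow> x \<in> insert None (Some ` (- (\<phi> -` C)))"
        by (cases x) auto
    qed
    ultimately show "openin ext_plane {x. map_option \<phi> x \<in> insert None (Some ` (- C))}" by (simp only: openin_ext_plane_None)
  qed
  have "inj \<phi>"
  proof (rule injI)
    fix x y assume "\<phi> x = \<phi> y"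
    then have "m * dist x y \<le> 0" using m(2)[of x y] by simp
    then show "x = y" using m(1) by (simp add: mult_le_0_iff)
  qed
  then show "inj (map_option \<phi>)" by (rule option.inj_map)
  show "surj (map_option \<phi>)"
    unfolding surj_def
  proof
    fix y show "\<exists>x. y = map_option \<phi> x"
    proof (cases y)
      case None
      then show ?thesis by (intro exI[of _ None]) simp
    next
      case (Some v)
      obtain u where "v = \<phi> u" using s by (auto simp: surj_def)
      then show ?thesis using Some by (intro exI[of _ "Some u"]) simp
    qed
  qed
qed

definition inversion :: "complex option \<Rightarrow> complex option" where
  "inversion x = (case x of None \<Rightarrow> Some 0 | Some z \<Rightarrow> if z = 0 then None else Some (1 / z))"

lemma inversion_involution: "inversion (inversion x) = x"
  by (simp add: inversion_def split: option.splits)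

lemma inversion_homeomorphism: "homeomorphic_map ext_plane ext_plane inversion"
proof (rule homeomorphic_map_ext_planeI)
  let ?i = "\<lambda>z::complex. 1 / z"
  have ic: "continuous_on (- {0}) ?i" by (intro continuous_intros) auto
  have io: "open (?i -` W \<inter> - {0})" if "open W" for W
  proof -
    have o: "open (- {0::complex})" by (rule open_Compl[OF closed_singleton])
    show ?thesis using ic that unfolding continuous_on_open_vimage[OF o] by blast
  qed
  show "continuous_map ext_plane ext_plane inversion"
  proof (rule continuous_map_ext_planeI)
    fix W :: "complex set" assume W: "open W"
    show "openin ext_plane {x. inversion x \<in> Some ` W}"
    proof (cases "0 \<in> W")
      case False
      have eq: "{x. inversion x \<in> Some ` W} = Some ` (?i -` W \<inter> - {0})"
      proof (rule set_eqI)
        fix x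
        show "x \<in> {x. inversion x \<in> Some ` W} \<longleftrightarrow> x \<in> Some ` (?i -` W \<inter> - {0})"
          using False by (cases x) (auto simp: inversion_def)
      qed
      show ?thesis unfolding eq by (rule openin_ext_plane_Some[OF io[OF W]])
    next
      case True
      have eq: "{x. inversion x \<in> Some ` W} = insert None (Some ` (- (- (?i -` W \<inter> - {0}))))"
      proof (rule set_eqI)
        fix x
        show "x \<in> {x. inversion x \<in> Some ` W} \<longleftrightarrow> x \<in> insert None (Some ` (- (- (?i -` W \<inter> - {0}))))"
          using True by (cases x) (auto simp: inversion_def)
      qed
      obtain e where e: "e > 0" "ball 0 e \<subseteq> W" using W True open_contains_ball by blast
      have "bounded (- (?i -` W \<inter> - {0}))"
        unfolding bounded_iff
      proof (intro exI[of _ "1 / e"] ballI)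
        fix z assume z: "z \<in> - (?i -` W \<inter> - {0})"
        show "norm z \<le> 1 / e"
        proof (cases "z = 0")
          case False
          then have "1 / z \<notin> ball 0 e" using z e(2) by auto
          then have "e \<le> 1 / norm z" by (simp add: norm_divide)
          then show ?thesis using False e(1) by (simp add: field_simps)
        qed (use e in simp)
      qed
      moreover have "closed (- (?i -` W \<inter> - {0}))" using io[OF W] by (rule closed_Compl)
      ultimately have "compact (- (?i -` W \<inter> - {0}))" by (simp only: compact_eq_bounded_closed)
      then show ?thesis unfolding eq by (rule openin_ext_plane_None)
    qed
  next
    fix C :: "complex set" assume C: "compact C"
    show "openin ext_plane {x. inversion x \<in> insert None (Some ` (- C))}"
    proof (cases "0 \<in> C")
      case False
      have eq: "{x. inversion x \<in> insert None (Some ` (- C))} = insert None (Some ` (- (?i ` C)))"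
      proof (rule set_eqI)
        fix x
        show "x \<in> {x. inversion x \<in> insert None (Some ` (- C))} \<longleftrightarrow> x \<in> insert None (Some ` (- (?i ` C)))"
        proof (cases x)
          case (Some z)
          have "z \<in> ?i ` C \<longleftrightarrow> z \<noteq> 0 \<and> 1 / z \<in> C"
          proof
            assume "z \<noteq> 0 \<and> 1 / z \<in> C"
            then show "z \<in> ?i ` C" by (intro image_eqI[of _ _ "1 / z"]) auto
          qed (use False in auto)
          then show ?thesis by (auto simp: Some inversion_def image_iff)
        qed (use False in \<open>auto simp: inversion_def\<close>)
      qed
      have "continuous_on C ?i" using False by (intro continuous_intros) auto
      then have "compact (?i ` C)" using C by (rule compact_continuous_image)
      then show ?thesis unfolding eq by (rule openin_ext_plane_None)
    next
      case True
      let ?V = "insert 0 (?i -` (- C) \<inter> - {0})"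
      have eq: "{x. inversion x \<in> insert None (Some ` (- C))} = Some ` ?V"
      proof (rule set_eqI)
        fix x
        show "x \<in> {x. inversion x \<in> insert None (Some ` (- C))} \<longleftrightarrow> x \<in> Some ` ?V"
          using True by (cases x) (auto simp: inversion_def)
      qed
      obtain R where R: "R > 0" "\<forall>x\<in>C. norm x \<le> R" using compact_imp_bounded[OF C] bounded_pos by blast
      have "ball 0 (1 / R) \<subseteq> ?V"
      proof
        fix z assume z: "z \<in> ball (0::complex) (1 / R)"
        show "z \<in> ?V"
        proof (cases "z = 0")
          case False
          then have "R < norm (1 / z)" using z R(1) by (simp add: norm_divide field_simps)
          then show ?thesis using R(2) False by (auto simp: not_le[symmetric])
        qed simp
      qed
      then have "?V = ball 0 (1 / R) \<union> (?i -` (- C) \<inter> - {0})" using R(1) by auto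
      moreover have "open (ball 0 (1 / R) \<union> (?i -` (- C) \<inter> - {0}))"
        by (intro open_Un open_ball io open_Compl compact_imp_closed C)
      ultimately have "open ?V" by simp
      then show ?thesis unfolding eq by (rule openin_ext_plane_Some)
    qed
  qed
  show "inj inversion" by (rule inj_on_inverseI[of _ inversion]) (rule inversion_involution)
  show "surj inversion" by (rule surjI) (rule inversion_involution)
qed

text \<open>The identity behind the invariance of the unit disc under Moebius transformations.\<close>

lemma blaschke_identity:
  "(cmod (1 - cnj w * z))\<^sup>2 - (cmod (w - z))\<^sup>2 = (1 - (cmod w)\<^sup>2) * (1 - (cmod z)\<^sup>2)"
  unfolding cmod_power2 by (simp add: power2_eq_square algebra_simps)

text \<open>The plane folded along the unit circle onto the unit disc, by inversion outside and by conjugation inside.\<close>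

definition folding :: "complex \<Rightarrow> complex" where
  "folding s = (if 1 < cmod s then 1 / s else cnj s)"

text \<open>Conjugation is an isometry, and inversion contracts distances outside the unit disc.  For points on different sides the claim is the sign of
\<open>blaschke_identity\<close>.\<close>

lemma folding_nonexpansive: "dist (folding s) (folding t) \<le> dist s t"
proof -
  have mixed: "cmod (1 / s - cnj t) \<le> cmod (s - t)" if s: "1 < cmod s" and t: "cmod t \<le> 1" for s t
  proof -
    have nz: "s \<noteq> 0" using s by auto
    have "(cmod (1 - cnj s * t))\<^sup>2 - (cmod (s - t))\<^sup>2 = (1 - (cmod s)\<^sup>2) * (1 - (cmod t)\<^sup>2)" by (rule blaschke_identity)
    also have "\<dots> \<le> 0"
    proof (rule mult_nonpos_nonneg)
      show "1 - (cmod s)\<^sup>2 \<le> 0" using s one_le_power[of "cmod s" 2] by simp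
      show "0 \<le> 1 - (cmod t)\<^sup>2" using t by (simp add: power_le_one)
    qed
    finally have "(cmod (1 - cnj s * t))\<^sup>2 \<le> (cmod (s - t))\<^sup>2" by simp
    then have le: "cmod (1 - cnj s * t) \<le> cmod (s - t)" by (rule power2_le_imp_le) simp
    have "1 / s - cnj t = cnj (1 - cnj s * t) / s" using nz by (simp add: field_simps)
    then have "cmod (1 / s - cnj t) = cmod (1 - cnj s * t) / cmod s" by (simp only: norm_divide complex_mod_cnj)
    also have "\<dots> \<le> cmod (1 - cnj s * t) / 1" using s by (intro divide_left_mono) auto
    finally show ?thesis using le by simp
  qed
  consider "1 < cmod s" "1 < cmod t" | "1 < cmod s" "cmod t \<le> 1" | "cmod s \<le> 1" "1 < cmod t" | "cmod s \<le> 1" "cmod t \<le> 1" by linarith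
  then show ?thesis
  proof cases
    case 1
    have nz: "s \<noteq> 0" "t \<noteq> 0" using 1 by auto
    have "1 / s - 1 / t = (t - s) / (s * t)" using nz by (simp add: field_simps)
    then have "cmod (1 / s - 1 / t) = cmod (t - s) / (cmod s * cmod t)" by (simp only: norm_divide norm_mult)
    also have "\<dots> \<le> cmod (t - s) / 1"
      using 1 mult_mono[of 1 "cmod s" 1 "cmod t"] nz by (intro divide_left_mono) auto
    finally show ?thesis using 1 by (simp add: folding_def dist_norm norm_minus_commute)
  next
    case 2
    then show ?thesis using mixed by (simp add: folding_def dist_norm)
  next
    case 3
    then show ?thesis using mixed[of t s] by (simp add: folding_def dist_norm norm_minus_commute)
  next
    case 4
    then have "dist (folding s) (folding t) = cmod (cnj (s - t))" by (simp add: folding_def dist_norm)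
    then show ?thesis by (simp only: complex_mod_cnj dist_norm order_refl)
  qed
qed

text \<open>Solving \<open>c0 + x + c1 * \<sigma> x = y\<close> for \<open>x\<close> is a fixed point problem for a contraction.\<close>

lemma perturbed_identity_ext_homeomorphism:
  fixes \<sigma> :: "complex \<Rightarrow> complex"
  assumes \<sigma>: "\<And>x y. dist (\<sigma> x) (\<sigma> y) \<le> dist x y" and c: "cmod c1 < 1"
  shows "homeomorphic_map ext_plane ext_plane (map_option (\<lambda>x. c0 + x + c1 * \<sigma> x))"
proof (rule expanding_map_ext_homeomorphism)
  have L: "cmod (c1 * \<sigma> x - c1 * \<sigma> y) \<le> cmod c1 * dist x y" for x y
    using mult_left_mono[OF \<sigma>[of x y], of "cmod c1"] by (simp add: dist_norm norm_mult flip: right_diff_distrib)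
  have "continuous_on UNIV \<sigma>"
    unfolding continuous_on_iff using \<sigma> by (metis le_less_trans)
  then show "continuous_on UNIV (\<lambda>x. c0 + x + c1 * \<sigma> x)" by (intro continuous_intros)
  show "surj (\<lambda>x. c0 + x + c1 * \<sigma> x)"
    unfolding surj_def
  proof
    fix y
    have "\<exists>!x. y - c0 - c1 * \<sigma> x = x"
    proof (rule banach_fix_type[where c = "cmod c1"])
      show "\<forall>x z. dist (y - c0 - c1 * \<sigma> x) (y - c0 - c1 * \<sigma> z) \<le> cmod c1 * dist x z"
      proof (intro allI)
        fix x z
        show "dist (y - c0 - c1 * \<sigma> x) (y - c0 - c1 * \<sigma> z) \<le> cmod c1 * dist x z"
          using L[of z x] by (simp add: dist_norm norm_minus_commute)
      qed
    qed (use c in auto)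
    then obtain x where "y - c0 - c1 * \<sigma> x = x" by blast
    then have "y = c0 + x + c1 * \<sigma> x" by (simp add: algebra_simps)
    then show "\<exists>x. y = c0 + x + c1 * \<sigma> x" by blast
  qed
  show "1 - cmod c1 > 0" using c by simp
  fix x y
  have "dist x y = cmod (((c0 + x + c1 * \<sigma> x) - (c0 + y + c1 * \<sigma> y)) - (c1 * \<sigma> x - c1 * \<sigma> y))"
    by (simp add: dist_norm)
  also have "\<dots> \<le> dist (c0 + x + c1 * \<sigma> x) (c0 + y + c1 * \<sigma> y) + cmod c1 * dist x y"
    unfolding dist_norm[of "c0 + x + c1 * \<sigma> x"] by (rule order_trans[OF norm_triangle_ineq4 add_left_mono[OF L]])
  finally show "(1 - cmod c1) * dist x y \<le> dist (c0 + x + c1 * \<sigma> x) (c0 + y + c1 * \<sigma> y)"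
    by (simp add: left_diff_distrib)
qed

text \<open>In the coordinate \<open>\<zeta> = 1 / (z - p)\<close>, the affine map \<open>(1 - p\<^sup>2) * \<zeta> - p\<close> is the reciprocal of the Blaschke factor of \<open>p\<close>.  It sends the unit disc to the
exterior of the unit disc, and so the case distinctions in \<open>reflected_pole\<close> and \<open>folding\<close> correspond.\<close>

lemma reflected_pole_as_folding:
  assumes p: "0 \<le> p" "p < 1" and z: "z \<noteq> of_real p"
  defines "\<zeta> \<equiv> 1 / (z - of_real p)"
  shows "(folding (of_real (1 - p\<^sup>2) * \<zeta> - of_real p) + of_real p) / of_real (1 - p\<^sup>2) = reflected_pole p z"
proof -
  let ?p = "complex_of_real p"
  have r: "1 - p\<^sup>2 > 0" using p by (simp add: abs_square_less_1)
  have "1 - ?p\<^sup>2 = of_real (1 - p\<^sup>2)" by simp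
  then have r': "1 - ?p\<^sup>2 \<noteq> 0" using r by (metis less_irrefl of_real_eq_0_iff)
  have zp: "z - ?p \<noteq> 0" using z by simp
  have s: "of_real (1 - p\<^sup>2) * \<zeta> - ?p = (1 - ?p * z) / (z - ?p)"
    using zp by (simp add: \<zeta>_def field_simps power2_eq_square)
  have id: "(cmod (1 - ?p * z))\<^sup>2 - (cmod (z - ?p))\<^sup>2 = (1 - p\<^sup>2) * (1 - (cmod z)\<^sup>2)"
    using blaschke_identity[of ?p z] p by (simp add: norm_minus_commute)
  have big: "1 < cmod ((1 - ?p * z) / (z - ?p)) \<longleftrightarrow> cmod z < 1"
  proof -
    have "1 < cmod ((1 - ?p * z) / (z - ?p)) \<longleftrightarrow> cmod (z - ?p) < cmod (1 - ?p * z)"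
      using zp by (simp add: norm_divide less_divide_eq)
    also have "\<dots> \<longleftrightarrow> (cmod (z - ?p))\<^sup>2 < (cmod (1 - ?p * z))\<^sup>2"
      using power2_less_imp_less[of "cmod (z - ?p)" "cmod (1 - ?p * z)"] power_strict_mono[of "cmod (z - ?p)" "cmod (1 - ?p * z)" 2] by auto
    also have "\<dots> \<longleftrightarrow> 0 < (1 - p\<^sup>2) * (1 - (cmod z)\<^sup>2)" using id by linarith
    also have "\<dots> \<longleftrightarrow> (cmod z)\<^sup>2 < 1" using r by (simp add: zero_less_mult_iff)
    also have "\<dots> \<longleftrightarrow> cmod z < 1" by (simp add: abs_square_less_1)
    finally show ?thesis .
  qed
  show ?thesis
  proof (cases "cmod z < 1")
    case True
    have nz: "1 - ?p * z \<noteq> 0" using denominator_nonzero(1)[OF p, of z] True by simp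
    have f: "folding (of_real (1 - p\<^sup>2) * \<zeta> - ?p) = (z - ?p) / (1 - ?p * z)"
      unfolding s folding_def using True big by simp
    have "(z - ?p) / (1 - ?p * z) + ?p = (1 - ?p\<^sup>2) * (z / (1 - ?p * z))"
      using nz by (simp add: field_simps power2_eq_square)
    then show ?thesis unfolding f using True r' by (simp add: reflected_pole_def)
  next
    case False
    have nz: "cnj z - ?p \<noteq> 0" using denominator_nonzero(3)[OF p, of z] False by simp
    have f: "folding (of_real (1 - p\<^sup>2) * \<zeta> - ?p) = (1 - ?p * cnj z) / (cnj z - ?p)"
      unfolding s folding_def using False big by simp
    have "(1 - ?p * cnj z) / (cnj z - ?p) + ?p = (1 - ?p\<^sup>2) * (1 / (cnj z - ?p))"
      using nz by (simp add: field_simps power2_eq_square)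
    then show ?thesis unfolding f using False r' by (simp add: reflected_pole_def)
  qed
qed

lemma extremal_extension_Some:
  assumes p: "0 \<le> p" "p < 1"
  shows "extremal_extension p c0 c1 (Some z) = (if z = of_real p then None else Some (1 / (z - of_real p) + c0 + c1 * reflected_pole p z))"
  using p by (auto simp: extremal_extension_def extremal_map_def reflected_pole_def)

text \<open>The extension is the composition of a translation, inversion, and the identity perturbed by a multiple of a nonexpansive
map.  That map is the folding conjugated by an affine map, and the conjugation preserves the Lipschitz constant \<open>1\<close>.\<close>

lemma extremal_extension_homeomorphism:
  assumes p: "0 \<le> p" "p < 1" and c: "cmod c1 < 1"
  shows "homeomorphic_map ext_plane ext_plane (extremal_extension p c0 c1)"
proof -
  let ?p = "complex_of_real p"
  define \<rho> where "\<rho> = 1 - p\<^sup>2"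
  have r: "\<rho> > 0" using p by (simp add: \<rho>_def abs_square_less_1)
  define \<sigma> where "\<sigma> \<zeta> = (folding (of_real \<rho> * \<zeta> - ?p) + ?p) / of_real \<rho>" for \<zeta>
  have \<sigma>: "dist (\<sigma> x) (\<sigma> y) \<le> dist x y" for x y
  proof -
    have "\<sigma> x - \<sigma> y = (folding (of_real \<rho> * x - ?p) - folding (of_real \<rho> * y - ?p)) / of_real \<rho>"
      unfolding \<sigma>_def by (simp add: diff_divide_distrib[symmetric])
    then have "dist (\<sigma> x) (\<sigma> y) = dist (folding (of_real \<rho> * x - ?p)) (folding (of_real \<rho> * y - ?p)) / \<rho>"
      using r by (simp add: dist_norm norm_divide)
    also have "\<dots> \<le> dist (of_real \<rho> * x - ?p) (of_real \<rho> * y - ?p) / \<rho>"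
      using r by (intro divide_right_mono folding_nonexpansive) auto
    also have "dist (of_real \<rho> * x - ?p) (of_real \<rho> * y - ?p) = \<rho> * dist x y"
      using r by (simp add: dist_norm norm_mult flip: right_diff_distrib)
    finally show ?thesis using r by simp
  qed
  have shift: "homeomorphic_map ext_plane ext_plane (map_option (\<lambda>z. z - ?p))"
  proof (rule expanding_map_ext_homeomorphism[where m = 1])
    show "continuous_on UNIV (\<lambda>z. z - ?p)" by (intro continuous_intros)
    show "surj (\<lambda>z. z - ?p)" by (rule surjI[where f = "\<lambda>z. z + ?p"]) simp
  qed (simp_all add: dist_norm)
  have "homeomorphic_map ext_plane ext_plane (map_option (\<lambda>x. c0 + x + c1 * \<sigma> x) \<circ> (inversion \<circ> map_option (\<lambda>z. z - ?p)))"
    by (rule homeomorphic_map_compose[OF homeomorphic_map_compose[OF shift inversion_homeomorphism] perturbed_identity_ext_homeomorphism[OF \<sigma> c]])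
  moreover have "map_option (\<lambda>x. c0 + x + c1 * \<sigma> x) \<circ> (inversion \<circ> map_option (\<lambda>z. z - ?p)) = extremal_extension p c0 c1"
  proof
    fix x
    show "(map_option (\<lambda>x. c0 + x + c1 * \<sigma> x) \<circ> (inversion \<circ> map_option (\<lambda>z. z - ?p))) x = extremal_extension p c0 c1 x"
    proof (cases x)
      case None
      have "cmod (- ?p) \<le> 1" using p by simp
      then have "\<sigma> 0 = 0" by (simp add: \<sigma>_def folding_def)
      then show ?thesis by (simp add: None inversion_def extremal_extension_def)
    next
      case (Some z)
      show ?thesis
      proof (cases "z = ?p")
        case False
        have "\<sigma> (1 / (z - ?p)) = reflected_pole p z"
          using reflected_pole_as_folding[OF p False] by (simp add: \<sigma>_def \<rho>_def)
        then show ?thesis using False by (simp add: Some inversion_def extremal_extension_Some[OF p])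
      qed (simp add: Some inversion_def extremal_extension_Some[OF p])
    qed
  qed
  ultimately show ?thesis by simp
qed

text \<open>The derivatives are those of the pole and of \<open>reflected_pole\<close>.  Outside the disc their quotient has modulus exactly \<open>k\<close>, inside the extension is conformal.\<close>

theorem extremal_extension_quasiconformal:
  assumes p: "0 \<le> p" "p < 1" and k: "k < 1" and c: "cmod c1 = k"
  shows "quasiconformal_extension k (extremal_map p c0 c1) (extremal_extension p c0 c1)"
proof -
  let ?p = "complex_of_real p" and ?F = "extremal_extension p c0 c1"
  define U where "U = - {?p}"
  define G where "G z = the (?F (Some z))" for z
  note Fs = extremal_extension_Some[OF p]
  have U: "open U" "{z. ?F (Some z) \<noteq> None} = U" by (auto simp: U_def Fs)
  have GU: "G z = 1 / (z - ?p) + c0 + c1 * reflected_pole p z" if "z \<in> U" for z using that by (simp add: G_def Fs U_def)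
  define h1 where "h1 z = - 1 / (z - ?p)\<^sup>2 + c1 * reflected_pole_dz p z" for z
  define h2 where "h2 z = c1 * reflected_pole_dzbar p z" for z
  have hm [measurable]: "h1 \<in> borel_measurable borel" "h2 \<in> borel_measurable borel"
    unfolding h1_def[abs_def] h2_def[abs_def] by measurable
  have ind: "AE z in lborel. indicator U z *\<^sub>R h z = h z" for h :: "complex \<Rightarrow> complex"
    using AE_lborel_singleton[of ?p] by eventually_elim (simp add: U_def)
  have sbm: "set_borel_measurable lebesgue U h" if [measurable]: "h \<in> borel_measurable borel" for h :: "complex \<Rightarrow> complex"
  proof -
    have [measurable]: "U \<in> sets borel" using U(1) by simp
    have "(\<lambda>z. indicator U z *\<^sub>R h z) \<in> borel_measurable lborel" by measurable
    then show ?thesis unfolding set_borel_measurable_def by (rule measurable_completion)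
  qed
  have L2: "locally_L2_on U h" if [measurable]: "h \<in> borel_measurable borel"
    and bd: "\<And>K. compact K \<Longrightarrow> K \<subseteq> U \<Longrightarrow> \<exists>B. \<forall>z\<in>K. cmod (h z) \<le> B" for h
    unfolding locally_L2_on_def
  proof (intro conjI allI impI)
    show "set_borel_measurable lebesgue U h" by (rule sbm) (rule that(1))
    fix K assume K: "compact K \<and> K \<subseteq> U"
    then obtain B where B: "\<forall>z\<in>K. cmod (h z) \<le> B" using bd by blast
    have [measurable]: "K \<in> sets borel" using K by (simp add: compact_imp_closed)
    have "integrable lborel (\<lambda>z. indicator K z *\<^sub>R (B\<^sup>2))"
      using borel_integrable_compact[of K "\<lambda>_. B\<^sup>2"] K by simp
    then have "integrable lborel (\<lambda>z. indicator K z *\<^sub>R (cmod (h z))\<^sup>2)"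
    proof (rule Bochner_Integration.integrable_bound)
      show "AE z in lborel. norm (indicator K z *\<^sub>R (cmod (h z))\<^sup>2) \<le> norm (indicator K z *\<^sub>R B\<^sup>2)"
        using B by (intro AE_I2) (auto simp: indicator_def intro: power_mono)
    qed measurable
    then show "set_integrable lebesgue K (\<lambda>z. (cmod (h z))\<^sup>2)"
      unfolding set_integrable_def by (subst integrable_completion) auto
  qed
  have L21: "locally_L2_on U h1"
  proof (rule L2[OF hm(1)])
    fix K assume K: "compact K" "K \<subseteq> U"
    have "continuous_on K (\<lambda>z. - 1 / (z - ?p)\<^sup>2)" using K(2) by (intro continuous_intros) (auto simp: U_def)
    then have "compact ((\<lambda>z. - 1 / (z - ?p)\<^sup>2) ` K)" using K(1) by (rule compact_continuous_image)
    then obtain B where B: "\<forall>z\<in>K. cmod (- 1 / (z - ?p)\<^sup>2) \<le> B" using compact_imp_bounded by (fastforce simp: bounded_iff)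
    show "\<exists>B. \<forall>z\<in>K. cmod (h1 z) \<le> B"
    proof (intro exI ballI)
      fix z assume "z \<in> K"
      then have "cmod (- 1 / (z - ?p)\<^sup>2) \<le> B" using B by blast
      moreover have "cmod (c1 * reflected_pole_dz p z) \<le> cmod c1 * (1 / (1 - p)\<^sup>2)"
        unfolding norm_mult by (intro mult_left_mono reflected_pole_bounded[OF p] norm_ge_zero)
      ultimately show "cmod (h1 z) \<le> B + cmod c1 * (1 / (1 - p)\<^sup>2)"
        unfolding h1_def by (rule norm_triangle_mono)
    qed
  qed
  have L22: "locally_L2_on U h2"
  proof (rule L2[OF hm(2)])
    show "\<exists>B. \<forall>z\<in>K. cmod (h2 z) \<le> B" for K
      by (intro exI[of _ "cmod c1 * (1 / (1 - p)\<^sup>2)"] ballI)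
        (auto simp only: h2_def norm_mult intro!: mult_left_mono reflected_pole_bounded[OF p] norm_ge_zero)
  qed
  have Gc: "continuous_on U G"
  proof (rule continuous_on_eq)
    show "continuous_on U (\<lambda>z. 1 / (z - ?p) + c0 + c1 * reflected_pole p z)"
      using reflected_pole_continuous[OF p] by (intro continuous_intros) (auto simp: U_def intro: continuous_on_subset)
  qed (simp add: GU)
  have ids: "(LINT z|lborel. h1 z * \<phi> z) = - (LINT z|lborel. G z * d_z \<phi> z)" "(LINT z|lborel. h2 z * \<phi> z) = - (LINT z|lborel. G z * d_zbar \<phi> z)"
    if \<phi>: "\<phi> \<in> test_functions U" for \<phi>
  proof -
    have \<phi>': "\<phi> \<in> test_functions UNIV" using \<phi> test_functions_mono by blast
    note R = reflected_pole_weak_derivs[OF p]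
    have e: "((\<lambda>z. 1 / (z - ?p) + c0) has_field_derivative - 1 / (z - ?p)\<^sup>2) (at z)" if "z \<in> U" for z
      using that by (auto intro!: derivative_eq_intros simp: U_def power2_eq_square field_simps)
    have ec: "continuous_on U (\<lambda>z. - 1 / (z - ?p)\<^sup>2)" by (intro continuous_intros) (auto simp: U_def)
    have eC: "continuous_on U (\<lambda>z. 1 / (z - ?p) + c0)" by (intro continuous_intros) (auto simp: U_def)
    have HP: "(LINT z|lborel. - 1 / (z - ?p)\<^sup>2 * \<phi> z) = - (LINT z|lborel. (1 / (z - ?p) + c0) * d_z \<phi> z)"
      "(LINT z|lborel. (1 / (z - ?p) + c0) * d_zbar \<phi> z) = 0" "integrable lborel (\<lambda>z. - 1 / (z - ?p)\<^sup>2 * \<phi> z)"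
      by (rule holomorphic_by_parts[OF U(1) \<phi> _ ec], erule e)+
    have I: "integrable lborel (\<lambda>z. reflected_pole_dz p z * \<phi> z)"
      by (rule integrable_test[OF loc_L2_imp_loc_int[OF weak_derivsD(2)[OF R]] \<phi>'])
    have Id: "integrable lborel (\<lambda>z. reflected_pole p z * D z)" if "D \<in> test_functions UNIV" for D
      by (rule integrable_test[OF loc_L2_imp_loc_int[OF loc_L2_continuous[OF weak_derivsD(1)[OF R]]] that])
    have split: "(LINT z|lborel. G z * D z) = (LINT z|lborel. (1 / (z - ?p) + c0) * D z) + c1 * (LINT z|lborel. reflected_pole p z * D z)"
      if D: "D \<in> test_functions U" for D
    proof -
      obtain K where K: "K \<subseteq> U" "\<And>z. z \<notin> K \<Longrightarrow> D z = 0" using test_functionsD(2)[OF D] by metis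
      have "D \<in> test_functions UNIV" using D test_functions_mono by blast
      note J = Id[OF this] set_integral_continuous_test(2)[OF U(1) eC D]
      have "G z * D z = (1 / (z - ?p) + c0) * D z + c1 * (reflected_pole p z * D z)" for z
        using K GU[of z] by (cases "z \<in> K") (auto simp: algebra_simps)
      then have "(LINT z|lborel. G z * D z) = (LINT z|lborel. (1 / (z - ?p) + c0) * D z + c1 * (reflected_pole p z * D z))" by (simp only:)
      also have "\<dots> = (LINT z|lborel. (1 / (z - ?p) + c0) * D z) + (LINT z|lborel. c1 * (reflected_pole p z * D z))"
        by (rule Bochner_Integration.integral_add[OF J(2) integrable_mult_right[OF J(1)]])
      finally show ?thesis by simp
    qed
    have "(LINT z|lborel. h1 z * \<phi> z) = (LINT z|lborel. - 1 / (z - ?p)\<^sup>2 * \<phi> z + c1 * (reflected_pole_dz p z * \<phi> z))"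
      by (rule Bochner_Integration.integral_cong) (simp_all add: h1_def algebra_simps)
    also have "\<dots> = (LINT z|lborel. - 1 / (z - ?p)\<^sup>2 * \<phi> z) + (LINT z|lborel. c1 * (reflected_pole_dz p z * \<phi> z))"
      by (rule Bochner_Integration.integral_add[OF HP(3) integrable_mult_right[OF I]])
    also have "(LINT z|lborel. c1 * (reflected_pole_dz p z * \<phi> z)) = c1 * (LINT z|lborel. reflected_pole_dz p z * \<phi> z)"
      by (rule integral_mult_right_zero)
    finally show "(LINT z|lborel. h1 z * \<phi> z) = - (LINT z|lborel. G z * d_z \<phi> z)"
      unfolding split[OF test_functions_d_z(1)[OF \<phi>]] HP(1) weak_derivsD(4)[OF R \<phi>'] by simp
    have "(LINT z|lborel. h2 z * \<phi> z) = (LINT z|lborel. c1 * (reflected_pole_dzbar p z * \<phi> z))"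
      by (rule Bochner_Integration.integral_cong) (simp_all add: h2_def mult.assoc)
    also have "\<dots> = c1 * (LINT z|lborel. reflected_pole_dzbar p z * \<phi> z)"
      by (rule integral_mult_right_zero)
    finally show "(LINT z|lborel. h2 z * \<phi> z) = - (LINT z|lborel. G z * d_zbar \<phi> z)"
      unfolding split[OF test_functions_d_z(2)[OF \<phi>]] HP(2) weak_derivsD(5)[OF R \<phi>'] by simp
  qed
  have sub: "\<phi> \<in> test_functions UNIV" if "\<phi> \<in> test_functions U" for \<phi> using that test_functions_mono by blast
  have d1: "distr_d_z_on U G h1"
    unfolding distr_d_z_on_def
  proof
    fix \<phi> assume \<phi>: "\<phi> \<in> test_functions U"
    show "(LINT z:U|lebesgue. h1 z * \<phi> z) = - (LINT z:U|lebesgue. G z * d_z \<phi> z)"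
      unfolding set_integral_borel_representative[OF sbm[OF hm(1)] hm(1) ind sub[OF \<phi>]]
        set_integral_continuous_test(1)[OF U(1) Gc test_functions_d_z(1)[OF \<phi>]] by (rule ids(1)[OF \<phi>])
  qed
  have d2: "distr_d_zbar_on U G h2"
    unfolding distr_d_zbar_on_def
  proof
    fix \<phi> assume \<phi>: "\<phi> \<in> test_functions U"
    show "(LINT z:U|lebesgue. h2 z * \<phi> z) = - (LINT z:U|lebesgue. G z * d_zbar \<phi> z)"
      unfolding set_integral_borel_representative[OF sbm[OF hm(2)] hm(2) ind sub[OF \<phi>]]
        set_integral_continuous_test(1)[OF U(1) Gc test_functions_d_z(2)[OF \<phi>]] by (rule ids(2)[OF \<phi>])
  qed
  have dil: "cmod (h2 z) \<le> k * cmod (h1 z)" for z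
  proof (cases "cmod z < 1")
    case True
    have "0 \<le> k" using c norm_ge_zero[of c1] by simp
    then show ?thesis using True by (simp add: h2_def reflected_pole_dzbar_def)
  next
    case False
    have "cmod (cnj z - ?p) = cmod (z - ?p)" by (metis complex_cnj_complex_of_real complex_cnj_diff complex_mod_cnj)
    then show ?thesis using False c
      by (simp add: h1_def h2_def reflected_pole_dz_def reflected_pole_dzbar_def norm_mult norm_divide norm_power)
  qed
  have "quasiconformal k ?F"
    unfolding quasiconformal_def Let_def U(2) G_def[abs_def, symmetric]
  proof (intro conjI exI)
    show "homeomorphic_map ext_plane ext_plane ?F"
      by (rule extremal_extension_homeomorphism[OF p]) (use c k in simp)
    show "locally_L2_on U h1" "locally_L2_on U h2" "distr_d_z_on U G h1" "distr_d_zbar_on U G h2" by fact+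
    show "AE z in lebesgue. z \<in> U \<longrightarrow> cmod (h2 z) \<le> k * cmod (h1 z)" using dil by simp
  qed
  moreover have "?F (Some z) = extremal_map p c0 c1 z" if "z \<in> unit_disc" for z
    using that by (simp add: extremal_extension_def)
  ultimately show ?thesis unfolding quasiconformal_extension_def by blast
qed

section \<open>The coefficient inequality\<close>

text \<open>The area formula for the derivative of \<open>\<Sum>n. a n * z^n\<close>.\<close>

lemma coefficient_area:
  assumes sm: "\<And>z. cmod z < 1 \<Longrightarrow> summable (\<lambda>n. a n * z ^ n)"
    and h: "integrable lborel (\<lambda>z. (cmod (h z))\<^sup>2)" "h \<in> borel_measurable borel"
    and eq: "AE z in lborel. cmod z < 1 \<longrightarrow> h z = (\<Sum>n. diffs a n * z ^ n)"
  shows "((\<lambda>n. real n * (cmod (a n))\<^sup>2) has_sum ((LINT z|lborel. indicator (ball 0 1) z * (cmod (h z))\<^sup>2) / pi)) {1..}"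
proof -
  let ?S = "\<lambda>z. \<Sum>n. diffs a n * z ^ n"
  let ?A = "LINT z|lborel. indicator (ball 0 1) z * (cmod (h z))\<^sup>2"
  have [measurable]: "ball (0::complex) 1 \<in> sets borel" by simp
  note [measurable] = h(2)
  have sm': "summable (\<lambda>n. diffs a n * z ^ n)" if "cmod z < 1" for z
    by (rule termdiff_converges[OF that sm])
  have "continuous_on (ball 0 1) ?S"
    by (intro continuous_at_imp_continuous_on ballI DERIV_isCont[OF termdiffs_strong'[where K = 1, OF sm']]) auto
  then have "(\<lambda>z. indicator (ball 0 1) z *\<^sub>R ?S z) \<in> borel_measurable borel"
    by (intro borel_measurable_continuous_on_indicator) auto
  then have "(\<lambda>z. (cmod (indicator (ball 0 1) z *\<^sub>R ?S z))\<^sup>2) \<in> borel_measurable borel" by measurable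
  moreover have "(cmod (indicator (ball 0 1) z *\<^sub>R ?S z))\<^sup>2 = indicator (ball 0 1) z * (cmod (?S z))\<^sup>2" for z
    by (simp add: indicator_def)
  ultimately have m: "(\<lambda>z. indicator (ball 0 1) z * (cmod (?S z))\<^sup>2) \<in> borel_measurable lborel" by simp
  have m': "(\<lambda>z. indicator (ball 0 1) z * (cmod (h z))\<^sup>2) \<in> borel_measurable lborel" by measurable
  have ae: "AE z in lborel. indicator (ball 0 1) z * (cmod (?S z))\<^sup>2 = indicator (ball 0 1) z * (cmod (h z))\<^sup>2"
    using eq by eventually_elim (auto simp: indicator_def)
  have I: "integrable lborel (\<lambda>z. indicator (ball 0 1) z * (cmod (?S z))\<^sup>2)"
    using integrable_cong_AE[OF m m' ae] integral_split_circle(1)[OF h(1)] by simp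
  have "(\<lambda>n. pi * (cmod (diffs a n))\<^sup>2 / (n + 1)) sums ?A"
    using disc_area_formula[OF sm' I] integral_cong_AE[OF m m' ae] by simp
  from sums_divide[OF this, of pi]
  have "(\<lambda>n. pi * (cmod (diffs a n))\<^sup>2 / (n + 1) / pi) sums (?A / pi)" .
  moreover have "pi * (cmod (diffs a n))\<^sup>2 / (n + 1) / pi = real (Suc n) * (cmod (a (Suc n)))\<^sup>2" for n
  proof -
    define x where "x = real (Suc n)"
    have x: "x \<noteq> 0" "real n + 1 = x" "real (n + 1) = x" by (simp_all add: x_def)
    have "cmod (diffs a n) = x * cmod (a (Suc n))" unfolding diffs_def norm_mult norm_of_nat x_def ..
    then have "pi * (cmod (diffs a n))\<^sup>2 / (n + 1) / pi = pi * (x * cmod (a (Suc n)))\<^sup>2 / x / pi" by (simp only: x(2,3))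
    also have "\<dots> = x * (cmod (a (Suc n)))\<^sup>2" using x(1) by (simp add: power2_eq_square)
    finally show ?thesis by (simp only: x_def)
  qed
  ultimately have s: "(\<lambda>n. real (Suc n) * (cmod (a (Suc n)))\<^sup>2) sums (?A / pi)" by simp
  have "((\<lambda>n. real (Suc n) * (cmod (a (Suc n)))\<^sup>2) has_sum (?A / pi)) UNIV"
    by (rule norm_summable_imp_has_sum[OF _ s]) (use sums_summable[OF s] in simp)
  then have "((\<lambda>n. real n * (cmod (a n))\<^sup>2) has_sum (?A / pi)) (range Suc)"
    by (subst has_sum_reindex) (auto simp: o_def)
  moreover have "range Suc = {1..}" by (auto simp: image_iff) (metis Suc_pred' less_eq_Suc_le)
  ultimately show ?thesis by simp
qed

text \<open>The estimate is \<open>exterior_energy\<close>, and the form of the extremal functions is \<open>equality_case\<close>.  Conversely an extremal function has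
\<open>h = c1 * reflected_pole_dz p\<close> in the disc, and its energy is known from \<open>reflected_pole_energy\<close>.\<close>

lemma coefficient_inequality:
  assumes k: "0 \<le> k" "k < 1" and p: "0 \<le> p" "p < 1"
    and f: "f \<in> Sigma_qc_class k p" and ex: "has_Sigma_expansion f p a"
  shows "(\<lambda>n. real n * (cmod (a n))\<^sup>2) summable_on {1..}"
    "(\<Sum>\<^sub>\<infinity>n\<in>{1..}. real n * (cmod (a n))\<^sup>2) \<le> k\<^sup>2 / (1 - p\<^sup>2)\<^sup>2"
    "(\<Sum>\<^sub>\<infinity>n\<in>{1..}. real n * (cmod (a n))\<^sup>2) = k\<^sup>2 / (1 - p\<^sup>2)\<^sup>2 \<longleftrightarrow>
       (\<exists>c0 c1. cmod c1 = k \<and> (\<forall>z\<in>unit_disc. f z = extremal_map p c0 c1 z))"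
proof -
  obtain F where F: "quasiconformal k F" "\<And>z. z \<in> unit_disc \<Longrightarrow> F (Some z) = f z"
    using f by (auto simp: Sigma_qc_class_def quasiconformal_extension_def)
  obtain g h w M where R: "weak_derivs g h w" "\<And>z. cmod (g z) \<le> M"
    "\<And>z. cmod z < 1 \<Longrightarrow> g z = (\<Sum>n. a n * z ^ n)"
    "AE z in lborel. cmod z < 1 \<longrightarrow> w z = 0 \<and> h z = (\<Sum>n. diffs a n * z ^ n)"
    "AE z in lborel. 1 \<le> cmod z \<longrightarrow> cmod (w z) \<le> k * cmod (h z - 1 / (z - of_real p)\<^sup>2)"
    by (rule qc_reduction[OF p F(1) ex F(2)]) blast+
  let ?S = "\<lambda>z. \<Sum>n. diffs a n * z ^ n"
  have sm: "summable (\<lambda>n. a n * z ^ n)" if "cmod z < 1" for z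
    using ex that by (auto simp: has_Sigma_expansion_def)
  note X = exterior_energy[OF p k R(1,2,4,5)]
  define A where "A = (LINT z|lborel. indicator (ball 0 1) z * (cmod (h z))\<^sup>2)"
  define B where "B = (LINT z|lborel. indicator (- ball 0 1) z * (cmod (h z))\<^sup>2)"
  define P where "P = pi / (1 - p\<^sup>2)\<^sup>2"
  have k2: "k\<^sup>2 < 1" using k by (simp add: abs_square_less_1)
  have hm: "h \<in> borel_measurable borel" using weak_derivsD(2)[OF R(1)] by (simp add: loc_L2_def)
  have hS: "AE z in lborel. cmod z < 1 \<longrightarrow> h z = ?S z" using R(4) by eventually_elim blast
  have AB: "A + B \<le> k\<^sup>2 * (B + P)" "0 \<le> B" using X(5,6) by (simp_all add: A_def B_def P_def)
  have "k\<^sup>2 * B \<le> 1 * B" using k2 AB(2) by (intro mult_right_mono) auto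
  then have AP: "A \<le> k\<^sup>2 * P" using AB(1) by (simp add: distrib_left)
  have hs: "((\<lambda>n. real n * (cmod (a n))\<^sup>2) has_sum (A / pi)) {1..}"
    unfolding A_def by (rule coefficient_area[OF sm X(1) hm hS])
  then show "(\<lambda>n. real n * (cmod (a n))\<^sup>2) summable_on {1..}" by (auto simp: summable_on_def)
  have inf: "(\<Sum>\<^sub>\<infinity>n\<in>{1..}. real n * (cmod (a n))\<^sup>2) = A / pi" by (rule infsumI[OF hs])
  have Pp: "k\<^sup>2 / (1 - p\<^sup>2)\<^sup>2 = (k\<^sup>2 * P) / pi" by (simp add: P_def)
  show "(\<Sum>\<^sub>\<infinity>n\<in>{1..}. real n * (cmod (a n))\<^sup>2) \<le> k\<^sup>2 / (1 - p\<^sup>2)\<^sup>2"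
    unfolding inf Pp using AP by (simp add: divide_right_mono)
  have gd: "(g has_field_derivative ?S z) (at z)" if z: "cmod z < 1" for z
  proof (rule has_field_derivative_transform_within_open[where S = unit_disc])
    show "((\<lambda>z. \<Sum>n. a n * z ^ n) has_field_derivative ?S z) (at z)" by (rule termdiffs_strong'[OF sm z])
  qed (use z R(3) in auto)
  have "A = k\<^sup>2 * P \<longleftrightarrow> (\<exists>c0 c1. cmod c1 = k \<and> (\<forall>z\<in>unit_disc. f z = extremal_map p c0 c1 z))"
  proof
    assume "A = k\<^sup>2 * P"
    then have eq: "(LINT z|lborel. indicator (ball 0 1) z * (cmod (h z))\<^sup>2) = k\<^sup>2 * (pi / (1 - p\<^sup>2)\<^sup>2)"
      by (simp add: A_def P_def)
    obtain c0 c1 where c: "cmod c1 = k" "\<And>z. cmod z < 1 \<Longrightarrow> g z = c0 + c1 * reflected_pole p z"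
      by (rule equality_case[OF p k R(1,2) gd R(4,5) eq]) blast+
    have "f z = extremal_map p c0 c1 z" if z: "z \<in> unit_disc" for z
    proof -
      have "(\<Sum>n. a n * z ^ n) = c0 + c1 * (z / (1 - of_real p * z))"
        using c(2)[of z] R(3)[of z] z by (simp add: reflected_pole_def)
      then show ?thesis using ex z by (auto simp: has_Sigma_expansion_def extremal_map_def)
    qed
    then show "\<exists>c0 c1. cmod c1 = k \<and> (\<forall>z\<in>unit_disc. f z = extremal_map p c0 c1 z)" using c(1) by blast
  next
    assume "\<exists>c0 c1. cmod c1 = k \<and> (\<forall>z\<in>unit_disc. f z = extremal_map p c0 c1 z)"
    then obtain c0 c1 where c: "cmod c1 = k" "\<And>z. z \<in> unit_disc \<Longrightarrow> f z = extremal_map p c0 c1 z" by blast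
    let ?V = "unit_disc - {complex_of_real p}"
    have gV: "g z = c0 + c1 * (z / (1 - of_real p * z))" if z: "z \<in> ?V" for z
    proof -
      have "Some (1 / (z - of_real p) + (\<Sum>n. a n * z ^ n)) = Some (1 / (z - of_real p) + c0 + c1 * z / (1 - of_real p * z))"
        using ex c(2)[of z] z by (auto simp: has_Sigma_expansion_def extremal_map_def)
      then show ?thesis using R(3)[of z] z by simp
    qed
    have SV: "?S z = c1 * reflected_pole_dz p z" if z: "z \<in> ?V" for z
    proof -
      have zD: "cmod z < 1" using z by simp
      have nz: "1 - of_real p * z \<noteq> 0" using denominator_nonzero(1)[OF p, of z] zD by simp
      have "((\<lambda>z. c0 + c1 * (z / (1 - of_real p * z))) has_field_derivative c1 * reflected_pole_dz p z) (at z)"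
        using nz zD by (auto intro!: derivative_eq_intros simp: reflected_pole_dz_def power2_eq_square field_simps)
      then have "(g has_field_derivative c1 * reflected_pole_dz p z) (at z)"
        by (rule has_field_derivative_transform_within_open[where S = ?V]) (use z gV in \<open>auto simp: open_Diff\<close>)
      then show ?thesis using gd[OF zD] DERIV_unique by blast
    qed
    have "A = (LINT z|lborel. k\<^sup>2 * (cmod (reflected_pole_dz p z))\<^sup>2)"
      unfolding A_def
    proof (rule integral_cong_AE)
      note [measurable] = hm
      have [measurable]: "ball (0::complex) 1 \<in> sets borel" by simp
      show "(\<lambda>z. indicator (ball 0 1) z * (cmod (h z))\<^sup>2) \<in> borel_measurable lborel"
        "(\<lambda>z. k\<^sup>2 * (cmod (reflected_pole_dz p z))\<^sup>2) \<in> borel_measurable lborel" by measurable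
      show "AE z in lborel. indicator (ball 0 1) z * (cmod (h z))\<^sup>2 = k\<^sup>2 * (cmod (reflected_pole_dz p z))\<^sup>2"
        using hS AE_lborel_singleton[of "complex_of_real p"]
      proof eventually_elim
        case (elim z)
        show ?case
        proof (cases "cmod z < 1")
          case True
          then have "h z = c1 * reflected_pole_dz p z" using elim SV[of z] by simp
          then show ?thesis using True c(1) by (simp add: norm_mult power_mult_distrib)
        qed (simp add: reflected_pole_dz_def)
      qed
    qed
    also have "\<dots> = k\<^sup>2 * P" unfolding P_def reflected_pole_energy(1)[OF p, symmetric] by (rule integral_mult_right_zero)
    finally show "A = k\<^sup>2 * P" .
  qed
  then show "(\<Sum>\<^sub>\<infinity>n\<in>{1..}. real n * (cmod (a n))\<^sup>2) = k\<^sup>2 / (1 - p\<^sup>2)\<^sup>2 \<longleftrightarrow>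
       (\<exists>c0 c1. cmod c1 = k \<and> (\<forall>z\<in>unit_disc. f z = extremal_map p c0 c1 z))"
    unfolding inf Pp by simp
qed

theorem theorem1:
  fixes k p :: real
  assumes "0 \<le> k" "k < 1" "0 \<le> p" "p < 1"
  shows "(\<forall>f a. f \<in> Sigma_qc_class k p \<and> has_Sigma_expansion f p a \<longrightarrow>
            (\<lambda>n. real n * (cmod (a n))\<^sup>2) summable_on {1..} \<and>
            (\<Sum>\<^sub>\<infinity>n\<in>{1..}. real n * (cmod (a n))\<^sup>2) \<le> k\<^sup>2 / (1 - p\<^sup>2)\<^sup>2 \<and>
            ((\<Sum>\<^sub>\<infinity>n\<in>{1..}. real n * (cmod (a n))\<^sup>2) = k\<^sup>2 / (1 - p\<^sup>2)\<^sup>2 \<longleftrightarrow>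
              (\<exists>c\<^sub>0 c\<^sub>1. cmod c\<^sub>1 = k \<and> (\<forall>z\<in>unit_disc. f z = extremal_map p c\<^sub>0 c\<^sub>1 z)))) \<and>
         (\<forall>c\<^sub>0 c\<^sub>1. cmod c\<^sub>1 = k \<longrightarrow>
            quasiconformal_extension k (extremal_map p c\<^sub>0 c\<^sub>1) (extremal_extension p c\<^sub>0 c\<^sub>1))"
proof (intro conjI allI impI)
  fix f a assume "f \<in> Sigma_qc_class k p \<and> has_Sigma_expansion f p a"
  then have "f \<in> Sigma_qc_class k p" "has_Sigma_expansion f p a" by blast+
  note C = coefficient_inequality[OF assms this]
  show "(\<lambda>n. real n * (cmod (a n))\<^sup>2) summable_on {1..}"
    "(\<Sum>\<^sub>\<infinity>n\<in>{1..}. real n * (cmod (a n))\<^sup>2) \<le> k\<^sup>2 / (1 - p\<^sup>2)\<^sup>2"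
    "(\<Sum>\<^sub>\<infinity>n\<in>{1..}. real n * (cmod (a n))\<^sup>2) = k\<^sup>2 / (1 - p\<^sup>2)\<^sup>2 \<longleftrightarrow>
      (\<exists>c\<^sub>0 c\<^sub>1. cmod c\<^sub>1 = k \<and> (\<forall>z\<in>unit_disc. f z = extremal_map p c\<^sub>0 c\<^sub>1 z))"
    by (fact C)+
next
  fix c\<^sub>0 c\<^sub>1 :: complex assume "cmod c\<^sub>1 = k"
  then show "quasiconformal_extension k (extremal_map p c\<^sub>0 c\<^sub>1) (extremal_extension p c\<^sub>0 c\<^sub>1)"
    by (rule extremal_extension_quasiconformal[OF assms(3,4,2)])
qed

end
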